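(* Let $n\ge1$, $K>0$, and let $f\in L^\infty(Q_1)$ with $f\le0$ a.e. in $Q_1$ and $\|f\|_{L^\infty(Q_1)}\le K$. Let $u\in C(Q_1)$ be a nonnegative weak solution to $$\partial_t u-\Delta u=f\quad\text{in }Q_1$$ with $\|u\|_{L^\infty(Q_1)}\le K$. Further, assume that $f$ is constant in $\{u>0\}\cap Q_1$. Then there exists a constant $C>0$ depending only on $n$ and $K$ such that $$\|\partial_t u\|_{L^\infty(Q_{1/2})}+\|D^2u\|_{L^\infty(Q_{1/2})}\le C.$$ In addition, for every $(y,\tau)\in\{u>0\}\cap Q_{1/2}$ we have $$|\nabla u(y,\tau)|\le C\delta,\qquad\text{where }\ \delta:=\sup\{\rho>0:Q_\rho(y,\tau)\subset\{u>0\}\}.$$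
   Context: Parabolic cylinders: $Q_r(x_0,t_0):=\{(x,t)\in\mathbb{R}^n\times\mathbb{R}:|x-x_0|<r,\ |t-t_0|<r^2\}$, and $Q_r:=Q_r(0,0)$. $\nabla$, $D^2$ and $\Delta$ denote the gradient, Hessian and Laplacian in the $x$ variables only. $\{u>0\}$ is a subset of $Q_1$, the domain of $u$. *)

theory Defs
  imports "HOL-Probability.Essential_Supremum"
begin

section \<open>Space-time and parabolic cylinders\<close>

type_synonym 'n spacetime = "(real ^ 'n) \<times> real"

definition parabolic_cylinder :: "real \<Rightarrow> 'n::finite spacetime \<Rightarrow> 'n spacetime set" where
  "parabolic_cylinder r z0 =
     {z. norm (fst z - fst z0) < r \<and> \<bar>snd z - snd z0\<bar> < r\<^sup>2}"

abbreviation Q0 :: "real \<Rightarrow> 'n::finite spacetime set" where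
  "Q0 r \<equiv> parabolic_cylinder r (0, 0)"

definition space_dir :: "'n::finite \<Rightarrow> 'n spacetime" where
  "space_dir i = (axis i 1, 0)"

definition time_dir :: "'n::finite spacetime" where
  "time_dir = (0, 1)"

text \<open>Functions are total, but the domain of \<open>u\<close> is the unit cylinder: its values elsewhere
  are irrelevant, and the positivity set is a subset of the unit cylinder.\<close>

definition positivity_set :: "('n::finite spacetime \<Rightarrow> real) \<Rightarrow> 'n spacetime set" where
  "positivity_set u = {z \<in> Q0 1. u z > 0}"

section \<open>Test functions\<close>

definition dir_deriv :: "'a::real_normed_vector \<Rightarrow> ('a \<Rightarrow> real) \<Rightarrow> 'a \<Rightarrow> real" where
  "dir_deriv v \<phi> z = frechet_derivative \<phi> (at z) v"

fun Ck :: "nat \<Rightarrow> ('a::euclidean_space \<Rightarrow> real) \<Rightarrow> bool" where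
  "Ck 0 \<phi> \<longleftrightarrow> continuous_on UNIV \<phi>"
| "Ck (Suc k) \<phi> \<longleftrightarrow>
     (\<forall>z. \<phi> differentiable (at z)) \<and> (\<forall>v. Ck k (dir_deriv v \<phi>))"

text \<open>The elements of \<open>C\<^sub>c\<^sup>\<infinity>(\<Omega>)\<close>, extended by zero to the whole space.\<close>

definition test_function :: "'a::euclidean_space set \<Rightarrow> ('a \<Rightarrow> real) \<Rightarrow> bool" where
  "test_function \<Omega> \<phi> \<longleftrightarrow>
     (\<forall>k. Ck k \<phi>) \<and> compact (closure {z. \<phi> z \<noteq> 0}) \<and> closure {z. \<phi> z \<noteq> 0} \<subseteq> \<Omega>"

section \<open>Weak derivatives and weak solutions\<close>

definition locally_integrable_on ::
    "('a::euclidean_space \<Rightarrow> real) \<Rightarrow> 'a set \<Rightarrow> bool" where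
  "locally_integrable_on g \<Omega> \<longleftrightarrow>
     (\<forall>S. compact S \<and> S \<subseteq> \<Omega> \<longrightarrow> set_integrable lebesgue S g)"

text \<open>\<open>has_weak_deriv \<Omega> vs u g\<close>: on the open set \<open>\<Omega>\<close>, the weak derivative of \<open>u\<close> taken
  successively in the directions listed in \<open>vs\<close> is represented by the function \<open>g\<close>.\<close>

definition has_weak_deriv ::
    "'a::euclidean_space set \<Rightarrow> 'a list \<Rightarrow> ('a \<Rightarrow> real) \<Rightarrow> ('a \<Rightarrow> real) \<Rightarrow> bool" where
  "has_weak_deriv \<Omega> vs u g \<longleftrightarrow>
     locally_integrable_on u \<Omega> \<and> locally_integrable_on g \<Omega> \<and>
     (\<forall>\<phi>. test_function \<Omega> \<phi> \<longrightarrow>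
        set_lebesgue_integral lebesgue \<Omega> (\<lambda>z. u z * foldr dir_deriv vs \<phi> z) =
        (- 1) ^ length vs * set_lebesgue_integral lebesgue \<Omega> (\<lambda>z. g z * \<phi> z))"

definition has_weak_time_deriv ::
    "'n::finite spacetime set \<Rightarrow> ('n spacetime \<Rightarrow> real) \<Rightarrow> ('n spacetime \<Rightarrow> real) \<Rightarrow> bool" where
  "has_weak_time_deriv \<Omega> u g \<longleftrightarrow> has_weak_deriv \<Omega> [time_dir] u g"

definition has_weak_hessian ::
    "'n::finite spacetime set \<Rightarrow> ('n spacetime \<Rightarrow> real) \<Rightarrow> ('n spacetime \<Rightarrow> real ^ 'n ^ 'n) \<Rightarrow> bool" where
  "has_weak_hessian \<Omega> u H \<longleftrightarrow>
     (\<forall>i j. has_weak_deriv \<Omega> [space_dir i, space_dir j] u (\<lambda>z. H z $ i $ j))"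

definition laplacian_x :: "('n::finite spacetime \<Rightarrow> real) \<Rightarrow> 'n spacetime \<Rightarrow> real" where
  "laplacian_x \<phi> z = (\<Sum>i\<in>UNIV. dir_deriv (space_dir i) (dir_deriv (space_dir i) \<phi>) z)"

text \<open>Weak solutions of \<open>\<partial>\<^sub>t u - \<Delta> u = f\<close> in \<open>\<Omega>\<close>, in the sense of distributions: all
  derivatives are moved onto the test function. No spatial weak gradient of \<open>u\<close> is
  presupposed, so this also covers solutions in the energy sense.\<close>

definition weak_heat_solution ::
    "'n::finite spacetime set \<Rightarrow> ('n spacetime \<Rightarrow> real) \<Rightarrow> ('n spacetime \<Rightarrow> real) \<Rightarrow> bool" where
  "weak_heat_solution \<Omega> f u \<longleftrightarrow>
     locally_integrable_on u \<Omega> \<and> locally_integrable_on f \<Omega> \<and>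
     (\<forall>\<phi>. test_function \<Omega> \<phi> \<longrightarrow>
        set_lebesgue_integral lebesgue \<Omega> (\<lambda>z. u z * (- dir_deriv time_dir \<phi> z - laplacian_x \<phi> z)) =
        set_lebesgue_integral lebesgue \<Omega> (\<lambda>z. f z * \<phi> z))"

section \<open>The essential supremum norm\<close>

text \<open>For matrix-valued functions the pointwise norm is the Frobenius norm. The value is
  \<open>\<infinity>\<close> if the pointwise norm is not measurable on \<open>\<Omega>\<close>.\<close>

definition Linf_norm :: "'a::euclidean_space set \<Rightarrow> ('a \<Rightarrow> 'b::real_normed_vector) \<Rightarrow> ereal" where
  "Linf_norm \<Omega> g = esssup (lebesgue_on \<Omega>) (\<lambda>z. ereal (norm (g z)))"

end

theory Submission
  imports Defs "HOL-Probability.Distributions"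
begin

text \<open>
  All estimates come from testing the equation with functions built from the regularised heat kernel
  \<open>\<tau>\<^bsup>-n/2\<^esup> exp (- (|x|\<^sup>2 + \<epsilon>) / 4\<tau>)\<close>, which is smooth on all of space-time.

  Growth at a zero \<open>z\<^sub>0\<close> of \<open>u\<close>: a convex truncation of the kernel with pole \<open>z\<^sub>0\<close> minus a barrier is a compactly
  supported subsolution of the adjoint equation away from the pole; since \<open>u z\<^sub>0 = 0\<close>, it bounds the integral of \<open>u\<close> over
  an earlier set. The kernel with pole near \<open>z\<^sub>0\<close>, times a cutoff, bounds \<open>u\<close> there by this integral plus a small multiple of
  \<open>sup u\<close>; here \<open>f \<le> 0\<close> enters. Iterating over scales yields \<open>u \<le> A r\<^sup>2\<close> on two-sided cylinders \<open>Q\<^sub>r(z\<^sub>0)\<close>.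

  Interior estimates: in \<open>{u > 0}\<close> the function \<open>u - c t\<close> is weakly caloric, and the cut-off kernel represents it as a
  convolution with a smooth function. Scaled to cylinders of radius comparable to \<open>\<delta>\<close>, this and the growth
  bound give \<open>|\<nabla>u| \<le> C\<delta>\<close>, \<open>|D\<^sup>2u| + |\<partial>\<^sub>t u| \<le> C\<close>, and then \<open>|\<nabla>u|\<^sup>2 \<le> C u\<close> by Taylor expansion.

  Across the free boundary the weak derivatives are the classical ones on \<open>{u > 0}\<close> extended by \<open>0\<close>, as limits of smooth truncations of \<open>u\<close>.
\<close>

section \<open>Functions of class \<open>C\<^sup>k\<close> on open sets\<close>

text \<open>The equation is available only against smooth compactly supported functions, whereas
  heat kernels are singular at the pole. For \<epsilon> > 0 a cut-off kernel is an honest test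
  function, and the adjoint operator turns it into an explicit approximate identity; letting
  \<epsilon> tend to 0 reads off point values of the merely continuous \<open>u\<close>.

  Mean value bounds for heat equations look into the past, yet growth is needed also after the time
  of the zero. The two signs share the work: the lower bound of the heat operator makes
  \<open>u\<close> small before the zero, and the upper bound 0 carries this smallness forward past
  it.

  Scaling fixes what must be proved: passing from radius r to \<open>sqrt s * r\<close> multiplies
  r^2 by s, so the contribution of the old supremum has to come with a factor strictly below s; s/2
  is obtained, and the iteration closes.

  Nothing is known about the free boundary, not even that it is a null set. The Hessian is therefore
  never examined there; truncations vanish near it, and the error they create on
  \<open>{u > 0}\<close> is bounded and tends to 0 pointwise.\<close>

lemma dir_deriv_eq: "(f has_derivative f') (at z) \<Longrightarrow> dir_deriv v f z = f' v"
  unfolding dir_deriv_def using frechet_derivative_at by metis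

lemma dir_deriv_has_derivative:
  "f differentiable (at z) \<Longrightarrow> (f has_derivative (\<lambda>v. dir_deriv v f z)) (at z)"
  unfolding dir_deriv_def using frechet_derivative_works by metis

text \<open>A local version of \<open>Ck\<close> is needed because the kernel is smooth only off its
  pole and \<open>u\<close> only where it is positive. Derivatives are unrestricted
  (\<open>at z\<close>), so the notion is meant for open \<open>S\<close>.\<close>

fun Ck_on :: "nat \<Rightarrow> 'a::euclidean_space set \<Rightarrow> ('a \<Rightarrow> real) \<Rightarrow> bool" where
  "Ck_on 0 S f \<longleftrightarrow> continuous_on S f"
| "Ck_on (Suc k) S f \<longleftrightarrow>
     (\<forall>z\<in>S. f differentiable (at z)) \<and> (\<forall>v. Ck_on k S (dir_deriv v f))"

definition smooth_on :: "'a::euclidean_space set \<Rightarrow> ('a \<Rightarrow> real) \<Rightarrow> bool" where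
  "smooth_on S f \<longleftrightarrow> (\<forall>k. Ck_on k S f)"

lemma Ck_iff_Ck_on: "Ck k f \<longleftrightarrow> Ck_on k UNIV f"
  by (induction k arbitrary: f) auto

lemma smooth_on_UNIV: "smooth_on UNIV f \<longleftrightarrow> (\<forall>k. Ck k f)"
  by (simp add: smooth_on_def Ck_iff_Ck_on)

lemma dir_deriv_cong_open:
  assumes "open S" "z \<in> S" "\<And>w. w \<in> S \<Longrightarrow> f w = g w" "f differentiable (at z)"
  shows "g differentiable (at z)" "dir_deriv v f z = dir_deriv v g z"
proof -
  have "(f has_derivative (\<lambda>v. dir_deriv v f z)) (at z)"
    using assms(4) dir_deriv_has_derivative by blast
  then have *: "(g has_derivative (\<lambda>v. dir_deriv v f z)) (at z)"
    using assms has_derivative_transform_within_open by (metis (no_types, lifting))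
  then show "g differentiable (at z)" unfolding differentiable_def by blast
  show "dir_deriv v f z = dir_deriv v g z" using dir_deriv_eq[OF *] by simp
qed

lemma Ck_on_cong_imp:
  assumes "open S" "\<And>w. w \<in> S \<Longrightarrow> f w = g w" "Ck_on k S f"
  shows "Ck_on k S g"
  using assms(2,3)
proof (induction k arbitrary: f g)
  case 0
  then show ?case using continuous_on_cong by (metis Ck_on.simps(1))
next
  case (Suc k)
  have d: "\<And>z. z \<in> S \<Longrightarrow> f differentiable (at z)" using Suc by simp
  have "Ck_on k S (dir_deriv v g)" for v
    apply (rule Suc.IH[of "dir_deriv v f"])
    using dir_deriv_cong_open(2)[OF assms(1) _ Suc.prems(1) d] Suc.prems by auto
  moreover have "\<And>z. z \<in> S \<Longrightarrow> g differentiable (at z)"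
    using dir_deriv_cong_open(1)[OF assms(1) _ Suc.prems(1) d] by auto
  ultimately show ?case by simp
qed

lemma Ck_on_subset: "Ck_on k S f \<Longrightarrow> T \<subseteq> S \<Longrightarrow> Ck_on k T f"
  by (induction k arbitrary: f) (auto intro: continuous_on_subset)

text \<open>Smoothness gets glued from local pieces: for the kernel around its pole, for truncations
  of \<open>u\<close> across the free boundary.\<close>

lemma Ck_on_Union:
  assumes "\<And>z. z \<in> S \<Longrightarrow> \<exists>T. open T \<and> z \<in> T \<and> Ck_on k T f"
  shows "Ck_on k S f"
  using assms
proof (induction k arbitrary: f)
  case 0
  have "continuous (at z within S) f" if zS: "z \<in> S" for z
  proof -
    obtain T where "open T" "z \<in> T" "continuous_on T f" using 0[OF zS] by auto
    then have "isCont f z" by (simp add: continuous_on_eq_continuous_at)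
    then show ?thesis by (rule continuous_at_imp_continuous_at_within)
  qed
  then show ?case by (simp add: continuous_on_eq_continuous_within)
next
  case (Suc k)
  have "f differentiable (at z)" if "z \<in> S" for z using Suc.prems[OF that] by auto
  moreover have "Ck_on k S (dir_deriv v f)" for v
  proof (rule Suc.IH)
    fix z assume "z \<in> S"
    then show "\<exists>T. open T \<and> z \<in> T \<and> Ck_on k T (dir_deriv v f)" using Suc.prems by fastforce
  qed
  ultimately show ?case by simp
qed

lemma Ck_on_continuous: "Ck_on k S f \<Longrightarrow> continuous_on S f"
  by (cases k) (auto simp: continuous_at_imp_continuous_on differentiable_imp_continuous_within)

lemma Ck_on_SucD: "Ck_on (Suc k) S f \<Longrightarrow> Ck_on k S f"
proof (induction k arbitrary: f)
  case 0
  then show ?case using Ck_on_continuous by (metis Ck_on.simps(1))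
next
  case (Suc k)
  then show ?case by (metis Ck_on.simps(2))
qed

lemma Ck_on_const: "Ck_on k S (\<lambda>z. c)"
proof (induction k arbitrary: c)
  case (Suc k)
  have "dir_deriv v (\<lambda>z. c) = (\<lambda>z. 0)" for v :: 'a
    using dir_deriv_eq[OF has_derivative_const] by blast
  then show ?case using Suc by simp
qed simp

lemma Ck_on_linear: "bounded_linear l \<Longrightarrow> Ck_on k S l"
proof (induction k)
  case 0
  then show ?case by (simp add: linear_continuous_on)
next
  case (Suc k)
  have "dir_deriv v l = (\<lambda>z. l v)" for v
    using dir_deriv_eq[OF bounded_linear_imp_has_derivative[OF Suc.prems]] by blast
  then show ?case using Suc by (simp add: Ck_on_const bounded_linear_imp_differentiable)
qed

lemma dir_deriv_add:
  assumes "f differentiable (at z)" "g differentiable (at z)"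
  shows "dir_deriv v (\<lambda>w. f w + g w) z = dir_deriv v f z + dir_deriv v g z"
  by (rule dir_deriv_eq[OF has_derivative_add]) (use assms dir_deriv_has_derivative in auto)

lemma dir_deriv_mult:
  assumes "f differentiable (at z)" "g differentiable (at z)"
  shows "dir_deriv v (\<lambda>w. f w * g w) z = f z * dir_deriv v g z + dir_deriv v f z * g z"
  by (rule dir_deriv_eq[OF has_derivative_mult]) (use assms dir_deriv_has_derivative in auto)

lemma dir_deriv_compose:
  fixes g :: "real \<Rightarrow> real"
  assumes "f differentiable (at z)" "(g has_real_derivative g') (at (f z))"
  shows "(\<lambda>w. g (f w)) differentiable (at z)"
    and "dir_deriv v (\<lambda>w. g (f w)) z = g' * dir_deriv v f z"
proof -
  have g: "(g has_derivative (*) g') (at (f z))" using assms(2)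
    by (simp add: has_field_derivative_def)
  have *: "((\<lambda>w. g (f w)) has_derivative (\<lambda>v. g' * dir_deriv v f z)) (at z)"
    using has_derivative_compose[OF dir_deriv_has_derivative[OF assms(1)], of g "(*) g'"] g by simp
  then show "(\<lambda>w. g (f w)) differentiable (at z)" unfolding differentiable_def by blast
  show "dir_deriv v (\<lambda>w. g (f w)) z = g' * dir_deriv v f z" using dir_deriv_eq[OF *] .
qed

lemma dir_deriv_affine:
  assumes "bounded_linear A" "f differentiable (at (A z + b))"
  shows "(\<lambda>w. f (A w + b)) differentiable (at z)"
    and "dir_deriv v (\<lambda>w. f (A w + b)) z = dir_deriv (A v) f (A z + b)"
proof -
  have a: "((\<lambda>w. A w + b) has_derivative A) (at z)"
    by (auto intro!: derivative_eq_intros bounded_linear_imp_has_derivative assms)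
  have *: "((\<lambda>w. f (A w + b)) has_derivative (\<lambda>v. dir_deriv (A v) f (A z + b))) (at z)"
    using has_derivative_compose[OF a dir_deriv_has_derivative[OF assms(2)]] by simp
  then show "(\<lambda>w. f (A w + b)) differentiable (at z)" unfolding differentiable_def by blast
  show "dir_deriv v (\<lambda>w. f (A w + b)) z = dir_deriv (A v) f (A z + b)" using dir_deriv_eq[OF *] .
qed

lemma Ck_on_add:
  assumes "open S" "Ck_on k S f" "Ck_on k S g"
  shows "Ck_on k S (\<lambda>z. f z + g z)"
  using assms(2,3)
proof (induction k arbitrary: f g)
  case 0
  then show ?case by (simp add: continuous_on_add)
next
  case (Suc k)
  have "Ck_on k S (dir_deriv v (\<lambda>z. f z + g z))" for v
    by (rule Ck_on_cong_imp[OF assms(1), of "\<lambda>z. dir_deriv v f z + dir_deriv v g z"])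
       (use Suc in \<open>auto simp: dir_deriv_add\<close>)
  then show ?case using Suc.prems by simp
qed

lemma Ck_on_mult:
  assumes "open S" "Ck_on k S f" "Ck_on k S g"
  shows "Ck_on k S (\<lambda>z. f z * g z)"
  using assms(2,3)
proof (induction k arbitrary: f g)
  case 0
  then show ?case by (simp add: continuous_on_mult)
next
  case (Suc k)
  have fg: "Ck_on k S f" "Ck_on k S g" using Suc.prems Ck_on_SucD by blast+
  have "Ck_on k S (dir_deriv v (\<lambda>z. f z * g z))" for v
    apply (rule Ck_on_cong_imp[OF assms(1), of "\<lambda>z. f z * dir_deriv v g z + dir_deriv v f z * g z"])
    using Suc fg by (auto simp: dir_deriv_mult intro!: Ck_on_add[OF assms(1)])
  then show ?case using Suc.prems by simp
qed

lemma Ck_on_compose: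
  fixes g :: "real \<Rightarrow> real"
  assumes "open S" "open T" "\<And>z. z \<in> S \<Longrightarrow> f z \<in> T" "Ck_on k S f" "Ck_on k T g"
  shows "Ck_on k S (\<lambda>z. g (f z))"
  using assms(4,5)
proof (induction k arbitrary: g)
  case 0
  then show ?case using assms(3) continuous_on_compose2 by (metis Ck_on.simps(1) image_subsetI)
next
  case (Suc k)
  have f: "Ck_on k S f" using Suc.prems Ck_on_SucD by blast
  have g': "(g has_real_derivative dir_deriv 1 g x) (at x)" if "x \<in> T" for x
  proof -
    have *: "(g has_derivative (\<lambda>v. dir_deriv v g x)) (at x)" using Suc.prems that by (intro dir_deriv_has_derivative) simp
    have "dir_deriv v g x = dir_deriv 1 g x * v" for v
      using linear_cmul[OF has_derivative_linear[OF *], of v 1] by simp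
    then have "(\<lambda>v. dir_deriv v g x) = (*) (dir_deriv 1 g x)" by (intro ext)
    then show ?thesis unfolding has_field_derivative_def using * by metis
  qed
  have "Ck_on k S (dir_deriv v (\<lambda>z. g (f z)))" for v
  proof (rule Ck_on_cong_imp[OF assms(1)])
    show "dir_deriv 1 g (f z) * dir_deriv v f z = dir_deriv v (\<lambda>z. g (f z)) z" if "z \<in> S" for z
      using dir_deriv_compose(2)[where f=f and g=g, OF _ g'[OF assms(3)[OF that]]] Suc.prems(1) that by simp
    show "Ck_on k S (\<lambda>z. dir_deriv 1 g (f z) * dir_deriv v f z)"
      using Suc.prems by (intro Ck_on_mult[OF assms(1)] Suc.IH[OF f]) auto
  qed
  moreover have "\<And>z. z \<in> S \<Longrightarrow> (\<lambda>z. g (f z)) differentiable (at z)"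
    by (rule dir_deriv_compose(1)[where f=f and g=g, OF _ g'[OF assms(3)]]) (use Suc.prems in auto)
  ultimately show ?case by simp
qed

lemma Ck_on_affine:
  assumes "open S" "open T" "bounded_linear A" "\<And>z. z \<in> S \<Longrightarrow> A z + b \<in> T" "Ck_on k T f"
  shows "Ck_on k S (\<lambda>z. f (A z + b))"
  using assms(5)
proof (induction k arbitrary: f)
  case 0
  have "continuous_on S (\<lambda>z. A z + b)"
    by (intro continuous_on_add continuous_on_const linear_continuous_on assms(3))
  then show ?case using 0 assms(4) by (auto intro!: continuous_on_compose2[of T f S])
next
  case (Suc k)
  have d: "f differentiable (at (A z + b))" if "z \<in> S" for z using Suc.prems assms(4)[OF that] by auto
  have "Ck_on k S (dir_deriv v (\<lambda>z. f (A z + b)))" for v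
  proof (rule Ck_on_cong_imp[OF assms(1)])
    show "dir_deriv (A v) f (A z + b) = dir_deriv v (\<lambda>z. f (A z + b)) z" if "z \<in> S" for z
      using dir_deriv_affine(2)[OF assms(3) d[OF that]] by simp
    show "Ck_on k S (\<lambda>z. dir_deriv (A v) f (A z + b))"
      using Suc.prems by (intro Suc.IH) simp
  qed
  moreover have "\<And>z. z \<in> S \<Longrightarrow> (\<lambda>z. f (A z + b)) differentiable (at z)"
    using dir_deriv_affine(1)[OF assms(3) d] by auto
  ultimately show ?case by simp
qed

lemma Ck_on_realI:
  fixes g :: "real \<Rightarrow> real"
  assumes "open T" "\<And>x. x \<in> T \<Longrightarrow> (g has_real_derivative g' x) (at x)" "Ck_on k T g'"
  shows "Ck_on (Suc k) T g"
proof -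
  have "dir_deriv v g x = v * g' x" if "x \<in> T" for v x
    using dir_deriv_eq[OF assms(2)[OF that, unfolded has_field_derivative_def], of v] by simp
  then have "Ck_on k T (dir_deriv v g)" for v
    using Ck_on_cong_imp[OF assms(1), of "\<lambda>x. v * g' x" "dir_deriv v g"]
      Ck_on_mult[OF assms(1) Ck_on_const assms(3), of v] by simp
  moreover have "\<forall>x\<in>T. g differentiable (at x)"
    using assms(2) real_differentiable_def by blast
  ultimately show ?thesis by simp
qed

lemma smooth_on_cong_imp: "open S \<Longrightarrow> (\<And>w. w \<in> S \<Longrightarrow> f w = g w) \<Longrightarrow> smooth_on S f \<Longrightarrow> smooth_on S g"
  unfolding smooth_on_def using Ck_on_cong_imp by metis
lemma smooth_on_subset: "smooth_on S f \<Longrightarrow> T \<subseteq> S \<Longrightarrow> smooth_on T f"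
  unfolding smooth_on_def using Ck_on_subset by metis
lemma smooth_on_Union:
  "(\<And>z. z \<in> S \<Longrightarrow> \<exists>T. open T \<and> z \<in> T \<and> smooth_on T f) \<Longrightarrow> smooth_on S f"
  unfolding smooth_on_def using Ck_on_Union by metis
lemma smooth_on_continuous: "smooth_on S f \<Longrightarrow> continuous_on S f"
  unfolding smooth_on_def using Ck_on_continuous by metis
lemma smooth_on_dir_deriv: "smooth_on S f \<Longrightarrow> smooth_on S (dir_deriv v f)"
  unfolding smooth_on_def by (metis Ck_on.simps(2))
lemma smooth_on_differentiable: "smooth_on S f \<Longrightarrow> z \<in> S \<Longrightarrow> f differentiable (at z)"
  unfolding smooth_on_def by (metis Ck_on.simps(2))
lemma smooth_on_const: "smooth_on S (\<lambda>z. c)"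
  unfolding smooth_on_def using Ck_on_const by metis
lemma smooth_on_linear: "bounded_linear l \<Longrightarrow> smooth_on S l"
  unfolding smooth_on_def using Ck_on_linear by metis
lemma smooth_on_add: "open S \<Longrightarrow> smooth_on S f \<Longrightarrow> smooth_on S g \<Longrightarrow> smooth_on S (\<lambda>z. f z + g z)"
  unfolding smooth_on_def using Ck_on_add by metis
lemma smooth_on_mult: "open S \<Longrightarrow> smooth_on S f \<Longrightarrow> smooth_on S g \<Longrightarrow> smooth_on S (\<lambda>z. f z * g z)"
  unfolding smooth_on_def using Ck_on_mult by metis
lemma smooth_on_minus: "open S \<Longrightarrow> smooth_on S f \<Longrightarrow> smooth_on S (\<lambda>z. - f z)"
  using smooth_on_mult[OF _ smooth_on_const[of _ "-1"]] by fastforce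
lemma smooth_on_diff: "open S \<Longrightarrow> smooth_on S f \<Longrightarrow> smooth_on S g \<Longrightarrow> smooth_on S (\<lambda>z. f z - g z)"
  using smooth_on_add[OF _ _ smooth_on_minus, of S f g] by simp
lemma smooth_on_sum: "open S \<Longrightarrow> (\<And>i. i \<in> I \<Longrightarrow> smooth_on S (f i)) \<Longrightarrow> smooth_on S (\<lambda>z. \<Sum>i\<in>I. f i z)"
  by (induction I rule: infinite_finite_induct) (auto intro: smooth_on_const smooth_on_add)
lemma smooth_on_compose:
  fixes g :: "real \<Rightarrow> real"
  shows "open S \<Longrightarrow> open T \<Longrightarrow> (\<And>z. z \<in> S \<Longrightarrow> f z \<in> T) \<Longrightarrow> smooth_on S f \<Longrightarrow> smooth_on T g
    \<Longrightarrow> smooth_on S (\<lambda>z. g (f z))"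
  unfolding smooth_on_def using Ck_on_compose by metis
lemma smooth_on_affine:
  "open S \<Longrightarrow> open T \<Longrightarrow> bounded_linear A \<Longrightarrow> (\<And>z. z \<in> S \<Longrightarrow> A z + b \<in> T) \<Longrightarrow> smooth_on T f
    \<Longrightarrow> smooth_on S (\<lambda>z. f (A z + b))"
  unfolding smooth_on_def using Ck_on_affine by metis

text \<open>A family whose derivatives are linear combinations of its own members is smooth: the
  induction on the order runs over all indices at once, so higher derivatives are never written
  down.\<close>

lemma smooth_on_real_family:
  fixes F :: "'i \<Rightarrow> real \<Rightarrow> real"
  assumes "open T" "\<And>i x. x \<in> T \<Longrightarrow> (F i has_real_derivative a i * F (p i) x + b i * F (q i) x) (at x)"
  shows "smooth_on T (F i)"
proof -
  have "Ck_on k T (F i)" for k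
  proof (induction k arbitrary: i)
    case 0
    show ?case using assms(2) DERIV_isCont continuous_at_imp_continuous_on by (metis Ck_on.simps(1))
  next
    case (Suc k)
    show ?case by (rule Ck_on_realI[OF assms(1) assms(2)])
      (auto intro!: Ck_on_add Ck_on_mult Ck_on_const assms Suc)
  qed
  then show ?thesis by (simp add: smooth_on_def)
qed

section \<open>Explicit smooth functions of one variable\<close>

lemma smooth_on_powr: "smooth_on {0<..} (\<lambda>x. x powr (a::real))"
  by (rule smooth_on_real_family[where F="\<lambda>a x. x powr a" and p="\<lambda>a. a - 1" and a="\<lambda>a. a" and b="\<lambda>_. 0"])
     (auto intro!: derivative_eq_intros)

lemma smooth_on_exp: "smooth_on UNIV (exp :: real \<Rightarrow> real)"
  by (rule smooth_on_real_family[where F="\<lambda>_::unit. exp" and a="\<lambda>_. 1" and b="\<lambda>_. 0"])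
     (auto intro!: derivative_eq_intros)

text \<open>With m = -n/2 and a = |x|^2 + \<epsilon> > 0 the heat kernel is
  \<open>a powr m * flat m (t / a)\<close>, hence the 1/4. The free exponent closes the family under
  differentiation; the same functions also supply the cutoffs (\<open>flat 0\<close>) and the convex
  truncation (\<open>flat 1\<close>).\<close>

definition flat :: "real \<Rightarrow> real \<Rightarrow> real" where
  "flat m q = (if q > 0 then q powr m * exp (- (1 / (4 * q))) else 0)"

lemma flat_tendsto_0: "(flat m \<longlongrightarrow> 0) (at_right 0)"
proof -
  have "((\<lambda>x. x powr (-m) / exp (x / 4)) \<longlongrightarrow> 0) at_top"
  proof (rule Lim_null_comparison)
    define k where "k = nat \<lceil>- m\<rceil>"
    have "((\<lambda>y::real. 4 ^ k * (y ^ k / exp y)) \<longlongrightarrow> 4 ^ k * 0) at_top"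
      by (intro tendsto_mult tendsto_const tendsto_power_div_exp_0)
    then have "((\<lambda>x::real. 4 ^ k * ((x * (1/4)) ^ k / exp (x * (1/4)))) \<longlongrightarrow> 4 ^ k * 0) at_top"
      by (rule filterlim_compose) (rule filterlim_at_top_mult_tendsto_pos[OF tendsto_const _ filterlim_ident], simp)
    moreover have "(\<lambda>x. 4 ^ k * ((x * (1/4)) ^ k / exp (x * (1/4)))) = (\<lambda>x::real. x ^ k / exp (x / 4))"
      by (auto simp: fun_eq_iff power_divide)
    ultimately show "((\<lambda>x::real. x ^ k / exp (x / 4)) \<longlongrightarrow> 0) at_top" by (simp only: mult_zero_right)
    show "\<forall>\<^sub>F x in at_top. norm (x powr (-m) / exp (x / 4)) \<le> x ^ k / exp (x / 4)"
      using eventually_ge_at_top[of 1]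
    proof eventually_elim
      case (elim x)
      have "x powr (-m) \<le> x powr (real k)" using elim unfolding k_def by (intro powr_mono real_nat_ceiling_ge)
      then show ?case using elim by (auto simp: powr_realpow intro!: divide_right_mono)
    qed
  qed
  then have "((\<lambda>q. (inverse q) powr (-m) / exp (inverse q / 4)) \<longlongrightarrow> 0) (at_right (0::real))"
    by (rule filterlim_compose) (rule filterlim_inverse_at_top_right)
  moreover have "eventually (\<lambda>q. (inverse q) powr (-m) / exp (inverse q / 4) = flat m q) (at_right (0::real))"
    using eventually_at_right_less[of "0::real"]
  proof eventually_elim
    case (elim q)
    have "inverse q powr (-m) = q powr m"
      using elim powr_powr[of q "-1" "-m"] by (simp add: powr_minus)
    then show ?case using elim by (simp add: flat_def exp_minus field_simps)
  qed
  ultimately show ?thesis using Lim_transform_eventually by blast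
qed

lemma flat_at_top: "(flat 0 \<longlongrightarrow> 1) at_top" "m > 0 \<Longrightarrow> (flat (- m) \<longlongrightarrow> 0) at_top"
proof -
  have "((\<lambda>q. exp (- (1 / (4 * q)))) \<longlongrightarrow> exp (- 0)) (at_top :: real filter)"
    by (intro tendsto_exp tendsto_minus tendsto_divide_0[OF tendsto_const]
        filterlim_at_top_imp_at_infinity filterlim_tendsto_pos_mult_at_top[OF tendsto_const _ filterlim_ident]) simp
  then have l: "((\<lambda>q. exp (- (1 / (4 * q)))) \<longlongrightarrow> 1) (at_top :: real filter)" by simp
  show "(flat 0 \<longlongrightarrow> 1) at_top"
    by (rule Lim_transform_eventually[OF l])
      (use eventually_gt_at_top[of 0] in eventually_elim, simp add: flat_def)
  assume m: "m > 0"
  show "(flat (- m) \<longlongrightarrow> 0) at_top"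
  proof (rule Lim_null_comparison)
    show "((\<lambda>x::real. x powr (- m)) \<longlongrightarrow> 0) at_top" by (rule tendsto_neg_powr[OF _ filterlim_ident]) (use m in simp)
    show "\<forall>\<^sub>F x in at_top. norm (flat (- m) x) \<le> x powr (- m)"
      using eventually_gt_at_top[of 0] by eventually_elim (auto simp: flat_def intro!: mult_right_le_one_le)
  qed
qed

text \<open>Only q = 0 is delicate: there the right difference quotient of \<open>flat m\<close> is
  \<open>flat (m - 1)\<close>, which tends to 0, and the left one is 0.\<close>

lemma DERIV_flat: "(flat m has_real_derivative m * flat (m - 1) q + 1/4 * flat (m - 2) q) (at q)"
proof (cases "q = 0")
  case True
  have r: "((\<lambda>h. (flat m (0 + h) - flat m 0) / h) \<longlongrightarrow> 0) (at_right 0)"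
  proof (rule Lim_transform_eventually[OF flat_tendsto_0[of "m-1"]])
    show "\<forall>\<^sub>F x in at_right 0. flat (m - 1) x = (flat m (0 + x) - flat m 0) / x"
      using eventually_at_right_less[of "0::real"]
      by eventually_elim (simp add: flat_def powr_diff)
  qed
  have l: "((\<lambda>h. (flat m (0 + h) - flat m 0) / h) \<longlongrightarrow> 0) (at_left 0)"
  proof (rule Lim_transform_eventually[OF tendsto_const])
    show "\<forall>\<^sub>F x in at_left 0. 0 = (flat m (0 + x) - flat m 0) / x"
      unfolding eventually_at_left_field by (auto simp: flat_def intro!: exI[of _ "-1"])
  qed
  show ?thesis using filterlim_split_at_real[OF l r] True
    by (simp add: DERIV_def flat_def)
next
  case False
  show ?thesis
  proof (cases "q > 0")
    case True
    have "((\<lambda>q. q powr m * exp (- (1 / (4 * q)))) has_real_derivative m * flat (m - 1) q + 1/4 * flat (m - 2) q) (at q)"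
      using True by (auto intro!: derivative_eq_intros simp: flat_def powr_diff power2_eq_square field_simps)
    then show ?thesis
      by (rule has_field_derivative_transform_within_open[where S="{0<..}"]) (use True in \<open>auto simp: flat_def\<close>)
  next
    case F: False
    have "((\<lambda>q. 0) has_real_derivative m * flat (m - 1) q + 1/4 * flat (m - 2) q) (at q)"
      using F by (auto intro!: derivative_eq_intros simp: flat_def)
    then show ?thesis
      by (rule has_field_derivative_transform_within_open[where S="{..<0}"]) (use False F in \<open>auto simp: flat_def\<close>)
  qed
qed

lemma smooth_on_flat: "smooth_on UNIV (flat m)"
  by (rule smooth_on_real_family[where F=flat and p="\<lambda>m. m-1" and a="\<lambda>m. m" and b="\<lambda>_. 1/4" and q="\<lambda>m. m-2"])
     (use DERIV_flat in auto)

section \<open>Derivatives along lines and under reflection\<close>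

lemma dir_deriv_line:
  assumes "f differentiable (at z)" "((\<lambda>s. f (z + s *\<^sub>R v)) has_real_derivative D) (at 0)"
  shows "dir_deriv v f z = D"
proof -
  have "((\<lambda>s. z + s *\<^sub>R v) has_derivative (\<lambda>s. s *\<^sub>R v)) (at 0)"
    by (auto intro!: derivative_eq_intros)
  from has_derivative_compose[OF this, of f "\<lambda>v. dir_deriv v f z"] dir_deriv_has_derivative[OF assms(1)]
  have d: "((\<lambda>s. f (z + s *\<^sub>R v)) has_derivative (\<lambda>s. dir_deriv (s *\<^sub>R v) f z)) (at 0)" by simp
  have "(\<lambda>s. dir_deriv (s *\<^sub>R v) f z) = (*) D"
    using has_derivative_unique[OF d assms(2)[unfolded has_field_derivative_def]] .
  from fun_cong[OF this, of 1] show ?thesis by simp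
qed

lemma line_has_real_derivative:
  assumes "f differentiable (at (z + s *\<^sub>R v))"
  shows "((\<lambda>s. f (z + s *\<^sub>R v)) has_real_derivative dir_deriv v f (z + s *\<^sub>R v)) (at s)"
proof -
  have "((\<lambda>s. z + s *\<^sub>R v) has_derivative (\<lambda>s. s *\<^sub>R v)) (at s)"
    by (auto intro!: derivative_eq_intros)
  from has_derivative_compose[OF this, of f "\<lambda>w. dir_deriv w f (z + s *\<^sub>R v)"] dir_deriv_has_derivative[OF assms]
  have d: "((\<lambda>s. f (z + s *\<^sub>R v)) has_derivative (\<lambda>h. dir_deriv (h *\<^sub>R v) f (z + s *\<^sub>R v))) (at s)" by simp
  have "dir_deriv (h *\<^sub>R v) f (z + s *\<^sub>R v) = dir_deriv v f (z + s *\<^sub>R v) * h" for h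
    using linear_cmul[OF has_derivative_linear[OF dir_deriv_has_derivative[OF assms]], of h v] by simp
  then show ?thesis using d unfolding has_field_derivative_def by (metis (no_types, lifting) ext)
qed

lemma dir_deriv_scaleR:
  "f differentiable (at z) \<Longrightarrow> dir_deriv (c *\<^sub>R v) f z = c * dir_deriv v f z"
  using linear_cmul[OF has_derivative_linear[OF dir_deriv_has_derivative]] by fastforce

lemma dir_deriv_const: "dir_deriv v (\<lambda>z. c) z = 0"
  using dir_deriv_eq[OF has_derivative_const] by blast

lemma dir_deriv_minus: "f differentiable (at z) \<Longrightarrow> dir_deriv v (\<lambda>z. - f z) z = - dir_deriv v f z"
  by (rule dir_deriv_eq[OF has_derivative_minus]) (rule dir_deriv_has_derivative)

lemma dir_deriv_diff:
  "f differentiable (at z) \<Longrightarrow> g differentiable (at z) \<Longrightarrow>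
   dir_deriv v (\<lambda>z. f z - g z) z = dir_deriv v f z - dir_deriv v g z"
  by (rule dir_deriv_eq[OF has_derivative_diff]) (rule dir_deriv_has_derivative, assumption)+

lemma dir_deriv_cmult: "f differentiable (at z) \<Longrightarrow> dir_deriv v (\<lambda>z. c * f z) z = c * dir_deriv v f z"
  by (rule dir_deriv_eq[OF has_derivative_mult_right]) (rule dir_deriv_has_derivative)

lemma dir_deriv_reflect:
  assumes "f differentiable (at (a - z))"
  shows "(\<lambda>w. f (a - w)) differentiable (at z)" "dir_deriv v (\<lambda>w. f (a - w)) z = - dir_deriv v f (a - z)"
proof -
  have b: "bounded_linear (\<lambda>w::'a. - w)" by (simp add: bounded_linear_minus)
  have d: "f differentiable (at (- z + a))" using assms by simp
  from dir_deriv_affine[OF b d] dir_deriv_scaleR[OF assms, of "-1" v]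
  show "(\<lambda>w. f (a - w)) differentiable (at z)" "dir_deriv v (\<lambda>w. f (a - w)) z = - dir_deriv v f (a - z)" 
    by simp_all
qed

lemma smooth_reflect:
  fixes f :: "'a::euclidean_space \<Rightarrow> real"
  assumes "open S" "smooth_on S f" shows "smooth_on {w. a - w \<in> S} (\<lambda>w. f (a - w))"
proof -
  have b: "bounded_linear (\<lambda>w::'a. - w)" by (simp add: bounded_linear_minus)
  have "open ((\<lambda>w. a - w) -` S)" by (intro open_vimage assms continuous_intros)
  then have "open {w. a - w \<in> S}" by (simp add: vimage_def)
  from smooth_on_affine[OF this assms(1) b _ assms(2), of a] show ?thesis by simp
qed

lemmas smooth_diff = smooth_on_differentiable[OF _ UNIV_I]
lemmas smooth_cont = smooth_on_continuous[where S=UNIV]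

section \<open>Adjoint heat operator\<close>

definition adj_heat :: "('n::finite spacetime \<Rightarrow> real) \<Rightarrow> 'n spacetime \<Rightarrow> real" where
  "adj_heat \<phi> z = - dir_deriv time_dir \<phi> z - laplacian_x \<phi> z"

lemma smooth_on_laplacian: "open S \<Longrightarrow> smooth_on S f \<Longrightarrow> smooth_on S (laplacian_x f)"
  unfolding laplacian_x_def by (intro smooth_on_sum smooth_on_dir_deriv)

lemma smooth_on_adj_heat: "open S \<Longrightarrow> smooth_on S f \<Longrightarrow> smooth_on S (adj_heat f)"
  unfolding adj_heat_def by (intro smooth_on_diff smooth_on_minus smooth_on_laplacian smooth_on_dir_deriv)

lemma dir_deriv2_mult:
  assumes "smooth_on UNIV f" "smooth_on UNIV g"
  shows "dir_deriv v (dir_deriv v (\<lambda>w. f w * g w)) z =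
    f z * dir_deriv v (dir_deriv v g) z + 2 * (dir_deriv v f z * dir_deriv v g z) + dir_deriv v (dir_deriv v f) z * g z"
proof -
  have sm: "smooth_on UNIV (dir_deriv v f)" "smooth_on UNIV (dir_deriv v g)"
    using assms smooth_on_dir_deriv by auto
  have e: "dir_deriv v (\<lambda>w. f w * g w) = (\<lambda>z. f z * dir_deriv v g z + dir_deriv v f z * g z)"
    by (intro ext dir_deriv_mult smooth_diff assms)
  have m: "smooth_on UNIV (\<lambda>z. f z * dir_deriv v g z)" "smooth_on UNIV (\<lambda>z. dir_deriv v f z * g z)"
    by (intro smooth_on_mult open_UNIV assms sm)+
  show ?thesis unfolding e
    by (simp add: dir_deriv_add dir_deriv_mult smooth_diff m assms sm)
qed

lemma adj_heat_mult:
  assumes "smooth_on UNIV f" "smooth_on UNIV g"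
  shows "adj_heat (\<lambda>w. f w * g w) z = f z * adj_heat g z + g z * adj_heat f z
    - 2 * (\<Sum>i\<in>UNIV. dir_deriv (space_dir i) f z * dir_deriv (space_dir i) g z)"
  unfolding adj_heat_def laplacian_x_def
  by (simp add: dir_deriv2_mult[OF assms] dir_deriv_mult smooth_diff assms sum.distrib sum_distrib_left
      sum_distrib_right algebra_simps)

lemma dir_deriv2_compose:
  fixes g :: "real \<Rightarrow> real"
  assumes "smooth_on UNIV f" "\<And>x. (g has_real_derivative g1 x) (at x)" "\<And>x. (g1 has_real_derivative g2 x) (at x)"
  shows "dir_deriv v (dir_deriv v (\<lambda>w. g (f w))) z =
    g1 (f z) * dir_deriv v (dir_deriv v f) z + g2 (f z) * (dir_deriv v f z)\<^sup>2"
proof -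
  have sm: "smooth_on UNIV (dir_deriv v f)" using smooth_on_dir_deriv[OF assms(1)] by auto
  have e: "dir_deriv v (\<lambda>w. g (f w)) = (\<lambda>z. g1 (f z) * dir_deriv v f z)"
    by (rule ext, rule dir_deriv_compose(2)[OF smooth_diff[OF assms(1)] assms(2)])
  have d: "(\<lambda>w. g1 (f w)) differentiable (at z)" 
    using dir_deriv_compose(1)[OF smooth_diff[OF assms(1)] assms(3)] .
  show ?thesis unfolding e
    by (simp add: dir_deriv_mult smooth_diff sm d dir_deriv_compose(2)[OF smooth_diff[OF assms(1)] assms(3)] power2_eq_square)
qed

text \<open>For convex \<open>g\<close> the last term has a sign: an increasing convex function of a
  subsolution of the adjoint equation is again one.\<close>

lemma adj_heat_compose:
  fixes g :: "real \<Rightarrow> real"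
  assumes "smooth_on UNIV f" "\<And>x. (g has_real_derivative g1 x) (at x)" "\<And>x. (g1 has_real_derivative g2 x) (at x)"
  shows "adj_heat (\<lambda>w. g (f w)) z = g1 (f z) * adj_heat f z - g2 (f z) * (\<Sum>i\<in>UNIV. (dir_deriv (space_dir i) f z)\<^sup>2)"
  unfolding adj_heat_def laplacian_x_def
  by (simp add: dir_deriv2_compose[OF assms] dir_deriv_compose(2)[OF smooth_diff[OF assms(1)] assms(2)]
      sum.distrib sum_distrib_left algebra_simps)

lemma adj_heat_diff:
  assumes "smooth_on UNIV f" "smooth_on UNIV g"
  shows "adj_heat (\<lambda>w. f w - g w) z = adj_heat f z - adj_heat g z"
proof -
  have "dir_deriv v (\<lambda>w. f w - g w) = (\<lambda>z. dir_deriv v f z - dir_deriv v g z)" for v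
    by (intro ext dir_deriv_diff smooth_diff assms)
  then show ?thesis unfolding adj_heat_def laplacian_x_def
    by (simp add: dir_deriv_diff smooth_diff assms smooth_on_dir_deriv sum_subtractf)
qed

section \<open>Cutoff\<close>

text \<open>The usual smooth transition from 0 to 1 on the unit interval. The reciprocal is written
  \<open>powr (-1)\<close> so that smoothness comes from real powers on the positive axis, where the
  denominator takes its values.\<close>

definition step :: "real \<Rightarrow> real" where
  "step t = flat 0 t * (flat 0 t + flat 0 (1 - t)) powr (-1)"

lemma flat_nonneg: "flat m q \<ge> 0" by (simp add: flat_def)
lemma flat_pos: "q > 0 \<Longrightarrow> flat m q > 0" by (simp add: flat_def)
lemma flat_0: "q \<le> 0 \<Longrightarrow> flat m q = 0" by (simp add: flat_def)

lemma step_denom_pos: "flat 0 t + flat 0 (1 - t) > 0"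
  by (cases "t > 0") (auto intro: add_pos_nonneg add_nonneg_pos simp: flat_nonneg flat_pos)

lemma step_0: "t \<le> 0 \<Longrightarrow> step t = 0" by (simp add: step_def flat_0)
lemma step_1: "t \<ge> 1 \<Longrightarrow> step t = 1" using step_denom_pos[of t] by (simp add: step_def flat_0 powr_minus)
lemma step_nonneg: "step t \<ge> 0" by (simp add: step_def flat_nonneg)
lemma step_le_1: "step t \<le> 1"
  using step_denom_pos[of t] flat_nonneg[of 0 "1-t"] by (simp add: step_def powr_minus field_simps)

lemma smooth_step: "smooth_on UNIV step"
proof -
  have a: "smooth_on UNIV (\<lambda>t. flat 0 (1 - t))"
    using smooth_reflect[OF open_UNIV smooth_on_flat[of 0], of 1] by simp
  show ?thesis unfolding step_def[abs_def]
    by (intro smooth_on_mult open_UNIV smooth_on_flat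
      smooth_on_compose[OF open_UNIV open_greaterThan _ _ smooth_on_powr] smooth_on_add a)
      (simp add: step_denom_pos)
qed

lemma smooth_step_compose: "open S \<Longrightarrow> smooth_on S p \<Longrightarrow> smooth_on S (\<lambda>z. step (p z))"
  using smooth_on_compose[OF _ open_UNIV _ _ smooth_step] by auto

abbreviation sqn :: "'n::finite spacetime \<Rightarrow> real" where "sqn z \<equiv> fst z \<bullet> fst z"

lemma smooth_snd: "smooth_on S (\<lambda>z::'n::finite spacetime. snd z)"
  by (rule smooth_on_linear[OF bounded_linear_snd])

lemma smooth_fst_nth: "smooth_on S (\<lambda>z::'n::finite spacetime. fst z $ i)"
  by (rule smooth_on_linear) (rule bounded_linear_compose[OF bounded_linear_vec_nth bounded_linear_fst])

lemma smooth_sqn: "open S \<Longrightarrow> smooth_on S (sqn :: 'n::finite spacetime \<Rightarrow> real)"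
  unfolding inner_vec_def inner_real_def by (intro smooth_on_sum smooth_on_mult smooth_fst_nth)

section \<open>The regularised heat kernel\<close>

text \<open>The heat kernel without the factor (4 \<pi>)^(-n/2), recovered at \<epsilon> = 0. For
  \<epsilon> > 0 the additional factor \<open>exp (- \<epsilon> / (4 * t))\<close> is flat at t = 0
  and removes the singularity at the origin.\<close>

definition gam :: "real \<Rightarrow> 'n::finite spacetime \<Rightarrow> real" where
  "gam \<epsilon> z = (if snd z > 0 then snd z powr (- real CARD('n) / 2) * exp (- (sqn z + \<epsilon>) / (4 * snd z)) else 0)"

lemma gam_nonneg: "gam \<epsilon> z \<ge> 0" by (simp add: gam_def)

lemma gam_le: assumes "\<epsilon> \<ge> \<delta>" shows "gam \<epsilon> z \<le> gam \<delta> z"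
  using assms by (auto simp: gam_def intro!: mult_left_mono divide_right_mono)

lemma open_snd_pos: "open {z::'n::finite spacetime. snd z > 0}"
  by (intro open_Collect_less continuous_intros)
lemma open_snd_neg: "open {z::'n::finite spacetime. snd z < 0}"
  by (intro open_Collect_less continuous_intros)
lemma open_sqn_pos: "open {z::'n::finite spacetime. sqn z + \<epsilon> > 0}"
  by (intro open_Collect_less continuous_intros)

text \<open>Factoring out a = |x|^2 + \<epsilon> leaves a power of a times \<open>flat\<close> of t
  / a, so the passage through t = 0 rests on the smoothness of \<open>flat\<close> alone.\<close>

lemma smooth_gam_positive: "smooth_on {z. sqn z + \<epsilon> > 0} (gam \<epsilon> :: 'n::finite spacetime \<Rightarrow> real)"
proof -
  let ?S = "{z::'n spacetime. sqn z + \<epsilon> > 0}"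
  let ?m = "- real CARD('n) / 2"
  have p: "smooth_on ?S (\<lambda>z. sqn z + \<epsilon>)"
    by (intro smooth_on_add smooth_sqn smooth_on_const open_sqn_pos)
  have pw: "smooth_on ?S (\<lambda>z. (sqn z + \<epsilon>) powr a)" for a
    by (rule smooth_on_compose[OF open_sqn_pos open_greaterThan _ p smooth_on_powr]) auto
  have "smooth_on ?S (\<lambda>z. (sqn z + \<epsilon>) powr ?m * flat ?m (snd z * (sqn z + \<epsilon>) powr (-1)))"
    by (intro smooth_on_mult open_sqn_pos pw smooth_snd smooth_on_compose[OF open_sqn_pos open_UNIV _ _ smooth_on_flat]) auto
  then show ?thesis
  proof (rule smooth_on_cong_imp[OF open_sqn_pos, rotated])
    fix z :: "'n spacetime" assume z: "z \<in> ?S"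
    define a where "a = sqn z + \<epsilon>"
    have a: "a > 0" "\<epsilon> + sqn z = a" using z by (simp_all add: a_def)
    have "a powr ?m * flat ?m (snd z * a powr (-1)) = gam \<epsilon> z"
      using a by (auto simp: gam_def flat_def a_def[symmetric] powr_minus powr_mult powr_divide field_simps zero_less_divide_iff zero_less_mult_iff)
    then show "(sqn z + \<epsilon>) powr ?m * flat ?m (snd z * (sqn z + \<epsilon>) powr (-1)) = gam \<epsilon> z" by (simp add: a_def)
  qed
qed

lemma smooth_gam_future: "smooth_on {z. snd z > 0} (gam \<epsilon> :: 'n::finite spacetime \<Rightarrow> real)"
proof -
  let ?S = "{z::'n spacetime. snd z > 0}"
  let ?m = "- real CARD('n) / 2"
  have pw: "smooth_on ?S (\<lambda>z. (snd z) powr a)" for a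
    by (rule smooth_on_compose[OF open_snd_pos open_greaterThan _ smooth_snd smooth_on_powr]) auto
  have "smooth_on ?S (\<lambda>z. (snd z) powr ?m * exp ((- 1/4) * ((sqn z + \<epsilon>) * (snd z powr (-1)))))"
    by (intro smooth_on_mult open_snd_pos pw smooth_snd smooth_on_compose[OF open_snd_pos open_UNIV _ _ smooth_on_exp]
       smooth_on_add smooth_sqn smooth_on_const) auto
  then show ?thesis
    by (rule smooth_on_cong_imp[OF open_snd_pos, rotated])
       (auto simp: gam_def powr_minus field_simps)
qed

lemma smooth_gam_past: "smooth_on {z. snd z < 0} (gam \<epsilon> :: 'n::finite spacetime \<Rightarrow> real)"
  by (rule smooth_on_cong_imp[OF open_snd_neg _ smooth_on_const[of _ 0]]) (auto simp: gam_def)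

lemma smooth_gam: "\<epsilon> > 0 \<Longrightarrow> smooth_on UNIV (gam \<epsilon> :: 'n::finite spacetime \<Rightarrow> real)"
  using smooth_gam_positive[where \<epsilon>=\<epsilon> and 'n='n] by (auto elim!: smooth_on_subset simp: add_nonneg_pos)

lemma smooth_gam_off: "\<epsilon> \<ge> 0 \<Longrightarrow> smooth_on (- {0}) (gam \<epsilon> :: 'n::finite spacetime \<Rightarrow> real)"
proof (rule smooth_on_Union)
  fix z :: "'n spacetime" assume "z \<in> - {0}" and e: "\<epsilon> \<ge> 0"
  then consider "fst z \<noteq> 0" | "snd z > 0" | "snd z < 0"
    by (metis ComplD linorder_neqE_linordered_idom prod_eqI singletonI snd_zero fst_zero)
  then show "\<exists>T. open T \<and> z \<in> T \<and> smooth_on T (gam \<epsilon>)"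
  proof cases
    case 1
    then have "sqn z + \<epsilon> > 0" using e by (simp add: add_pos_nonneg)
    then show ?thesis using open_sqn_pos smooth_gam_positive by blast
  next
    case 2 then show ?thesis using open_snd_pos smooth_gam_future by blast
  next
    case 3 then show ?thesis using open_snd_neg smooth_gam_past by blast
  qed
qed

text \<open>Only time 0 is not immediate: the derivative is continuous and vanishes at all earlier
  times, so its value is the limit from the past.\<close>

lemma dir_deriv_zero_past:
  fixes F :: "'n::finite spacetime \<Rightarrow> real"
  assumes S: "open S" "smooth_on S F" "\<And>z. z \<in> S \<Longrightarrow> snd z \<le> 0 \<Longrightarrow> F z = 0"
    and z: "z \<in> S" "snd z \<le> 0"
  shows "dir_deriv v F z = 0"
proof -
  have neg: "dir_deriv v F w = 0" if "w \<in> S" "snd w < 0" for w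
  proof -
    have "dir_deriv v F w = dir_deriv v (\<lambda>_. 0) w"
      by (rule dir_deriv_cong_open(2)[where S="S \<inter> {z. snd z < 0}"])
        (use that S smooth_on_differentiable open_snd_neg in auto)
    then show ?thesis by (simp add: dir_deriv_const)
  qed
  show ?thesis
  proof (cases "snd z < 0")
    case True then show ?thesis using neg z by simp
  next
    case False
    then have z0: "snd z = 0" using z by simp
    have c: "isCont (dir_deriv v F) z"
      using smooth_on_continuous[OF smooth_on_dir_deriv[OF S(2)]] S(1) z(1) by (simp add: continuous_on_eq_continuous_at)
    define p where "p = (\<lambda>h::real. z - h *\<^sub>R (time_dir :: 'n spacetime))"
    have pt: "(p \<longlongrightarrow> z) (at_right 0)"
      unfolding p_def by (auto intro!: tendsto_eq_intros)
    have "((\<lambda>h. dir_deriv v F (p h)) \<longlongrightarrow> dir_deriv v F z) (at_right 0)"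
      using isCont_tendsto_compose[OF c pt] .
    moreover have "eventually (\<lambda>h. p h \<in> S) (at_right 0)"
      using topological_tendstoD[OF pt S(1) z(1)] .
    then have "eventually (\<lambda>h. dir_deriv v F (p h) = 0) (at_right 0)"
      using eventually_at_right_less[of "0::real"]
      by eventually_elim (rule neg, auto simp: p_def time_dir_def z0)
    ultimately have "((\<lambda>h. 0) \<longlongrightarrow> dir_deriv v F z) (at_right (0::real))"
      by (rule Lim_transform_eventually)
    then show ?thesis using tendsto_unique[OF _ tendsto_const] by (metis trivial_limit_at_right_real)
  qed
qed

lemma dir_deriv_gam_past:
  assumes "open S" "smooth_on S (gam \<epsilon>)" "z \<in> S" "snd z \<le> 0"
  shows "dir_deriv v (gam \<epsilon>) z = 0" "dir_deriv w (dir_deriv v (gam \<epsilon>)) z = 0"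
proof -
  have *: "dir_deriv v (gam \<epsilon>) z = 0" if "z \<in> S" "snd z \<le> 0" for z
    by (rule dir_deriv_zero_past[OF assms(1,2) _ that]) (auto simp: gam_def)
  show "dir_deriv v (gam \<epsilon>) z = 0" using * assms by blast
  show "dir_deriv w (dir_deriv v (gam \<epsilon>)) z = 0"
    by (rule dir_deriv_zero_past[OF assms(1) smooth_on_dir_deriv[OF assms(2)] _ assms(3,4)]) (use * in auto)
qed

lemma sqn_line: "sqn (z + s *\<^sub>R space_dir i) = sqn z + 2 * s * fst z $ i + s\<^sup>2"
  by (simp add: space_dir_def inner_add_left inner_add_right inner_axis' inner_axis power2_eq_square algebra_simps)

lemma gam_space:
  fixes z :: "'n::finite spacetime"
  assumes "snd z > 0"
  shows "dir_deriv (space_dir i) (gam \<epsilon>) z = - (fst z $ i / (2 * snd z)) * gam \<epsilon> z"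
proof (rule dir_deriv_line)
  show "gam \<epsilon> differentiable (at z)"
    using smooth_on_differentiable[OF smooth_gam_future] assms by simp
  have e: "(\<lambda>s. gam \<epsilon> (z + s *\<^sub>R space_dir i)) =
    (\<lambda>s. snd z powr (- real CARD('n) / 2) * exp (- (sqn z + 2 * s * fst z $ i + s\<^sup>2 + \<epsilon>) / (4 * snd z)))"
    using assms sqn_line[of z _ i] by (auto simp: gam_def space_dir_def fun_eq_iff)
  show "((\<lambda>s. gam \<epsilon> (z + s *\<^sub>R space_dir i)) has_real_derivative - (fst z $ i / (2 * snd z)) * gam \<epsilon> z) (at 0)"
    unfolding e using assms by (auto intro!: derivative_eq_intros simp: gam_def field_simps)
qed

lemma gam_space_second:
  fixes z :: "'n::finite spacetime"
  assumes "snd z > 0"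
  shows "dir_deriv (space_dir i) (dir_deriv (space_dir i) (gam \<epsilon>)) z =
    (- 1 / (2 * snd z) + (fst z $ i)\<^sup>2 / (4 * (snd z)\<^sup>2)) * gam \<epsilon> z"
proof (rule dir_deriv_line)
  show "dir_deriv (space_dir i) (gam \<epsilon>) differentiable (at z)"
    using smooth_on_differentiable[OF smooth_on_dir_deriv[OF smooth_gam_future]] assms by simp
  have e: "(\<lambda>s. dir_deriv (space_dir i) (gam \<epsilon>) (z + s *\<^sub>R space_dir i)) =
    (\<lambda>s. - ((fst z $ i + s) / (2 * snd z)) * (snd z powr (- real CARD('n) / 2) * exp (- (sqn z + 2 * s * fst z $ i + s\<^sup>2 + \<epsilon>) / (4 * snd z))))"
  proof
    fix s
    have "snd (z + s *\<^sub>R space_dir i) > 0" using assms by (simp add: space_dir_def)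
    from gam_space[OF this, of i \<epsilon>] sqn_line[of z s i] assms
    show "dir_deriv (space_dir i) (gam \<epsilon>) (z + s *\<^sub>R space_dir i) = - ((fst z $ i + s) / (2 * snd z)) * (snd z powr (- real CARD('n) / 2) * exp (- (sqn z + 2 * s * fst z $ i + s\<^sup>2 + \<epsilon>) / (4 * snd z)))"
      by (simp add: gam_def space_dir_def)
  qed
  show "((\<lambda>s. dir_deriv (space_dir i) (gam \<epsilon>) (z + s *\<^sub>R space_dir i)) has_real_derivative 
    (- 1 / (2 * snd z) + (fst z $ i)\<^sup>2 / (4 * (snd z)\<^sup>2)) * gam \<epsilon> z) (at 0)"
    unfolding e using assms by (auto intro!: derivative_eq_intros simp: gam_def field_simps power2_eq_square)
qed

lemma gam_time:
  fixes z :: "'n::finite spacetime"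
  assumes "snd z > 0"
  shows "dir_deriv time_dir (gam \<epsilon>) z =
    (- real CARD('n) / (2 * snd z) + (sqn z + \<epsilon>) / (4 * (snd z)\<^sup>2)) * gam \<epsilon> z"
proof (rule dir_deriv_line)
  show "gam \<epsilon> differentiable (at z)"
    using smooth_on_differentiable[OF smooth_gam_future] assms by simp
  have "snd z * snd z powr ((- real CARD('n) - 2) / 2) = snd z powr (1 + (- real CARD('n) - 2) / 2)"
    using assms by (simp add: powr_mult_base)
  also have "1 + (- real CARD('n) - 2) / 2 = - (real CARD('n) / 2)" by (simp add: field_simps)
  finally have p: "snd z powr - (real CARD('n) / 2) = snd z * snd z powr ((- real CARD('n) - 2) / 2)" by simp
  have "((\<lambda>s. (snd z + s) powr (- real CARD('n) / 2) * exp (- (sqn z + \<epsilon>) / (4 * (snd z + s)))) has_real_derivative 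
    (- real CARD('n) / (2 * snd z) + (sqn z + \<epsilon>) / (4 * (snd z)\<^sup>2)) * gam \<epsilon> z) (at 0)"
    using assms by (auto intro!: derivative_eq_intros simp: gam_def p field_simps power2_eq_square)
  then show "((\<lambda>s. gam \<epsilon> (z + s *\<^sub>R time_dir)) has_real_derivative 
    (- real CARD('n) / (2 * snd z) + (sqn z + \<epsilon>) / (4 * (snd z)\<^sup>2)) * gam \<epsilon> z) (at 0)"
    by (rule has_field_derivative_transform_within_open[where S="{- snd z<..}"])
       (use assms in \<open>auto simp: gam_def time_dir_def\<close>)
qed

text \<open>The heat operator applied to the regularised kernel leaves \<open>conc\<close>, an integrable parabolic
  rescaling of \<open>conc 1\<close>, hence an approximate identity up to the factor \<open>\<integral> conc 1\<close>.\<close>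

definition conc :: "real \<Rightarrow> 'n::finite spacetime \<Rightarrow> real" where
  "conc \<epsilon> z = \<epsilon> / (4 * (snd z)\<^sup>2) * gam \<epsilon> z"

text \<open>The regularised kernel is the caloric function \<open>gam 0\<close> times
  \<open>exp (- \<epsilon> / (4 * t))\<close>, a function of time alone; only the derivative of this
  factor survives, which brings down \<epsilon> / (4 t^2).\<close>

lemma heat_gam:
  fixes z :: "'n::finite spacetime"
  assumes "open S" "smooth_on S (gam \<epsilon>)" "z \<in> S"
  shows "dir_deriv time_dir (gam \<epsilon>) z - laplacian_x (gam \<epsilon>) z = conc \<epsilon> z"
proof (cases "snd z > 0")
  case True
  have s: "sqn z = (\<Sum>i\<in>UNIV. (fst z $ i)\<^sup>2)" by (simp add: inner_vec_def power2_eq_square)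
  have "laplacian_x (gam \<epsilon>) z = (- real CARD('n) / (2 * snd z) + sqn z / (4 * (snd z)\<^sup>2)) * gam \<epsilon> z"
    unfolding laplacian_x_def gam_space_second[OF True] s
    by (simp add: sum.distrib sum_subtractf sum_distrib_right[symmetric] sum_divide_distrib[symmetric])
  then show ?thesis using True unfolding gam_time[OF True] conc_def
    by (simp add: algebra_simps add_divide_distrib)
next
  case False
  then show ?thesis unfolding laplacian_x_def conc_def
    using dir_deriv_gam_past[OF assms] by (simp add: gam_def)
qed

text \<open>Reflection flips first derivatives and keeps second ones, so the forward operator
  becomes the adjoint one.\<close>

lemma adj_heat_reflect:
  assumes "smooth_on UNIV f"
  shows "adj_heat (\<lambda>w. f (a - w)) z = dir_deriv time_dir f (a - z) - laplacian_x f (a - z)"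
proof -
  have "dir_deriv v (\<lambda>w. f (a - w)) = (\<lambda>z. - dir_deriv v f (a - z))" for v
    by (intro ext dir_deriv_reflect smooth_diff assms)
  moreover have "dir_deriv v (\<lambda>z. - dir_deriv v f (a - z)) z = dir_deriv v (dir_deriv v f) (a - z)" for v
    using dir_deriv_reflect[of "dir_deriv v f" a z] smooth_diff[OF smooth_on_dir_deriv[OF assms]]
    by (simp add: dir_deriv_minus)
  ultimately show ?thesis unfolding adj_heat_def laplacian_x_def by simp
qed

lemma adj_heat_gam: "\<epsilon> > 0 \<Longrightarrow> adj_heat (\<lambda>w. gam \<epsilon> (a - w)) z = conc \<epsilon> (a - z)"
  using heat_gam[OF open_UNIV smooth_gam] adj_heat_reflect[OF smooth_gam] by (metis UNIV_I)

lemma smooth_gam_reflect: "\<epsilon> > 0 \<Longrightarrow> smooth_on UNIV (\<lambda>w. gam \<epsilon> (a - w))"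
  using smooth_reflect[OF open_UNIV smooth_gam] by simp

text \<open>The cross term of the product rule changes sign because the kernel is reflected. The
  last two summands live only where the cutoff varies.\<close>

lemma adj_heat_cutoff_gam:
  assumes "\<epsilon> > 0" "smooth_on UNIV \<eta>"
  shows "adj_heat (\<lambda>w. \<eta> w * gam \<epsilon> (a - w)) z = \<eta> z * conc \<epsilon> (a - z) + gam \<epsilon> (a - z) * adj_heat \<eta> z
    + 2 * (\<Sum>i\<in>UNIV. dir_deriv (space_dir i) \<eta> z * dir_deriv (space_dir i) (gam \<epsilon>) (a - z))"
  unfolding adj_heat_mult[OF assms(2) smooth_gam_reflect[OF assms(1)]] adj_heat_gam[OF assms(1)]
  by (simp add: dir_deriv_reflect(2)[OF smooth_diff[OF smooth_gam[OF assms(1)]]] sum_negf)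

lemma conc_nonneg: "\<epsilon> \<ge> 0 \<Longrightarrow> conc \<epsilon> z \<ge> 0" by (simp add: conc_def gam_nonneg)

section \<open>Gaussian integrals\<close>

text \<open>The value is (4 \<pi>)^(n/2); it enters the estimates as some finite constant.\<close>

definition gauss_mass :: "'n::finite itself \<Rightarrow> ennreal" where
  "gauss_mass _ = (\<integral>\<^sup>+x. ennreal (exp (- (x \<bullet> x) / 4)) \<partial>(lborel :: (real ^ 'n) measure))"

lemma gauss_mass_finite: "gauss_mass TYPE('n::finite) < \<infinity>"
proof -
  have 1: "(\<integral>\<^sup>+x. ennreal (exp (- x\<^sup>2 / 4)) \<partial>(lborel :: real measure)) < \<infinity>"
  proof -
    have "(\<lambda>x. exp (- x\<^sup>2 / 4)) = (\<lambda>x. sqrt (2 * pi * (sqrt 2)\<^sup>2) * normal_density 0 (sqrt 2) x)"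
      by (auto simp: normal_density_def fun_eq_iff)
    then have "integrable lborel (\<lambda>x::real. exp (- x\<^sup>2 / 4))" by simp
    then show ?thesis by (simp add: integrable_iff_bounded)
  qed
  have "gauss_mass TYPE('n) =
    (\<integral>\<^sup>+x. (\<Prod>b\<in>Basis. ennreal (exp (- (x \<bullet> b)\<^sup>2 / 4))) \<partial>(lborel :: (real ^ 'n) measure))"
    unfolding gauss_mass_def
  proof (rule nn_integral_cong)
    fix x :: "real ^ 'n"
    have "x \<bullet> x = (\<Sum>b\<in>Basis. (x \<bullet> b)\<^sup>2)"
      using euclidean_inner[of x x] by (simp add: power2_eq_square)
    then have "exp (- (x \<bullet> x) / 4) = exp (\<Sum>b\<in>Basis. - (x \<bullet> b)\<^sup>2 / 4)"
      by (simp add: sum_negf sum_divide_distrib)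
    then show "ennreal (exp (- (x \<bullet> x) / 4)) = (\<Prod>b\<in>Basis. ennreal (exp (- (x \<bullet> b)\<^sup>2 / 4)))"
      by (simp add: exp_sum prod_ennreal)
  qed
  also have "\<dots> = (\<Prod>b\<in>(Basis :: (real ^ 'n) set). (\<integral>\<^sup>+x. ennreal (exp (- x\<^sup>2 / 4)) \<partial>lborel))"
    by (rule nn_integral_lborel_prod) auto
  also have "\<dots> < \<infinity>" using 1 by (simp add: power_less_top_ennreal)
  finally show ?thesis .
qed

lemma fst_spacetime_measurable[measurable]: "(fst :: 'n::finite spacetime \<Rightarrow> real ^ 'n) \<in> borel_measurable borel"
  and snd_spacetime_measurable[measurable]: "(snd :: 'n::finite spacetime \<Rightarrow> real) \<in> borel_measurable borel"
  by (intro borel_measurable_continuous_onI continuous_intros)+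

lemma sqrt_mult_self_left: "x > 0 \<Longrightarrow> sqrt x * (sqrt x * y) = x * y"
  by (simp flip: mult.assoc)

lemma gauss_scale:
  assumes "\<tau> > 0"
  shows "(\<integral>\<^sup>+x. ennreal (exp (- (x \<bullet> x) / (4 * \<tau>))) \<partial>(lborel :: (real ^ 'n::finite) measure))
     = ennreal (\<tau> powr (real CARD('n) / 2)) * gauss_mass TYPE('n)"
proof -
  have p: "\<bar>sqrt \<tau>\<bar> ^ DIM(real^'n) = \<tau> powr (real CARD('n) / 2)"
    using assms by (simp add: powr_half_sqrt[symmetric] powr_powr powr_realpow[symmetric])
  show ?thesis
    apply (subst lborel_affine[of "sqrt \<tau>" 0])
    using assms p by (simp_all add: nn_integral_density nn_integral_distr nn_integral_cmult gauss_mass_def sqrt_mult_self_left)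
qed

text \<open>Tonelli with the Gaussian integrated out at each time, which contributes the power n/2
  of \<tau>. The masses of \<open>conc 1\<close> and of the kernel on a strip become one-dimensional
  integrals.\<close>

lemma nn_integral_spacetime:
  fixes a :: "real \<Rightarrow> real"
  assumes [measurable]: "a \<in> borel_measurable borel" and a: "\<And>\<tau>. a \<tau> \<ge> 0" "\<And>\<tau>. \<tau> \<le> 0 \<Longrightarrow> a \<tau> = 0"
  shows "(\<integral>\<^sup>+z. ennreal (a (snd z) * exp (- sqn z / (4 * snd z))) \<partial>(lborel :: ('n::finite spacetime) measure))
    = (\<integral>\<^sup>+\<tau>. ennreal (a \<tau> * \<tau> powr (real CARD('n) / 2)) \<partial>lborel) * gauss_mass TYPE('n)"
proof -
  let ?f = "\<lambda>z::'n spacetime. ennreal (a (snd z) * exp (- sqn z / (4 * snd z)))"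
  have [measurable]: "?f \<in> borel_measurable (lborel \<Otimes>\<^sub>M lborel)"
    unfolding lborel_prod by simp
  have "(\<integral>\<^sup>+z. ?f z \<partial>lborel) = (\<integral>\<^sup>+\<tau>. (\<integral>\<^sup>+x. ?f (x, \<tau>) \<partial>lborel) \<partial>lborel)"
    unfolding lborel_prod[symmetric] by (rule lborel_pair.nn_integral_snd[symmetric]) measurable
  also have "\<dots> = (\<integral>\<^sup>+\<tau>. ennreal (a \<tau> * \<tau> powr (real CARD('n) / 2)) * gauss_mass TYPE('n) \<partial>lborel)"
  proof (rule nn_integral_cong)
    fix \<tau> :: real
    show "(\<integral>\<^sup>+x. ?f (x, \<tau>) \<partial>lborel) = ennreal (a \<tau> * \<tau> powr (real CARD('n) / 2)) * gauss_mass TYPE('n)"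
    proof (cases "\<tau> > 0")
      case True
      have "(\<integral>\<^sup>+x. ?f (x, \<tau>) \<partial>lborel) = (\<integral>\<^sup>+x. ennreal (a \<tau>) * ennreal (exp (- (x \<bullet> x) / (4 * \<tau>))) \<partial>(lborel :: (real^'n) measure))"
        by (simp add: ennreal_mult' a)
      also have "\<dots> = ennreal (a \<tau>) * (ennreal (\<tau> powr (real CARD('n) / 2)) * gauss_mass TYPE('n))"
        by (subst nn_integral_cmult) (auto simp: gauss_scale[OF True, symmetric])
      finally show ?thesis by (simp add: ennreal_mult' a mult.assoc)
    qed (simp add: a)
  qed
  also have "\<dots> = (\<integral>\<^sup>+\<tau>. ennreal (a \<tau> * \<tau> powr (real CARD('n) / 2)) \<partial>lborel) * gauss_mass TYPE('n)"
    by (rule nn_integral_multc) measurable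
  finally show ?thesis .
qed

lemma flat_measurable[measurable]: "flat m \<in> borel_measurable borel"
  unfolding flat_def[abs_def] by measurable

lemma gam_measurable[measurable]: "gam \<epsilon> \<in> borel_measurable borel"
  unfolding gam_def[abs_def] borel_prod[symmetric] by measurable

lemma conc_measurable[measurable]: "conc \<epsilon> \<in> borel_measurable borel"
proof -
  show ?thesis unfolding conc_def[abs_def] by measurable
qed

text \<open>Once space is integrated out, what remains is \<open>1/4 * flat (-2)\<close>, the
  derivative of \<open>flat 0\<close>, whose increment over the half-line is 1.\<close>

lemma integrable_conc: "integrable lborel (conc 1 :: 'n::finite spacetime \<Rightarrow> real)"
proof -
  let ?n = "real CARD('n) / 2"
  define a where "a = (\<lambda>\<tau>::real. 1/4 * flat (-2 - ?n) \<tau>)"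
  have eq: "conc 1 z = a (snd z) * exp (- sqn z / (4 * snd z))" for z :: "'n spacetime"
  proof (cases "snd z > 0")
    case True
    have "- (sqn z + 1) / (4 * snd z) = - (1 / (4 * snd z)) + (- sqn z / (4 * snd z))"
      by (simp add: add_divide_distrib diff_divide_distrib)
    then have "exp (- (sqn z + 1) / (4 * snd z)) = exp (- (1 / (4 * snd z))) * exp (- sqn z / (4 * snd z))"
      by (simp only: exp_add)
    moreover have "snd z powr (-2 - ?n) = snd z powr (- real CARD('n) / 2) / (snd z)\<^sup>2"
    proof -
      have "-2 - ?n = - real CARD('n) / 2 + -2" by simp
      then have "snd z powr (-2 - ?n) = snd z powr (- real CARD('n) / 2) * snd z powr (- 2)"
        by (simp only: powr_add)
      also have "snd z powr (- 2) = inverse ((snd z)\<^sup>2)" using True by (simp only: powr_minus powr_numeral)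
      finally show ?thesis by (simp only: divide_inverse)
    qed
    ultimately show ?thesis using True by (simp add: conc_def gam_def a_def flat_def)
  qed (simp add: conc_def gam_def a_def flat_def)
  have "(\<integral>\<^sup>+\<tau>. ennreal (a \<tau> * \<tau> powr ?n) \<partial>lborel) = (\<integral>\<^sup>+\<tau>. ennreal (1/4 * flat (-2) \<tau>) * indicator {0..} \<tau> \<partial>lborel)"
  proof (rule nn_integral_cong)
    fix \<tau> :: real
    have "\<tau> > 0 \<Longrightarrow> \<tau> powr (-2 - ?n) * \<tau> powr ?n = \<tau> powr (-2)" by (subst powr_add[symmetric]) simp
    then have *: "a \<tau> * \<tau> powr ?n = 1/4 * flat (-2) \<tau>" by (auto simp: a_def flat_def mult_ac)
    show "ennreal (a \<tau> * \<tau> powr ?n) = ennreal (1/4 * flat (-2) \<tau>) * indicator {0..} \<tau>"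
      unfolding * by (auto simp: indicator_def flat_def)
  qed
  also have "\<dots> = ennreal (1 - flat 0 0)"
  proof (rule nn_integral_FTC_atLeast[where F="flat 0" and T=1])
    show "(flat 0 has_real_derivative 1 / 4 * flat (- 2) x) (at x)" for x
      using DERIV_flat[of 0 x] by simp
    show "(flat 0 \<longlongrightarrow> 1) at_top" by (rule flat_at_top(1))
  qed (auto simp: flat_nonneg)
  finally have 1: "(\<integral>\<^sup>+\<tau>. ennreal (a \<tau> * \<tau> powr ?n) \<partial>lborel) = 1" by (simp add: flat_def)
  have "(\<integral>\<^sup>+z. ennreal (conc 1 z) \<partial>(lborel :: 'n spacetime measure)) = gauss_mass TYPE('n)"
  proof -
    have "a \<tau> \<ge> 0" "\<tau> \<le> 0 \<Longrightarrow> a \<tau> = 0" "a \<in> borel_measurable borel" for \<tau>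
      by (auto simp: a_def flat_nonneg flat_0)
    then show ?thesis unfolding eq by (subst nn_integral_spacetime) (auto simp: 1)
  qed
  then show ?thesis
    using gauss_mass_finite[where 'n='n]
    by (intro integrableI_bounded) (simp_all add: abs_of_nonneg conc_nonneg)
qed

lemma integral_conc_pos: "integral\<^sup>L lborel (conc 1 :: 'n::finite spacetime \<Rightarrow> real) > 0"
proof -
  let ?c = "conc 1 :: 'n spacetime \<Rightarrow> real"
  have "integral\<^sup>L lborel ?c \<noteq> 0"
  proof
    assume "integral\<^sup>L lborel ?c = 0"
    then have "AE z in lborel. ?c z = 0"
      using integral_nonneg_eq_0_iff_AE[OF integrable_conc[where 'n='n]] by (simp add: conc_nonneg)
    then have "AE z in (lborel :: 'n spacetime measure). \<not> snd z > 0"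
      by eventually_elim (auto simp: conc_def gam_def)
    then have "{z::'n spacetime. snd z > 0} \<in> null_sets lborel"
      using AE_iff_null_sets[of "{z::'n spacetime. snd z > 0}" lborel] open_snd_pos by (simp add: borel_open)
    then show False
      using open_not_negligible[OF open_snd_pos] 
      by (metis (mono_tags, lifting) completion.null_sets_outer empty_iff mem_Collect_eq negligible_iff_null_sets null_sets_completionI snd_conv zero_less_one)
  qed
  moreover have "integral\<^sup>L lborel ?c \<ge> 0" by (simp add: conc_nonneg)
  ultimately show ?thesis by simp
qed

text \<open>All time slices of the heat kernel carry the same mass. Since \<open>gam\<close>
  decreases in \<epsilon>, this bounds the regularised kernels uniformly in \<epsilon>.\<close>

lemma integral_gam_strip:
  assumes T: "T > 0"
  shows "integrable lborel (\<lambda>z::'n::finite spacetime. gam 0 z * indicator {0..T} (snd z))"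
    and "integral\<^sup>L lborel (\<lambda>z::'n::finite spacetime. gam 0 z * indicator {0..T} (snd z)) = T * enn2real (gauss_mass TYPE('n))"
proof -
  let ?n = "real CARD('n) / 2"
  define a where "a = (\<lambda>\<tau>::real. if \<tau> > 0 then \<tau> powr (- real CARD('n) / 2) * indicator {0..T} \<tau> else 0)"
  have [measurable]: "a \<in> borel_measurable borel" unfolding a_def by measurable
  have eq: "gam 0 z * indicator {0..T} (snd z) = a (snd z) * exp (- sqn z / (4 * snd z))" for z :: "'n spacetime"
    by (auto simp: gam_def a_def)
  have "(\<integral>\<^sup>+\<tau>. ennreal (a \<tau> * \<tau> powr ?n) \<partial>lborel) = (\<integral>\<^sup>+\<tau>. indicator {0<..T} \<tau> \<partial>lborel)"
  proof (rule nn_integral_cong)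
    fix \<tau> :: real
    have "\<tau> > 0 \<Longrightarrow> \<tau> powr (- real CARD('n) / 2) * \<tau> powr ?n = 1" by (subst powr_add[symmetric]) simp
    then show "ennreal (a \<tau> * \<tau> powr ?n) = indicator {0<..T} \<tau>"
      by (auto simp: a_def indicator_def)
  qed
  then have 1: "(\<integral>\<^sup>+\<tau>. ennreal (a \<tau> * \<tau> powr ?n) \<partial>lborel) = ennreal T" using T by simp
  have nn: "(\<integral>\<^sup>+z. ennreal (gam 0 z * indicator {0..T} (snd z)) \<partial>(lborel :: 'n spacetime measure)) = T * gauss_mass TYPE('n)"
  proof -
    have "a \<tau> \<ge> 0" "\<tau> \<le> 0 \<Longrightarrow> a \<tau> = 0" for \<tau> by (auto simp: a_def)
    then show ?thesis unfolding eq by (subst nn_integral_spacetime) (auto simp: 1)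
  qed
  have [measurable]: "(\<lambda>z::'n::finite spacetime. gam 0 z * indicator {0..T} (snd z)) \<in> borel_measurable borel"
    unfolding eq borel_prod[symmetric] by measurable
  show "integrable lborel (\<lambda>z::'n::finite spacetime. gam 0 z * indicator {0..T} (snd z))"
    using gauss_mass_finite[where 'n='n] T
    by (intro integrableI_bounded) (simp_all add: nn gam_nonneg abs_mult ennreal_mult_less_top)
  show "integral\<^sup>L lborel (\<lambda>z::'n::finite spacetime. gam 0 z * indicator {0..T} (snd z)) = T * enn2real (gauss_mass TYPE('n))"
    by (subst integral_eq_nn_integral) (use T in \<open>auto simp: nn gam_nonneg enn2real_mult\<close>)
qed

section \<open>Parabolic affine substitution\<close>

text \<open>The factors are independent: r and r^2 give the parabolic rescaling, and
  \<open>- sqrt \<epsilon>\<close> with \<open>- \<epsilon>\<close> the reflected one that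
  normalises the approximate identity.\<close>

definition paff :: "'n::finite spacetime \<Rightarrow> real \<Rightarrow> real \<Rightarrow> 'n spacetime \<Rightarrow> 'n spacetime" where
  "paff z0 a b z = z0 + (a *\<^sub>R fst z, b * snd z)"

lemma lborel_paff:
  assumes "a \<noteq> 0" "b \<noteq> 0"
  shows "(lborel :: ('n::finite spacetime) measure) =
    density (distr lborel borel (paff z0 a b)) (\<lambda>_. ennreal (\<bar>a\<bar> ^ CARD('n) * \<bar>b\<bar>))"
proof -
  \<comment> \<open>One factor for each basis vector; \<open>snd j = 0\<close> singles out the
    spatial ones.\<close>
  define c :: "'n spacetime \<Rightarrow> real" where "c j = (if snd j = 0 then a else b)" for j
  have T: "z0 + (\<Sum>j\<in>Basis. (c j * (z \<bullet> j)) *\<^sub>R j) = paff z0 a b z" for z :: "'n spacetime"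
  proof -
    have "(\<Sum>j\<in>Basis. (c j * (z \<bullet> j)) *\<^sub>R j) = (a *\<^sub>R fst z, b * snd z)"
    proof (rule euclidean_eqI)
      fix k :: "'n spacetime" assume k: "k \<in> Basis"
      have "(\<Sum>j\<in>Basis. (c j * (z \<bullet> j)) *\<^sub>R j) \<bullet> k = c k * (z \<bullet> k)"
        using k by simp
      also have "\<dots> = (a *\<^sub>R fst z, b * snd z) \<bullet> k"
        using k by (cases z) (auto simp: Basis_prod_def c_def)
      finally show "(\<Sum>j\<in>Basis. (c j * (z \<bullet> j)) *\<^sub>R j) \<bullet> k = (a *\<^sub>R fst z, b * snd z) \<bullet> k" .
    qed
    then show ?thesis by (simp add: paff_def)
  qed
  have pr: "(\<Prod>j\<in>Basis. \<bar>c j\<bar>) = \<bar>a\<bar> ^ CARD('n) * \<bar>b\<bar>"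
  proof -
    have "(\<Prod>j\<in>Basis. \<bar>c j\<bar>) = (\<Prod>j\<in>(\<lambda>u. (u, 0)) ` (Basis :: (real^'n) set). \<bar>c j\<bar>) * (\<Prod>j\<in>(\<lambda>v. (0, v)) ` (Basis :: real set). \<bar>c j\<bar>)"
      unfolding Basis_prod_def by (rule prod.union_disjoint) auto
    also have "(\<Prod>j\<in>(\<lambda>u. (u, 0)) ` (Basis :: (real^'n) set). \<bar>c j\<bar>) = \<bar>a\<bar> ^ CARD('n)"
      by (subst prod.reindex) (auto simp: inj_on_def c_def)
    also have "(\<Prod>j\<in>(\<lambda>v. (0, v)) ` (Basis :: real set). \<bar>c j\<bar>) = \<bar>b\<bar>"
      by (simp add: c_def)
    finally show ?thesis .
  qed
  have "lborel = density (distr lborel borel (\<lambda>x. z0 + (\<Sum>j\<in>Basis. (c j * (x \<bullet> j)) *\<^sub>R j))) (\<lambda>_. (\<Prod>j\<in>Basis. \<bar>c j\<bar>))"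
    by (rule lborel_affine_euclidean) (use assms in \<open>auto simp: c_def\<close>)
  then show ?thesis unfolding T pr .
qed

lemma paff_measurable[measurable]: "paff z0 a b \<in> borel_measurable borel"
  unfolding paff_def[abs_def] by (intro borel_measurable_continuous_onI continuous_intros)

lemma integral_paff:
  fixes F :: "'n::finite spacetime \<Rightarrow> real"
  assumes "a \<noteq> 0" "b \<noteq> 0" and [measurable]: "F \<in> borel_measurable borel"
  shows "integral\<^sup>L lborel F = (\<bar>a\<bar> ^ CARD('n) * \<bar>b\<bar>) * (\<integral>z. F (paff z0 a b z) \<partial>lborel)"
proof -
  have "integral\<^sup>L lborel F = integral\<^sup>L (density (distr lborel borel (paff z0 a b)) (\<lambda>_. ennreal (\<bar>a\<bar> ^ CARD('n) * \<bar>b\<bar>))) F"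
    using lborel_paff[OF assms(1,2), of z0] by simp
  also have "\<dots> = (\<bar>a\<bar> ^ CARD('n) * \<bar>b\<bar>) * (\<integral>z. F (paff z0 a b z) \<partial>lborel)"
    by (subst integral_density) (auto simp: integral_distr)
  finally show ?thesis .
qed

text \<open>The prefactor is the Jacobian of the parabolic dilation, so all
  \<open>conc \<epsilon>\<close> have the mass of \<open>conc 1\<close>.\<close>

lemma conc_scale:
  fixes z :: "'n::finite spacetime"
  assumes "\<epsilon> > 0"
  shows "(sqrt \<epsilon> ^ CARD('n) * \<epsilon>) * conc \<epsilon> (sqrt \<epsilon> *\<^sub>R fst z, \<epsilon> * snd z) = conc 1 z"
proof (cases "snd z > 0")
  case True
  have p: "sqrt \<epsilon> ^ CARD('n) = \<epsilon> powr (real CARD('n) / 2)"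
    using assms by (simp add: powr_half_sqrt[symmetric] powr_powr powr_realpow[symmetric])
  have q: "\<epsilon> powr (real CARD('n) / 2) * (\<epsilon> * snd z) powr (- real CARD('n) / 2) = snd z powr (- real CARD('n) / 2)"
    using assms True by (simp add: powr_mult powr_minus)
  have e: "(\<epsilon> * sqn z + \<epsilon>) / (4 * (\<epsilon> * snd z)) = (sqn z + 1) / (4 * snd z)"
    using assms True by (simp add: field_simps)
  have e2: "(- sqn z - 1) / (4 * snd z) = - ((sqn z + 1) / (4 * snd z))"
    by (simp add: add_divide_distrib diff_divide_distrib)
  have "(sqrt \<epsilon> ^ CARD('n) * \<epsilon>) * conc \<epsilon> (sqrt \<epsilon> *\<^sub>R fst z, \<epsilon> * snd z) =
     (\<epsilon> powr (real CARD('n) / 2) * (\<epsilon> * snd z) powr (- real CARD('n) / 2)) * (\<epsilon> * (\<epsilon> / (4 * (\<epsilon> * snd z)\<^sup>2)))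
      * exp (- ((\<epsilon> * sqn z + \<epsilon>) / (4 * (\<epsilon> * snd z))))"
    using minus_divide_left[of "\<epsilon> * sqn z + \<epsilon>" "4 * (\<epsilon> * snd z)"] assms True by (simp add: conc_def gam_def p sqrt_mult_self_left)
  also have "\<dots> = conc 1 z" unfolding q e using assms True
    by (simp add: conc_def gam_def power2_eq_square e2)
  finally show ?thesis .
qed (use assms in \<open>simp add: conc_def gam_def zero_less_mult_iff\<close>)

text \<open>Substituting the reflected dilation around \<open>z1\<close> freezes the weight at
  \<open>conc 1\<close> and moves the \<epsilon>-dependence into the argument of \<open>g\<close>,
  which tends to \<open>z1\<close>. Dominated convergence with majorant \<open>M * conc 1\<close>
  finishes, so continuity at the single point \<open>z1\<close> is enough.\<close>

lemma concentration:
  fixes g :: "'n::finite spacetime \<Rightarrow> real"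
  assumes [measurable]: "g \<in> borel_measurable borel" and M: "\<And>z. \<bar>g z\<bar> \<le> M" and c: "isCont g z1"
    and X: "\<And>k. X k > 0" "X \<longlonglongrightarrow> 0"
  shows "(\<lambda>k. \<integral>z. g z * conc (X k) (z1 - z) \<partial>lborel) \<longlonglongrightarrow> g z1 * integral\<^sup>L lborel (conc 1 :: 'n spacetime \<Rightarrow> real)"
    and "integrable lborel (\<lambda>z. g z * conc (X k) (z1 - z))"
proof -
  have m1[measurable]: "(\<lambda>z. g z * conc (X k) (z1 - z)) \<in> borel_measurable borel" for k by measurable
  have sub: "sqrt (X k) ^ CARD('n) * X k * (g (paff z1 (- sqrt (X k)) (- X k) z) * conc (X k) (z1 - paff z1 (- sqrt (X k)) (- X k) z)) =
    g (paff z1 (- sqrt (X k)) (- X k) z) * conc 1 z" for k z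
    using conc_scale[OF X(1), of k z] by (cases z1) (simp add: paff_def mult_ac)
  have eq: "(\<integral>z. g z * conc (X k) (z1 - z) \<partial>lborel) = (\<integral>z. g (paff z1 (- sqrt (X k)) (- X k) z) * conc 1 z \<partial>lborel)" for k
  proof -
    have "(\<integral>z. g z * conc (X k) (z1 - z) \<partial>lborel) = (sqrt (X k) ^ CARD('n) * X k) *
        (\<integral>z. g (paff z1 (- sqrt (X k)) (- X k) z) * conc (X k) (z1 - paff z1 (- sqrt (X k)) (- X k) z) \<partial>lborel)"
      using X(1)[of k] by (subst integral_paff[of "- sqrt (X k)" "- X k" _ z1]) auto
    also have "\<dots> = (\<integral>z. g (paff z1 (- sqrt (X k)) (- X k) z) * conc 1 z \<partial>lborel)"
      by (simp only: integral_mult_right_zero[symmetric] sub)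
    finally show ?thesis .
  qed
  have sq: "(\<lambda>k. sqrt (X k)) \<longlonglongrightarrow> 0" using tendsto_real_sqrt[OF X(2)] by simp
  have l: "(\<lambda>k. paff z1 (- sqrt (X k)) (- X k) z) \<longlonglongrightarrow> z1" for z
  proof -
    have "(\<lambda>k. z1 + ((- sqrt (X k)) *\<^sub>R fst z, (- X k) * snd z)) \<longlonglongrightarrow> z1 + ((- 0) *\<^sub>R fst z, (- 0) * snd z)"
      by (intro tendsto_intros sq X(2))
    then show ?thesis by (simp add: paff_def zero_prod_def[symmetric])
  qed
  show "(\<lambda>k. \<integral>z. g z * conc (X k) (z1 - z) \<partial>lborel) \<longlonglongrightarrow> g z1 * integral\<^sup>L lborel (conc 1 :: 'n spacetime \<Rightarrow> real)"
    unfolding eq integral_mult_right_zero[symmetric]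
  proof (rule integral_dominated_convergence[where w="\<lambda>z. M * conc 1 z"])
    show "AE z in lborel. (\<lambda>k. g (paff z1 (- sqrt (X k)) (- X k) z) * conc 1 z) \<longlonglongrightarrow> g z1 * conc 1 z"
      by (intro always_eventually allI tendsto_mult tendsto_const isCont_tendsto_compose[OF c l])
    show "AE z in lborel. norm (g (paff z1 (- sqrt (X k)) (- X k) z) * conc 1 z) \<le> M * conc 1 z" for k
      by (intro always_eventually allI) (auto simp: abs_mult conc_nonneg intro!: mult_right_mono M)
  qed (auto intro!: integrable_conc)
  show "integrable lborel (\<lambda>z. g z * conc (X k) (z1 - z))" for k
  proof -
    have "integrable lborel (\<lambda>z. g (paff z1 (- sqrt (X k)) (- X k) z) * conc 1 z)"
      by (rule Bochner_Integration.integrable_bound[of _ "\<lambda>z. M * conc 1 z"])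
        (auto intro!: integrable_conc mult_right_mono always_eventually order_trans[OF M abs_ge_self]
          simp: abs_mult conc_nonneg simp del: split_paired_All)
    then have *: "integrable lborel (\<lambda>z. sqrt (X k) ^ CARD('n) * X k * (g (paff z1 (- sqrt (X k)) (- X k) z) * conc (X k) (z1 - paff z1 (- sqrt (X k)) (- X k) z)))"
      unfolding sub .
    show ?thesis
      apply (subst lborel_paff[of "- sqrt (X k)" "- X k" z1])
      using X(1)[of k] * by (auto simp: integrable_density integrable_distr_eq less_imp_neq[symmetric])
  qed
qed

section \<open>Test functions and weak inequalities\<close>

lemma dir_deriv_vanish:
  assumes "closed K" "\<And>z. z \<notin> K \<Longrightarrow> \<phi> z = 0" "z \<notin> K"
  shows "dir_deriv v \<phi> z = 0"
proof -
  have "dir_deriv v (\<lambda>_. 0) z = dir_deriv v \<phi> z"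
    by (rule dir_deriv_cong_open(2)[of "- K"]) (use assms in \<open>auto simp: open_Compl\<close>)
  then show ?thesis by (simp add: dir_deriv_const)
qed

lemma adj_heat_vanish:
  assumes "closed K" "\<And>z. z \<notin> K \<Longrightarrow> \<phi> z = 0" "z \<notin> K"
  shows "adj_heat \<phi> z = 0"
  unfolding adj_heat_def laplacian_x_def
  using dir_deriv_vanish[OF assms(1,2)] dir_deriv_vanish[OF assms(1) dir_deriv_vanish[OF assms(1,2)]] assms(3)
  by simp

lemma test_functionI:
  assumes "smooth_on UNIV \<phi>" "compact K" "K \<subseteq> \<Omega>" "\<And>z. z \<notin> K \<Longrightarrow> \<phi> z = 0"
  shows "test_function \<Omega> \<phi>"
proof -
  have "closure {z. \<phi> z \<noteq> 0} \<subseteq> K"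
    by (rule closure_minimal) (use assms compact_imp_closed in auto)
  moreover from this have "K \<inter> closure {z. \<phi> z \<noteq> 0} = closure {z. \<phi> z \<noteq> 0}" by blast
  then have "compact (closure {z. \<phi> z \<noteq> 0})"
    using compact_Int_closed[OF assms(2) closed_closure, of "{z. \<phi> z \<noteq> 0}"] by (simp only:)
  ultimately show ?thesis unfolding test_function_def
    using assms(1,3) smooth_on_UNIV[of \<phi>] by blast
qed

lemma test_functionD:
  assumes "test_function \<Omega> \<phi>"
  shows "\<exists>K. smooth_on UNIV \<phi> \<and> compact K \<and> K \<subseteq> \<Omega> \<and> (\<forall>z. z \<notin> K \<longrightarrow> \<phi> z = 0)"
proof (intro exI[of _ "closure {z. \<phi> z \<noteq> 0}"] conjI allI impI)
  show "z \<notin> closure {z. \<phi> z \<noteq> 0} \<Longrightarrow> \<phi> z = 0" for z using closure_subset[of "{z. \<phi> z \<noteq> 0}"] by blast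
qed (use assms in \<open>auto simp: test_function_def smooth_on_UNIV\<close>)

lemma integrable_times_compact:
  fixes u h :: "'a::euclidean_space \<Rightarrow> real"
  assumes "compact K" "continuous_on K u" "continuous_on K h" "\<And>z. z \<notin> K \<Longrightarrow> h z = 0"
  shows "integrable lborel (\<lambda>z. u z * h z)"
proof -
  have "integrable lborel (\<lambda>x. indicator K x *\<^sub>R (u x * h x))"
    by (intro borel_integrable_compact continuous_intros assms)
  also have "(\<lambda>x. indicator K x *\<^sub>R (u x * h x)) = (\<lambda>z. u z * h z)"
    using assms(4) by (auto simp: indicator_def fun_eq_iff)
  finally show ?thesis .
qed

lemma integrable_smooth_compact:
  assumes "smooth_on UNIV h" "compact K" "\<And>z. z \<notin> K \<Longrightarrow> h z = 0"
  shows "integrable lborel h"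
  using integrable_times_compact[OF assms(2) continuous_on_const[of K 1] _ assms(3)]
    smooth_on_continuous[OF smooth_on_subset[OF assms(1) subset_UNIV]] by simp

lemma integrable_adj_heat:
  assumes "smooth_on UNIV \<phi>" "compact K" "\<And>z. z \<notin> K \<Longrightarrow> \<phi> z = 0" "continuous_on K u"
  shows "integrable lborel (\<lambda>z. u z * adj_heat \<phi> z)"
  using smooth_on_continuous[OF smooth_on_subset[OF smooth_on_adj_heat[OF open_UNIV assms(1)] subset_UNIV]]
    adj_heat_vanish[OF compact_imp_closed[OF assms(2)] assms(3)]
  by (intro integrable_times_compact[OF assms(2,4)]) auto

text \<open>Translation invariance makes every difference quotient integrate to 0; the mean value
  theorem bounds the quotients on a common compact set, so the limit may be taken inside.\<close>

lemma integral_dir_deriv_zero: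
  fixes F :: "'a::euclidean_space \<Rightarrow> real"
  assumes F: "smooth_on UNIV F" and K: "compact K" "\<And>z. z \<notin> K \<Longrightarrow> F z = 0"
  shows "integral\<^sup>L lborel (dir_deriv v F) = 0"
proof -
  define h where "h k = inverse (real (Suc k))" for k
  have h: "h k > 0" "h k \<le> 1" for k by (auto simp: h_def inverse_le_1_iff)
  have hl: "h \<longlonglongrightarrow> 0" unfolding h_def by (rule LIMSEQ_inverse_real_of_nat)
  define q where "q k z = (F (z + h k *\<^sub>R v) - F z) / h k" for k z
  have Fi: "integrable lborel F" by (rule integrable_smooth_compact[OF F K])
  have Fm[measurable]: "F \<in> borel_measurable borel" using borel_measurable_integrable[OF Fi] by simp
  have tr: "integral\<^sup>L lborel (\<lambda>z. F (z + w)) = integral\<^sup>L lborel F" "integrable lborel (\<lambda>z. F (z + w))" for w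
  proof -
    have d: "distr lborel borel (\<lambda>z. z + w) = lborel" 
    proof -
      have "(\<lambda>z. z + w) = (+) w" by (auto simp: add.commute fun_eq_iff)
      then show ?thesis using lborel_distr_plus[of w] by simp
    qed
    show "integral\<^sup>L lborel (\<lambda>z. F (z + w)) = integral\<^sup>L lborel F"
      using integral_distr[of "\<lambda>z. z + w" lborel borel F] d by simp
    show "integrable lborel (\<lambda>z. F (z + w))"
      using integrable_distr_eq[of "\<lambda>z. z + w" lborel borel F] d Fi by simp
  qed
  have q0: "integral\<^sup>L lborel (q k) = 0" for k
    unfolding q_def using tr[of "h k *\<^sub>R v"] Fi by simp
  have dc: "continuous_on UNIV (dir_deriv v F)"
    using smooth_on_continuous[OF smooth_on_dir_deriv[OF F]] .
  obtain B where B: "\<And>z. \<bar>dir_deriv v F z\<bar> \<le> B"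
  proof -
    have "compact (dir_deriv v F ` K)"
      by (intro compact_continuous_image K continuous_on_subset[OF dc]) auto
    then obtain B where B: "\<And>z. z \<in> K \<Longrightarrow> \<bar>dir_deriv v F z\<bar> \<le> B"
      using compact_imp_bounded[of "dir_deriv v F ` K"] unfolding bounded_iff by auto
    have "\<bar>dir_deriv v F z\<bar> \<le> max B 0" for z
      using B[of z] dir_deriv_vanish[OF compact_imp_closed[OF K(1)] K(2), where z=z and v=v] by (cases "z \<in> K") auto
    then show ?thesis using that by blast
  qed
  have B0: "B \<ge> 0" using B[of undefined] by linarith
  \<comment> \<open>All points that some translation by \<open>t *\<^sub>R v\<close> with 0 \<le> t
    \<le> 1 moves into \<open>K\<close>; it contains the supports of all difference
    quotients.\<close>
  define K' where "K' = (\<lambda>(x, t). x - t *\<^sub>R v) ` (K \<times> {0..1})"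
  have K': "compact K'" unfolding K'_def
    by (intro compact_continuous_image compact_Times K compact_Icc) (auto intro!: continuous_intros simp: split_beta)
  have qb: "\<bar>q k z\<bar> \<le> B * indicator K' z" for k z
  proof (cases "z \<in> K'")
    case True
    have "\<exists>x>0. x < h k \<and> F (z + h k *\<^sub>R v) - F (z + 0 *\<^sub>R v) = (h k - 0) * dir_deriv v F (z + x *\<^sub>R v)"
      using MVT2[of 0 "h k" "\<lambda>s. F (z + s *\<^sub>R v)" "\<lambda>s. dir_deriv v F (z + s *\<^sub>R v)"]
        line_has_real_derivative[OF smooth_diff[OF F]] h(1)[of k] by auto
    then show ?thesis using True h(1)[of k] B by (auto simp: q_def abs_mult)
  next
    case False
    have "z \<notin> K" using False unfolding K'_def by (force intro: image_eqI[of _ _ "(z, 0)"])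
    moreover have "z + h k *\<^sub>R v \<notin> K"
    proof
      assume "z + h k *\<^sub>R v \<in> K"
      then have "z \<in> K'" unfolding K'_def using h[of k]
        by (intro image_eqI[of _ _ "(z + h k *\<^sub>R v, h k)"]) (auto simp: less_imp_le)
      then show False using False by simp
    qed
    ultimately show ?thesis using False by (simp add: q_def K)
  qed
  have "(\<lambda>k. integral\<^sup>L lborel (q k)) \<longlonglongrightarrow> integral\<^sup>L lborel (dir_deriv v F)"
  proof (rule integral_dominated_convergence[where w="\<lambda>z. B * indicator K' z"])
    show "dir_deriv v F \<in> borel_measurable lborel" using borel_measurable_continuous_onI[OF dc] by simp
    show "q k \<in> borel_measurable lborel" for k unfolding q_def by measurable
    show "integrable lborel (\<lambda>z. B * indicat_real K' z)"
      using emeasure_compact_finite[OF K'] borel_closed[OF compact_imp_closed[OF K']] by (intro integrable_mult_right integrable_real_indicator) auto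
    show "AE z in lborel. (\<lambda>k. q k z) \<longlonglongrightarrow> dir_deriv v F z"
    proof (intro always_eventually allI)
      fix z
      have "((\<lambda>s. (F (z + s *\<^sub>R v) - F z) / s) \<longlongrightarrow> dir_deriv v F z) (at 0)"
        using line_has_real_derivative[OF smooth_diff[OF F], where z=z and s=0 and v=v] by (simp add: DERIV_def)
      moreover have "filterlim h (at 0) sequentially"
        using hl h(1) by (auto simp: filterlim_at less_imp_neq[symmetric])
      ultimately show "(\<lambda>k. q k z) \<longlonglongrightarrow> dir_deriv v F z" unfolding q_def
        by (rule filterlim_compose)
    qed
    show "AE z in lborel. norm (q k z) \<le> B * indicator K' z" for k using qb by simp
  qed
  then show ?thesis unfolding q0 by (simp add: LIMSEQ_const_iff)
qed

text \<open>Distributionally \<open>- k \<le> \<partial>\<^sub>t u - \<Delta>u \<le> 0\<close>: all that the growth estimate uses of the right-hand side \<open>f\<close>.\<close>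

definition heat_ineq :: "'n::finite spacetime set \<Rightarrow> ('n spacetime \<Rightarrow> real) \<Rightarrow> real \<Rightarrow> bool" where
  "heat_ineq \<Omega> u k \<longleftrightarrow> (\<forall>\<phi>. test_function \<Omega> \<phi> \<and> (\<forall>z. \<phi> z \<ge> 0) \<longrightarrow>
     - k * integral\<^sup>L lborel \<phi> \<le> (\<integral>z. u z * adj_heat \<phi> z \<partial>lborel) \<and> (\<integral>z. u z * adj_heat \<phi> z \<partial>lborel) \<le> 0)"

definition weakly_caloric :: "'n::finite spacetime set \<Rightarrow> ('n spacetime \<Rightarrow> real) \<Rightarrow> bool" where
  "weakly_caloric \<Omega> u \<longleftrightarrow> (\<forall>\<phi>. test_function \<Omega> \<phi> \<longrightarrow> (\<integral>z. u z * adj_heat \<phi> z \<partial>lborel) = 0)"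

lemma bounded_linear_par: "bounded_linear (\<lambda>w::'n::finite spacetime. (a *\<^sub>R fst w, b * snd w))"
  by (intro bounded_linear_Pair bounded_linear_compose[OF bounded_linear_scaleR_right bounded_linear_fst]
      bounded_linear_compose[OF bounded_linear_mult_right bounded_linear_snd])

text \<open>Pulling a test function back through the dilation transfers the rescaled equation to the
  original one. The Jacobian is r^(n+2), and \<open>adj_heat\<close> contributes r^(-2), which
  explains the different powers in the two integrals.\<close>

lemma scaled_test:
  fixes z0 :: "'n::finite spacetime"
  assumes r: "r > 0" and u: "continuous_on \<Omega> u" and \<phi>: "test_function \<Omega>' \<phi>"
    and sub: "\<And>z. z \<in> \<Omega>' \<Longrightarrow> paff z0 r (r\<^sup>2) z \<in> \<Omega>"
  obtains \<psi> where "test_function \<Omega> \<psi>" "(\<forall>z. \<phi> z \<ge> 0) \<longrightarrow> (\<forall>z. \<psi> z \<ge> 0)"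
    "integral\<^sup>L lborel \<psi> = r ^ CARD('n) * r\<^sup>2 * integral\<^sup>L lborel \<phi>"
    "(\<integral>z. u z * adj_heat \<psi> z \<partial>lborel) = r ^ CARD('n) * (\<integral>z. u (paff z0 r (r\<^sup>2) z) * adj_heat \<phi> z \<partial>lborel)"
proof -
  obtain K where K: "smooth_on UNIV \<phi>" "compact K" "K \<subseteq> \<Omega>'" "\<And>z. z \<notin> K \<Longrightarrow> \<phi> z = 0"
    using test_functionD[OF \<phi>] by auto
  let ?P = "paff z0 r (r\<^sup>2)"
  define A where "A = (\<lambda>w::'n spacetime. ((1/r) *\<^sub>R fst w, (1/r\<^sup>2) * snd w))"
  have A: "bounded_linear A" unfolding A_def by (rule bounded_linear_par)
  define b where "b = - A z0"
  define \<psi> where "\<psi> = (\<lambda>w. \<phi> (A w + b))"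
  have AP: "A (?P z) + b = z" for z
    using r by (simp add: A_def b_def paff_def prod_eq_iff algebra_simps add_divide_distrib)
  have PA: "?P (A w + b) = w" for w
    using r by (simp add: A_def b_def paff_def prod_eq_iff algebra_simps add_divide_distrib)
  have sm: "smooth_on UNIV \<psi>" unfolding \<psi>_def
    by (rule smooth_on_affine[OF open_UNIV open_UNIV A _ K(1)]) simp
  have cP: "continuous_on S ?P" for S unfolding paff_def[abs_def] by (intro continuous_intros)
  have cK: "compact (?P ` K)" by (rule compact_continuous_image[OF cP K(2)])
  have PK: "?P ` K \<subseteq> \<Omega>" using K(3) sub by auto
  have van: "\<psi> w = 0" if "w \<notin> ?P ` K" for w
    using that PA[of w] K(4)[of "A w + b"] unfolding \<psi>_def by force
  have test: "test_function \<Omega> \<psi>" by (rule test_functionI[OF sm cK PK van])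
  have dd: "dir_deriv v \<psi> = (\<lambda>w. dir_deriv (A v) \<phi> (A w + b))" for v
    unfolding \<psi>_def by (intro ext dir_deriv_affine(2)[OF A] smooth_diff K(1))
  have sd: "smooth_on UNIV (dir_deriv v \<phi>)" for v using K(1) smooth_on_dir_deriv by blast
  have At: "A time_dir = (1/r\<^sup>2) *\<^sub>R time_dir" by (simp add: A_def time_dir_def)
  have As: "A (space_dir i) = (1/r) *\<^sub>R space_dir i" for i by (simp add: A_def space_dir_def)
  have dt: "dir_deriv time_dir \<psi> w = (1/r\<^sup>2) * dir_deriv time_dir \<phi> (A w + b)" for w
    unfolding dd At by (rule dir_deriv_scaleR[OF smooth_diff[OF K(1)]])
  have ds: "dir_deriv (space_dir i) \<psi> = (\<lambda>w. (1/r) * dir_deriv (space_dir i) \<phi> (A w + b))" for i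
    unfolding dd As by (rule ext, rule dir_deriv_scaleR[OF smooth_diff[OF K(1)]])
  have ds2: "dir_deriv (space_dir i) (dir_deriv (space_dir i) \<psi>) w = 
      (1/r\<^sup>2) * dir_deriv (space_dir i) (dir_deriv (space_dir i) \<phi>) (A w + b)" for i w
  proof -
    have d1: "(\<lambda>w. dir_deriv (space_dir i) \<phi> (A w + b)) differentiable (at w)"
      by (rule dir_deriv_affine(1)[OF A smooth_diff[OF sd]])
    have d2: "dir_deriv (space_dir i) (\<lambda>w. dir_deriv (space_dir i) \<phi> (A w + b)) w
      = (1/r) * dir_deriv (space_dir i) (dir_deriv (space_dir i) \<phi>) (A w + b)"
      unfolding dir_deriv_affine(2)[OF A smooth_diff[OF sd]] As
      by (rule dir_deriv_scaleR[OF smooth_diff[OF sd]])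
    show ?thesis unfolding ds dir_deriv_cmult[OF d1] d2 by (simp add: power2_eq_square)
  qed
  have ah: "adj_heat \<psi> w = (1/r\<^sup>2) * adj_heat \<phi> (A w + b)" for w
    unfolding adj_heat_def laplacian_x_def dt ds2 by (simp add: sum_distrib_left algebra_simps sum_divide_distrib)
  have uc: "continuous_on (?P ` K) u" using u PK continuous_on_subset by blast
  have i1: "integrable lborel \<psi>" by (rule integrable_smooth_compact[OF sm cK van])
  have i2: "integrable lborel (\<lambda>z. u z * adj_heat \<psi> z)" by (rule integrable_adj_heat[OF sm cK van uc])
  have J: "\<bar>r\<bar> ^ CARD('n) * \<bar>r\<^sup>2\<bar> = r ^ CARD('n) * r\<^sup>2" using r by simp
  have e1: "integral\<^sup>L lborel \<psi> = r ^ CARD('n) * r\<^sup>2 * integral\<^sup>L lborel \<phi>"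
    using integral_paff[of r "r\<^sup>2" \<psi> z0] r borel_measurable_integrable[OF i1] J by (simp add: \<psi>_def AP)
  have "(\<integral>z. u z * adj_heat \<psi> z \<partial>lborel) = (r ^ CARD('n) * r\<^sup>2) * (\<integral>z. u (?P z) * adj_heat \<psi> (?P z) \<partial>lborel)"
    using integral_paff[of r "r\<^sup>2" "\<lambda>z. u z * adj_heat \<psi> z" z0] r borel_measurable_integrable[OF i2] J by simp
  also have "(\<lambda>z. u (?P z) * adj_heat \<psi> (?P z)) = (\<lambda>z. (1/r\<^sup>2) * (u (?P z) * adj_heat \<phi> z))"
    by (simp add: ah AP fun_eq_iff)
  also have "(r ^ CARD('n) * r\<^sup>2) * (\<integral>z. (1/r\<^sup>2) * (u (?P z) * adj_heat \<phi> z) \<partial>lborel) = r ^ CARD('n) * (\<integral>z. u (?P z) * adj_heat \<phi> z \<partial>lborel)"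
    using r by (simp only: integral_mult_right_zero) simp
  finally have e2: "(\<integral>z. u z * adj_heat \<psi> z \<partial>lborel) = r ^ CARD('n) * (\<integral>z. u (?P z) * adj_heat \<phi> z \<partial>lborel)" .
  show ?thesis by (rule that[OF test _ e1 e2]) (unfold \<psi>_def, blast)
qed

text \<open>The right-hand side picks up r^2, the same power as in the growth bound to be
  iterated.\<close>

lemma heat_ineq_scale:
  fixes u :: "'n::finite spacetime \<Rightarrow> real"
  assumes "heat_ineq \<Omega> u k" "r > 0" "continuous_on \<Omega> u" "\<And>z. z \<in> \<Omega>' \<Longrightarrow> paff z0 r (r\<^sup>2) z \<in> \<Omega>"
  shows "heat_ineq \<Omega>' (\<lambda>z. u (paff z0 r (r\<^sup>2) z)) (k * r\<^sup>2)"
  unfolding heat_ineq_def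
proof (intro allI impI, elim conjE)
  fix \<phi> assume \<phi>: "test_function \<Omega>' \<phi>" "\<forall>z. 0 \<le> \<phi> z"
  obtain \<psi> where \<psi>: "test_function \<Omega> \<psi>" "(\<forall>z. \<phi> z \<ge> 0) \<longrightarrow> (\<forall>z. \<psi> z \<ge> 0)"
    "integral\<^sup>L lborel \<psi> = r ^ CARD('n) * r\<^sup>2 * integral\<^sup>L lborel \<phi>"
    "(\<integral>z. u z * adj_heat \<psi> z \<partial>lborel) = r ^ CARD('n) * (\<integral>z. u (paff z0 r (r\<^sup>2) z) * adj_heat \<phi> z \<partial>lborel)"
    by (rule scaled_test[OF assms(2,3) \<phi>(1) assms(4)])
  have 1: "- k * (r ^ CARD('n) * r\<^sup>2 * integral\<^sup>L lborel \<phi>) \<le> r ^ CARD('n) * (\<integral>z. u (paff z0 r (r\<^sup>2) z) * adj_heat \<phi> z \<partial>lborel)"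
    and 2: "r ^ CARD('n) * (\<integral>z. u (paff z0 r (r\<^sup>2) z) * adj_heat \<phi> z \<partial>lborel) \<le> 0"
    using assms(1) \<psi>(1,2) \<phi>(2) unfolding heat_ineq_def \<psi>(3,4)[symmetric] by blast+
  have p: "r ^ CARD('n) > 0" using assms(2) by simp
  have "r ^ CARD('n) * (- (k * r\<^sup>2) * integral\<^sup>L lborel \<phi>) \<le> r ^ CARD('n) * (\<integral>z. u (paff z0 r (r\<^sup>2) z) * adj_heat \<phi> z \<partial>lborel)"
    using 1 by (simp add: algebra_simps)
  then show "- (k * r\<^sup>2) * integral\<^sup>L lborel \<phi> \<le> (\<integral>z. u (paff z0 r (r\<^sup>2) z) * adj_heat \<phi> z \<partial>lborel) \<and>
      (\<integral>z. u (paff z0 r (r\<^sup>2) z) * adj_heat \<phi> z \<partial>lborel) \<le> 0"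
    using p 2 by (simp only: mult_le_cancel_left_pos mult_le_0_iff) auto
qed

text \<open>The time coordinate has heat operator 1, so subtracting a multiple of it removes a
  constant right-hand side. By the Leibniz rule the integrand is \<phi> minus derivatives of
  compactly supported functions, which integrate to 0.\<close>

lemma integral_time_adj_heat:
  fixes \<phi> :: "'n::finite spacetime \<Rightarrow> real"
  assumes "test_function \<Omega> \<phi>"
  shows "(\<integral>z. (snd z - c) * adj_heat \<phi> z \<partial>lborel) = integral\<^sup>L lborel \<phi>"
proof -
  obtain K where K': "smooth_on UNIV \<phi>" "compact K" "K \<subseteq> \<Omega>" "\<And>z. z \<notin> K \<Longrightarrow> \<phi> z = 0"
    using test_functionD[OF assms] by auto
  note K = K'(1,2,4)
  define t where "t = (\<lambda>z::'n spacetime. snd z - c)"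
  have t: "smooth_on UNIV t" unfolding t_def by (intro smooth_on_diff smooth_snd smooth_on_const open_UNIV)
  have dt: "dir_deriv v t z = snd v" for v z
    unfolding t_def by (rule dir_deriv_eq) (auto intro!: derivative_eq_intros)
  have cl: "closed K" using K compact_imp_closed by blast
  have sd: "smooth_on UNIV (dir_deriv v \<phi>)" for v using K(1) smooth_on_dir_deriv by blast
  let ?s = "\<lambda>i z. t z * dir_deriv (space_dir i) \<phi> z"
  have e1: "dir_deriv time_dir (\<lambda>z. t z * \<phi> z) z = t z * dir_deriv time_dir \<phi> z + \<phi> z" for z
    by (simp add: dir_deriv_mult smooth_diff t K dt time_dir_def)
  have e2: "dir_deriv (space_dir i) (?s i) z = t z * dir_deriv (space_dir i) (dir_deriv (space_dir i) \<phi>) z" for i z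
    by (simp add: dir_deriv_mult smooth_diff t sd dt space_dir_def)
  have s1: "smooth_on UNIV (\<lambda>z. t z * \<phi> z)" and s2: "smooth_on UNIV (?s i)" for i
    by (intro smooth_on_mult open_UNIV t K sd)+
  have v2: "z \<notin> K \<Longrightarrow> ?s i z = 0" for i z using dir_deriv_vanish[OF cl K(3)] by simp
  have z1: "integral\<^sup>L lborel (dir_deriv time_dir (\<lambda>z. t z * \<phi> z)) = 0"
    by (rule integral_dir_deriv_zero[OF s1 K(2)]) (simp add: K)
  have z2: "integral\<^sup>L lborel (dir_deriv (space_dir i) (?s i)) = 0" for i
    by (rule integral_dir_deriv_zero[OF s2 K(2) v2])
  have i1: "integrable lborel (dir_deriv time_dir (\<lambda>z. t z * \<phi> z))"
    by (rule integrable_smooth_compact[OF smooth_on_dir_deriv[OF s1] K(2)])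
       (rule dir_deriv_vanish[OF cl], simp_all add: K)
  have i2: "integrable lborel (dir_deriv (space_dir i) (?s i))" for i
    by (rule integrable_smooth_compact[OF smooth_on_dir_deriv[OF s2] K(2)])
       (rule dir_deriv_vanish[OF cl v2])
  have i3: "integrable lborel \<phi>" by (rule integrable_smooth_compact[OF K])
  have "t z * adj_heat \<phi> z = \<phi> z - dir_deriv time_dir (\<lambda>z. t z * \<phi> z) z - (\<Sum>i\<in>UNIV. dir_deriv (space_dir i) (?s i) z)" for z
    unfolding e1 e2 adj_heat_def laplacian_x_def by (simp add: algebra_simps sum_distrib_left)
  then have "(\<integral>z. t z * adj_heat \<phi> z \<partial>lborel) = integral\<^sup>L lborel \<phi> - 0 - (\<Sum>i\<in>(UNIV::'n set). 0)"
    by (simp only: Bochner_Integration.integral_diff Bochner_Integration.integral_sum Bochner_Integration.integrable_diff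
       Bochner_Integration.integrable_sum i1 i2 i3 z1 z2)
  then show ?thesis by (simp add: t_def)
qed

lemma parabolic_cylinder_open: "open (parabolic_cylinder r z0)"
  unfolding parabolic_cylinder_def by (intro open_Collect_conj open_Collect_less continuous_intros)

section \<open>Integral bound below a zero\<close>

lemma lborel_distr_uminus_euclidean: "distr lborel borel uminus = (lborel :: 'a::euclidean_space measure)"
proof -
  have "(\<lambda>x::'a. 0 + (-1) *\<^sub>R x) = uminus" by auto
  then show ?thesis using lborel_affine[of "-1" "0::'a"] by (simp add: density_1 one_ennreal_def[symmetric])
qed

section \<open>The convex truncation \<open>flat 1\<close>\<close>

lemma exp_mult_one_plus_le: "(1 + x) * exp (- x) \<le> (1::real)"
  using exp_ge_add_one_self[of x] by (simp add: exp_minus field_simps)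

lemma flat_1_le: "flat 1 w \<le> max w 0"
  by (auto simp: flat_def intro!: mult_right_le_one_le)

text \<open>With x = 1/(4w) the left side is (1 + x) exp(-x). Slope at most 1 means that truncating
  does not enlarge the approximate identity.\<close>

lemma flat_1_deriv_le: "flat 0 w + 1/4 * flat (-1) w \<le> 1"
proof (cases "w > 0")
  case True
  then show ?thesis using exp_mult_one_plus_le[of "1/(4*w)"]
    by (simp add: flat_def powr_minus field_simps)
qed (simp add: flat_def)

lemma flat_1_has_deriv: "(flat 1 has_real_derivative flat 0 w + 1/4 * flat (-1) w) (at w)"
  using DERIV_flat[of 1 w] by simp

text \<open>The two \<open>flat (-2)\<close> terms cancel; what remains is nonnegative, so
  \<open>flat 1\<close> is convex.\<close>

lemma flat_1_has_deriv2: "((\<lambda>w. flat 0 w + 1/4 * flat (-1) w) has_real_derivative 1/16 * flat (-3) w) (at w)"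
proof -
  have "((\<lambda>w. flat 0 w + 1/4 * flat (-1) w) has_real_derivative 
     (0 * flat (0-1) w + 1/4 * flat (0-2) w) + 1/4 * (-1 * flat (-1 - 1) w + 1/4 * flat (-1-2) w)) (at w)"
    by (intro DERIV_add DERIV_cmult DERIV_flat)
  then show ?thesis by (rule DERIV_cong) (simp add: field_simps)
qed

text \<open>A box in the past of the origin. Elapsed times between 2s and 3s lie well inside (0,
  4s), where kernel minus barrier can be positive, and keep a distance s from every point with |t| <
  s.\<close>

definition lower_set :: "real \<Rightarrow> 'n::finite spacetime set" where
  "lower_set s = cball 0 (1/8) \<times> {- (3 * s) .. - (2 * s)}"

lemma Q0_iff: "z \<in> Q0 r \<longleftrightarrow> norm (fst z) < r \<and> \<bar>snd z\<bar> < r\<^sup>2"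
  by (simp add: parabolic_cylinder_def)

text \<open>The subtracted barrier \<open>q\<close> grows so fast in the elapsed time that the positive part of
  kernel minus barrier is supported in \<open>|y| \<le> 3/4\<close>, \<open>0 \<le> \<tau> \<le> 4s\<close>, while it stays positive on the lower set.\<close>

definition barrier :: "'n::finite itself \<Rightarrow> real \<Rightarrow> real \<Rightarrow> real" where
  "barrier _ s \<tau> = (4 * s) powr (- real CARD('n) / 2) * exp (- ((4 * s - \<tau>) / (200 * s\<^sup>2)))"

lemma barrier_pos: "s > 0 \<Longrightarrow> barrier T s \<tau> > 0" by (simp add: barrier_def)

text \<open>After time 4s the barrier is at least its prefactor, which then exceeds the maximal
  height t^(-n/2) of the kernel. Outside radius 3/4 the comparison is made between the
  exponents.\<close>

lemma gam_barrier_support: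
  fixes z :: "'n::finite spacetime"
  assumes s: "s > 0" "s \<le> 1 / (40 * real CARD('n))" and e: "\<epsilon> \<ge> 0" and W: "gam \<epsilon> z > barrier TYPE('n) s (snd z)"
  shows "0 < snd z" "snd z \<le> 4 * s" "norm (fst z) \<le> 3/4"
proof -
  let ?n = "real CARD('n)"
  let ?t = "snd z"
  show t: "0 < ?t" using W barrier_pos[OF s(1), of "TYPE('n)" ?t] by (auto simp: gam_def split: if_splits)
  have n: "?n \<ge> 1" by (simp add: Suc_leI)
  have gp: "gam \<epsilon> z = ?t powr (- ?n / 2) * exp (- (sqn z + \<epsilon>) / (4 * ?t))" using t by (simp add: gam_def)
  show t4: "?t \<le> 4 * s"
  proof (rule ccontr)
    assume a: "\<not> ?t \<le> 4 * s"
    have "gam \<epsilon> z \<le> ?t powr (- ?n / 2) * 1"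
      unfolding gp using t order_trans[of "- sqn z" 0 \<epsilon>] e by (intro mult_left_mono) (auto intro!: divide_nonpos_pos)
    also have "\<dots> \<le> (4 * s) powr (- ?n / 2)"
      using a s t by (simp, intro powr_mono2') auto
    also have "\<dots> \<le> barrier TYPE('n) s ?t" 
      unfolding barrier_def using a s by (auto simp: divide_nonpos_pos)
    finally show False using W by simp
  qed
  show "norm (fst z) \<le> 3/4"
  proof (rule ccontr)
    assume a: "\<not> norm (fst z) \<le> 3/4"
    have "(3/4)\<^sup>2 \<le> (norm (fst z))\<^sup>2" using a by (intro power_mono) auto
    then have r: "9/16 \<le> sqn z" by (simp only: dot_square_norm) (simp add: power2_eq_square)
    have "gam \<epsilon> z \<le> exp (- ?n / 2 * ln ?t) * exp (- (9/16) / (4 * ?t))"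
    proof -
      have "- (sqn z + \<epsilon>) / (4 * ?t) \<le> - (9/16) / (4 * ?t)" using r e t by (intro divide_right_mono) auto
      moreover have "?t powr (- ?n / 2) = exp (- ?n / 2 * ln ?t)" using t by (simp add: powr_def)
      ultimately show ?thesis unfolding gp by simp
    qed
    also have "\<dots> = exp (- ?n / 2 * ln ?t - 9 / (64 * ?t))" by (simp flip: exp_add)
    also have "\<dots> \<le> exp (- ?n / 2 * ln (4 * s) - (4 * s - ?t) / (200 * s\<^sup>2))"
    proof -
      \<comment> \<open>Both losses are measured against 1/t: \<open>s \<le> 1 / (40 * n)\<close>
        limits the logarithm to 1/20, and t (4s - t) \<le> 4 s^2 limits the barrier exponent to
        1/50. Their sum stays below 9/64, a quarter of (3/4)^2.\<close>
      have "ln (4 * s / ?t) \<le> 4 * s / ?t" using ln_le_minus_one[of "4 * s / ?t"] s t by simp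
      then have "?n / 2 * ln (4 * s / ?t) \<le> ?n / 2 * (4 * s / ?t)" by (intro mult_left_mono) auto
      also have "\<dots> = (2 * ?n * s) / ?t" by simp
      also have "\<dots> \<le> (1/20) / ?t" using s n t by (intro divide_right_mono) (auto simp: field_simps)
      finally have 1: "?n / 2 * ln (4 * s / ?t) \<le> (1/20) / ?t" .
      have "?t * (4 * s - ?t) \<le> 4 * s\<^sup>2" using zero_le_power2[of "?t - 2 * s"] by (simp add: power2_eq_square algebra_simps)
      then have "(4 * s - ?t) / (200 * s\<^sup>2) \<le> (1/50) / ?t" using s t by (simp add: field_simps)
      with 1 have "?n / 2 * ln (4 * s / ?t) + (4 * s - ?t) / (200 * s\<^sup>2) \<le> (1/20 + 1/50) / ?t"
        by (simp add: add_divide_distrib)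
      also have "\<dots> \<le> (9/64) / ?t" using t by (intro divide_right_mono) auto
      finally have "?n / 2 * ln (4 * s / ?t) + (4 * s - ?t) / (200 * s\<^sup>2) \<le> 9 / (64 * ?t)" by simp
      then show ?thesis using s t by (simp add: ln_div algebra_simps)
    qed
    also have "\<dots> = barrier TYPE('n) s ?t"
      using s by (simp add: barrier_def powr_def flip: exp_add)
    finally show False using W by simp
  qed
qed

text \<open>Here |x|^2 + \<epsilon> \<le> 1/32 and t \<ge> 2s give the kernel the exponent -1/(256
  s), while 4s - t \<ge> s gives the barrier at most -1/(200 s). The constant 200 of the barrier is
  below 256 for the sake of this gap.\<close>

lemma gam_barrier_lower:
  fixes z :: "'n::finite spacetime"
  assumes s: "s > 0" and e: "0 \<le> \<epsilon>" "\<epsilon> \<le> 1/64" and z: "norm (fst z) \<le> 1/8" "2 * s \<le> snd z" "snd z \<le> 3 * s"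
  shows "gam \<epsilon> z - barrier TYPE('n) s (snd z) \<ge> (4 * s) powr (- real CARD('n) / 2) * (exp (- (1 / (256 * s))) - exp (- (1 / (200 * s))))"
proof -
  let ?n = "real CARD('n)"
  let ?t = "snd z"
  have t: "?t > 0" using s z by linarith
  have "(norm (fst z))\<^sup>2 \<le> (1/8)\<^sup>2" using z by (intro power_mono) auto
  then have r: "sqn z \<le> 1/64" by (simp only: dot_square_norm) (simp add: power2_eq_square)
  have "(sqn z + \<epsilon>) / (4 * ?t) \<le> (1/32) / (8 * s)"
    using r e s z t by (intro frac_le) auto
  then have "exp (- (1 / (256 * s))) \<le> exp (- (sqn z + \<epsilon>) / (4 * ?t))"
    using minus_divide_left[of "sqn z + \<epsilon>" "4 * ?t"] by simp
  moreover have "(4 * s) powr (- ?n / 2) \<le> ?t powr (- ?n / 2)"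
    using t z s by (intro powr_mono2') auto
  ultimately have 1: "(4 * s) powr (- ?n / 2) * exp (- (1 / (256 * s))) \<le> gam \<epsilon> z"
    using t by (auto simp: gam_def intro!: mult_mono)
  have "1 / (200 * s) = s / (200 * s\<^sup>2)" using s by (simp add: power2_eq_square)
  also have "\<dots> \<le> (4 * s - ?t) / (200 * s\<^sup>2)" using z s by (intro divide_right_mono) auto
  finally have "barrier TYPE('n) s ?t \<le> (4 * s) powr (- ?n / 2) * exp (- (1 / (200 * s)))"
    unfolding barrier_def by (intro mult_left_mono) auto
  with 1 show ?thesis by (simp add: algebra_simps)
qed

text \<open>A jump of the indicator is harmless at a zero. This is needed because the pole will lie
  on the top face of the set \<open>K\<close>, where time is 0.\<close>

lemma isCont_indicator_mult:
  fixes u :: "'a::euclidean_space \<Rightarrow> real"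
  assumes "isCont u z" "u z = 0"
  shows "isCont (\<lambda>w. indicator K w * u w) z"
proof -
  have "((\<lambda>w. indicator K w * u w) \<longlongrightarrow> 0) (at z)"
  proof (rule Lim_null_comparison)
    show "((\<lambda>w. \<bar>u w\<bar>) \<longlongrightarrow> 0) (at z)" using assms tendsto_rabs_zero by (force simp: isCont_def)
    show "\<forall>\<^sub>F w in at z. norm (indicator K w * u w) \<le> \<bar>u w\<bar>"
      by (intro always_eventually allI) (auto simp: indicator_def)
  qed
  then show ?thesis using assms by (simp add: isCont_def)
qed

lemma bounded_measurable_on_compact:
  fixes u :: "'a::euclidean_space \<Rightarrow> real"
  assumes "compact K" "continuous_on K u"
  shows "(\<lambda>w. indicator K w * u w) \<in> borel_measurable borel" "\<exists>M. \<forall>w. \<bar>indicator K w * u w\<bar> \<le> M"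
proof -
  show "(\<lambda>w. indicator K w * u w) \<in> borel_measurable borel"
    using borel_measurable_continuous_on_indicator[OF _ assms(2)] borel_closed[OF compact_imp_closed[OF assms(1)]] by simp
  have "compact (u ` K)" using assms compact_continuous_image by blast
  then obtain M where M: "\<And>w. w \<in> K \<Longrightarrow> \<bar>u w\<bar> \<le> M"
    using compact_imp_bounded[of "u ` K"] unfolding bounded_iff by auto
  have "\<bar>indicator K w * u w\<bar> \<le> max M 0" for w
    using M[of w] by (cases "w \<in> K") auto
  then show "\<exists>M. \<forall>w. \<bar>indicator K w * u w\<bar> \<le> M" by blast
qed

lemma smooth_barrier: "smooth_on UNIV (\<lambda>z::'n::finite spacetime. barrier T s (- snd z))"
proof -
  have "smooth_on UNIV (\<lambda>z::'n spacetime. (4 * s) powr (- real CARD('m::finite) / 2) * exp ((- 1 / (200 * s\<^sup>2)) * (4 * s + snd z)))"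
    by (intro smooth_on_mult smooth_on_const open_UNIV smooth_on_compose[OF open_UNIV open_UNIV _ _ smooth_on_exp] smooth_on_add smooth_snd) auto
  then show ?thesis unfolding barrier_def by simp
qed

lemma adj_heat_barrier:
  "adj_heat (\<lambda>z::'n::finite spacetime. barrier TYPE('n) s (- snd z)) z = barrier TYPE('n) s (- snd z) / (200 * s\<^sup>2)"
proof -
  have 1: "dir_deriv (space_dir i) (\<lambda>z::'n spacetime. barrier TYPE('n) s (- snd z)) = (\<lambda>z. 0)" for i
    by (rule ext, rule dir_deriv_line[OF smooth_diff[OF smooth_barrier]]) (simp add: space_dir_def)
  have 2: "dir_deriv time_dir (\<lambda>z::'n spacetime. barrier TYPE('n) s (- snd z)) z = - (barrier TYPE('n) s (- snd z) / (200 * s\<^sup>2))"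
  proof (rule dir_deriv_line[OF smooth_diff[OF smooth_barrier]])
    have sh: "4 * s - (- snd z - h) = 4 * s + (snd z + h)" for h by simp
    have "((\<lambda>h. (4 * s) powr (- real CARD('n) / 2) * exp ((- 1 / (200 * s\<^sup>2)) * (4 * s + snd z + h))) has_real_derivative
      (4 * s) powr (- real CARD('n) / 2) * (exp ((- 1 / (200 * s\<^sup>2)) * (4 * s + snd z + 0)) * ((- 1 / (200 * s\<^sup>2)) * (0 + 1)))) (at 0)"
      by (intro DERIV_cmult DERIV_fun_exp DERIV_add DERIV_const DERIV_ident)
    then show "((\<lambda>h. barrier TYPE('n) s (- snd (z + h *\<^sub>R time_dir))) has_real_derivative - (barrier TYPE('n) s (- snd z) / (200 * s\<^sup>2))) (at 0)"
      by (simp add: time_dir_def barrier_def add.assoc sh)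
  qed
  show ?thesis unfolding adj_heat_def laplacian_x_def 1 2 by (simp add: dir_deriv_const)
qed

text \<open>Convexity discards the squared gradient. The barrier makes the truncated kernel a strict
  subsolution away from the pole, and the strictness supplies the weight against which
  \<open>u\<close> will be integrated.\<close>

lemma adj_heat_lower_test:
  fixes z :: "'n::finite spacetime" and s :: real
  assumes "\<epsilon> > 0"
  defines "W \<equiv> \<lambda>z::'n spacetime. gam \<epsilon> (- z) - barrier TYPE('n) s (- snd z)"
  shows "smooth_on UNIV W"
    and "adj_heat (\<lambda>z. flat 1 (W z)) z \<le> (flat 0 (W z) + 1/4 * flat (-1) (W z)) * (conc \<epsilon> (- z) - barrier TYPE('n) s (- snd z) / (200 * s\<^sup>2))"
proof -
  have g: "smooth_on UNIV (\<lambda>z::'n spacetime. gam \<epsilon> (- z))"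
    using smooth_gam_reflect[OF assms(1), of 0] by simp
  show W: "smooth_on UNIV W" unfolding W_def by (intro smooth_on_diff open_UNIV g smooth_barrier)
  have "adj_heat W z = conc \<epsilon> (- z) - barrier TYPE('n) s (- snd z) / (200 * s\<^sup>2)"
    unfolding W_def adj_heat_diff[OF g smooth_barrier] adj_heat_barrier
    using adj_heat_gam[OF assms(1), of 0 z] by simp
  moreover have "1/16 * flat (-3) (W z) * (\<Sum>i\<in>UNIV. (dir_deriv (space_dir i) W z)\<^sup>2) \<ge> 0"
    by (intro mult_nonneg_nonneg sum_nonneg) (auto simp: flat_nonneg)
  ultimately show "adj_heat (\<lambda>z. flat 1 (W z)) z \<le> (flat 0 (W z) + 1/4 * flat (-1) (W z)) * (conc \<epsilon> (- z) - barrier TYPE('n) s (- snd z) / (200 * s\<^sup>2))"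
    unfolding adj_heat_compose[OF W flat_1_has_deriv flat_1_has_deriv2] by simp
qed

text \<open>Testing with \<phi> = \<open>flat 1 (W z)\<close> yields an upper bound for the weighted
  integral of \<open>u\<close> by the concentration term plus \<open>k\<close> times the integral of
  \<phi>. As \<epsilon> tends to 0 the concentration term tends to a multiple of
  \<open>u 0 = 0\<close>, and on the lower set the weight is at least \<open>c\<close>.\<close>

lemma integral_bound_below_zero:
  fixes u :: "'n::finite spacetime \<Rightarrow> real"
  assumes s: "s > 0" "s \<le> 1 / (40 * real CARD('n))"
  defines "c \<equiv> exp (- (1 / (4 * ((4 * s) powr (- real CARD('n) / 2) * (exp (- (1 / (256 * s))) - exp (- (1 / (200 * s))))))))
      * ((4 * s) powr (- real CARD('n) / 2) * exp (- (1 / (100 * s))) / (200 * s\<^sup>2))"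
  assumes u: "continuous_on (Q0 1) u" "\<And>z. z \<in> Q0 1 \<Longrightarrow> u z \<ge> 0" "u 0 = 0" and H: "heat_ineq (Q0 1) u k" and k: "k \<ge> 0"
  shows "c * (\<integral>z. indicator (lower_set s) z * u z \<partial>lborel) \<le> k * (4 * s * enn2real (gauss_mass TYPE('n)))"
proof -
  let ?n = "real CARD('n)"
  have "?n \<ge> 1" by (simp add: Suc_leI)
  then have "1 / (40 * ?n) \<le> 1 / (40 * 1)" by (intro divide_left_mono) auto
  then have s1: "s \<le> 1/40" using s by linarith
  define K :: "'n spacetime set" where "K = cball 0 (3/4) \<times> {- (4 * s) .. 0}"
  have K: "compact K" unfolding K_def by (intro compact_Times compact_cball compact_Icc)
  have KQ: "K \<subseteq> Q0 1" using s1 by (auto simp: K_def Q0_iff)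
  have EK: "lower_set s \<subseteq> K" using s by (auto simp: K_def lower_set_def)
  have uK: "continuous_on K u" using u(1) KQ continuous_on_subset by blast
  define g where "g = (\<lambda>w. indicator K w * u w)"
  obtain M where g: "g \<in> borel_measurable borel" and M: "\<And>w. \<bar>g w\<bar> \<le> M"
    using bounded_measurable_on_compact[OF K uK] unfolding g_def by blast
  have g0: "g w \<ge> 0" for w using u(2)[of w] KQ by (cases "w \<in> K") (auto simp: g_def)
  have "0 \<in> Q0 1" by (simp add: Q0_iff)
  then have "isCont u 0" using u(1) continuous_on_eq_continuous_at[OF parabolic_cylinder_open] by blast
  then have gc: "isCont g 0" unfolding g_def by (rule isCont_indicator_mult) (rule u(3))
  \<comment> \<open>Division by 64 keeps \<epsilon> \<le> 1/64, as the lower bound for kernel minus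
    barrier requires.\<close>
  define X where "X = (\<lambda>j. inverse (real (Suc j)) / 64)"
  have X: "X j > 0" "X j \<le> 1/64" for j by (auto simp: X_def inverse_le_1_iff)
  have Xl: "X \<longlonglongrightarrow> 0" using tendsto_divide[OF LIMSEQ_inverse_real_of_nat tendsto_const[of 64]] by (simp add: X_def[abs_def])
  have lim: "(\<lambda>j. \<integral>z. g z * conc (X j) (- z) \<partial>lborel) \<longlonglongrightarrow> 0"
    using concentration(1)[OF g M gc X(1) Xl] u(3) by (simp add: g_def)
  have gi: "integrable lborel (\<lambda>z. g z * conc (X j) (- z))" for j
    using concentration(2)[OF g M gc X(1) Xl] by simp
  \<comment> \<open>The height of kernel minus barrier guaranteed on the lower set;
    \<open>flat 0\<close> of it is the first factor of \<open>c\<close>, the second being the least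
    value of \<kappa> there.\<close>
  define w0 where "w0 = (4 * s) powr (- ?n / 2) * (exp (- (1 / (256 * s))) - exp (- (1 / (200 * s))))"
  have w0: "w0 > 0" using s by (auto simp: w0_def field_simps)
  have step: "c * (\<integral>z. indicator (lower_set s) z * u z \<partial>lborel) \<le> (\<integral>z. g z * conc (X j) (- z) \<partial>lborel) + k * (4 * s * enn2real (gauss_mass TYPE('n)))" for j
  proof -
    define W where "W = (\<lambda>z::'n spacetime. gam (X j) (- z) - barrier TYPE('n) s (- snd z))"
    define \<phi> where "\<phi> = (\<lambda>z. flat 1 (W z))"
    define p where "p = (\<lambda>z. flat 0 (W z) + 1/4 * flat (-1) (W z))"
    define \<kappa> where "\<kappa> = (\<lambda>z::'n spacetime. barrier TYPE('n) s (- snd z) / (200 * s\<^sup>2))"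
    have W: "smooth_on UNIV W" unfolding W_def by (rule adj_heat_lower_test[OF X(1)])
    have ad: "adj_heat \<phi> z \<le> p z * (conc (X j) (- z) - \<kappa> z)" for z
      using adj_heat_lower_test(2)[OF X(1), of j s z] unfolding \<phi>_def p_def \<kappa>_def W_def .
    have smf: "smooth_on UNIV (\<lambda>z. flat m (W z))" for m
      by (rule smooth_on_compose[OF open_UNIV open_UNIV _ W smooth_on_flat]) simp
    have \<phi>s: "smooth_on UNIV \<phi>" unfolding \<phi>_def by (rule smf)
    have ps: "smooth_on UNIV p" unfolding p_def by (intro smooth_on_add smooth_on_mult smooth_on_const open_UNIV smf)
    have \<kappa>s: "smooth_on UNIV \<kappa>" unfolding \<kappa>_def divide_inverse by (intro smooth_on_mult smooth_on_const open_UNIV smooth_barrier)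
    have WK: "W z \<le> 0" if "z \<notin> K" for z
    proof (rule ccontr)
      assume "\<not> W z \<le> 0"
      then have "gam (X j) (- z) > barrier TYPE('n) s (snd (- z))" by (simp add: W_def)
      from gam_barrier_support[OF s less_imp_le[OF X(1)] this] have "z \<in> K"
        by (cases z) (auto simp: K_def)
      then show False using that by simp
    qed
    have \<phi>K: "z \<notin> K \<Longrightarrow> \<phi> z = 0" and pK: "z \<notin> K \<Longrightarrow> p z = 0" for z
      using WK by (auto simp: \<phi>_def p_def flat_0)
    have p01: "0 \<le> p z" "p z \<le> 1" for z
      using flat_1_deriv_le by (auto simp: p_def flat_nonneg)
    have \<kappa>0: "\<kappa> z > 0" for z using barrier_pos[OF s(1), of "TYPE('n)" "- snd z"] s(1) by (simp add: \<kappa>_def)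
    have test: "test_function (Q0 1) \<phi>" by (rule test_functionI[OF \<phi>s K KQ \<phi>K])
    have i1: "integrable lborel (\<lambda>z. u z * adj_heat \<phi> z)" by (rule integrable_adj_heat[OF \<phi>s K \<phi>K uK])
    have cp: "continuous_on K p" and ck: "continuous_on K \<kappa>"
      using smooth_cont[OF ps] smooth_cont[OF \<kappa>s] continuous_on_subset by blast+
    have i2: "integrable lborel (\<lambda>z. u z * (p z * \<kappa> z))"
      by (rule integrable_times_compact[OF K uK]) (auto intro!: continuous_intros cp ck simp: pK)
    have iE: "integrable lborel (\<lambda>z. indicator (lower_set s) z * u z)"
    proof -
      have "compact (lower_set s :: 'n spacetime set)" unfolding lower_set_def by (intro compact_Times compact_cball compact_Icc)
      then show ?thesis using borel_integrable_compact[of "lower_set s" u] uK EK continuous_on_subset by fastforce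
    qed
    have i3: "integrable lborel \<phi>" by (rule integrable_smooth_compact[OF \<phi>s K \<phi>K])
    have "- k * integral\<^sup>L lborel \<phi> \<le> (\<integral>z. u z * adj_heat \<phi> z \<partial>lborel)"
      using H test unfolding heat_ineq_def by (simp add: \<phi>_def flat_nonneg)
    also have "\<dots> \<le> (\<integral>z. g z * conc (X j) (- z) - u z * (p z * \<kappa> z) \<partial>lborel)"
    proof (rule integral_mono[OF i1 Bochner_Integration.integrable_diff[OF gi i2]])
      fix z :: "'n spacetime"
      show "u z * adj_heat \<phi> z \<le> g z * conc (X j) (- z) - u z * (p z * \<kappa> z)"
      proof (cases "z \<in> K")
        case True
        then have uz: "u z \<ge> 0" using u(2)[of z] KQ by auto
        have "adj_heat \<phi> z \<le> 1 * conc (X j) (- z) - p z * \<kappa> z"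
          using ad[of z] mult_right_mono[OF p01(2)[of z] conc_nonneg[OF less_imp_le[OF X(1)[of j]], of "- z"]]
          by (simp add: algebra_simps)
        then have "u z * adj_heat \<phi> z \<le> u z * (conc (X j) (- z) - p z * \<kappa> z)"
          using uz by (intro mult_left_mono) auto
        then show ?thesis using True by (simp add: g_def algebra_simps)
      next
        case False
        then show ?thesis using pK adj_heat_vanish[OF compact_imp_closed[OF K] \<phi>K] by (simp add: g_def)
      qed
    qed
    also have "\<dots> = (\<integral>z. g z * conc (X j) (- z) \<partial>lborel) - (\<integral>z. u z * (p z * \<kappa> z) \<partial>lborel)"
      by (rule Bochner_Integration.integral_diff[OF gi i2])
    finally have 1: "(\<integral>z. u z * (p z * \<kappa> z) \<partial>lborel) \<le> (\<integral>z. g z * conc (X j) (- z) \<partial>lborel) + k * integral\<^sup>L lborel \<phi>" by simp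
    \<comment> \<open>Uniformly in \<epsilon>: truncation and barrier only lower the kernel, and
      \<open>gam 0\<close> dominates all \<open>gam \<epsilon>\<close>.\<close>
    have "integral\<^sup>L lborel \<phi> \<le> (\<integral>z. gam 0 (- z) * indicator {0..4 * s} (snd (- z)) \<partial>(lborel :: 'n spacetime measure))"
    proof (rule integral_mono[OF i3])
      show "integrable lborel (\<lambda>z::'n spacetime. gam 0 (- z) * indicator {0..4 * s} (snd (- z)))"
        using integrable_distr_eq[of uminus lborel borel "\<lambda>z::'n spacetime. gam 0 z * indicator {0..4 * s} (snd z)"]
          integral_gam_strip(1)[of "4 * s", where 'n='n] s lborel_distr_uminus_euclidean[where 'a="'n spacetime"]
          borel_measurable_integrable[OF integral_gam_strip(1)[of "4 * s", where 'n='n]] by simp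
      fix z :: "'n spacetime"
      show "\<phi> z \<le> gam 0 (- z) * indicator {0..4 * s} (snd (- z))"
      proof (cases "z \<in> K")
        case True
        have "\<phi> z \<le> max (W z) 0" unfolding \<phi>_def by (rule flat_1_le)
        also have "\<dots> \<le> gam (X j) (- z)" using barrier_pos[OF s(1), of "TYPE('n)" "- snd z"] gam_nonneg[of "X j" "- z"] by (simp add: W_def)
        also have "\<dots> \<le> gam 0 (- z)" using X(1)[of j] by (intro gam_le) simp
        finally show ?thesis using True by (auto simp: K_def)
      qed (simp add: \<phi>K gam_nonneg)
    qed
    also have "\<dots> = (\<integral>z. gam 0 z * indicator {0..4 * s} (snd z) \<partial>(lborel :: 'n spacetime measure))"
      using integral_distr[of uminus lborel borel "\<lambda>z::'n spacetime. gam 0 z * indicator {0..4 * s} (snd z)"]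
        s lborel_distr_uminus_euclidean[where 'a="'n spacetime"]
        borel_measurable_integrable[OF integral_gam_strip(1)[of "4 * s", where 'n='n]] by simp
    also have "\<dots> = 4 * s * enn2real (gauss_mass TYPE('n))" using integral_gam_strip(2)[of "4 * s"] s by simp
    finally have 2: "k * integral\<^sup>L lborel \<phi> \<le> k * (4 * s * enn2real (gauss_mass TYPE('n)))"
      using k by (intro mult_left_mono)
    have "c * (\<integral>z. indicator (lower_set s) z * u z \<partial>lborel) = (\<integral>z. c * (indicator (lower_set s) z * u z) \<partial>lborel)" by simp
    also have "\<dots> \<le> (\<integral>z. u z * (p z * \<kappa> z) \<partial>lborel)"
    proof (rule integral_mono[OF _ i2])
      show "integrable lborel (\<lambda>z. c * (indicator (lower_set s) z * u z))" using iE by simp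
      fix z :: "'n spacetime"
      show "c * (indicator (lower_set s) z * u z) \<le> u z * (p z * \<kappa> z)"
      proof (cases "z \<in> lower_set s")
        case True
        then have uz: "u z \<ge> 0" using u(2)[of z] KQ EK by auto
        have zz: "norm (fst (- z)) \<le> 1/8" "2 * s \<le> snd (- z)" "snd (- z) \<le> 3 * s"
          using True by (auto simp: lower_set_def)
        have Wz: "W z \<ge> w0" using gam_barrier_lower[OF s(1) less_imp_le[OF X(1)[of j]] X(2) zz] by (simp add: W_def w0_def)
        have "exp (- (1 / (4 * w0))) \<le> flat 0 (W z)"
          using Wz w0 by (auto simp: flat_def intro!: divide_left_mono)
        also have "\<dots> \<le> p z" by (simp add: p_def flat_nonneg)
        finally have pz: "exp (- (1 / (4 * w0))) \<le> p z" .
        have "(4 * s - (- snd z)) / (200 * s\<^sup>2) \<le> (2 * s) / (200 * s\<^sup>2)"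
          using zz by (intro divide_right_mono) auto
        also have "\<dots> = 1 / (100 * s)" using s by (simp add: power2_eq_square)
        finally have kz: "(4 * s) powr (- ?n / 2) * exp (- (1 / (100 * s))) / (200 * s\<^sup>2) \<le> \<kappa> z"
          unfolding \<kappa>_def barrier_def by (intro divide_right_mono mult_left_mono) auto
        have "c \<le> p z * \<kappa> z" unfolding c_def w0_def[symmetric]
          using pz kz p01(1) by (intro mult_mono) auto
        then have "u z * c \<le> u z * (p z * \<kappa> z)" using uz by (rule mult_left_mono)
        then show ?thesis using True by (simp add: mult.commute)
      next
        case False
        have "z \<in> K \<Longrightarrow> u z \<ge> 0" using u(2)[of z] KQ by auto
        then have "u z * (p z * \<kappa> z) \<ge> 0"
          using p01(1)[of z] \<kappa>0[of z] pK[of z] by (cases "z \<in> K") auto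
        then show ?thesis using False by simp
      qed
    qed
    finally show ?thesis using 1 2 by linarith
  qed
  have "(\<lambda>j. (\<integral>z. g z * conc (X j) (- z) \<partial>lborel) + k * (4 * s * enn2real (gauss_mass TYPE('n)))) \<longlonglongrightarrow> 0 + k * (4 * s * enn2real (gauss_mass TYPE('n)))"
    by (intro tendsto_intros lim)
  from LIMSEQ_le_const[OF this, of "c * (\<integral>z. indicator (lower_set s) z * u z \<partial>lborel)"] step
  show ?thesis by auto
qed

section \<open>Quadratic growth at zeros\<close>

text \<open>From exp(x) \<ge> (x/m)^m with x = 1/(4096 t) and m = n + 3: of the m powers of t
  gained, n absorb the height t^(-n/2) \<le> t^(-n), one absorbs the factor 1/t of the gradient, and
  two remain.\<close>

lemma gam_small:
  fixes z :: "'n::finite spacetime"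
  assumes e: "\<epsilon> \<ge> 0" and z: "sqn z \<ge> 1/1024" "norm (fst z) \<le> 1" "0 < snd z" "snd z \<le> 1"
  defines "C \<equiv> (4096 * real (CARD('n) + 3)) ^ (CARD('n) + 3)"
  shows "gam \<epsilon> z \<le> C * (snd z)\<^sup>2" "\<bar>dir_deriv (space_dir i) (gam \<epsilon>) z\<bar> \<le> C * (snd z)\<^sup>2"
proof -
  let ?t = "snd z" and ?n = "CARD('n)"
  define m where "m = ?n + 3"
  define x where "x = 1 / (4096 * ?t)"
  have x: "x > 0" using z by (simp add: x_def)
  have "(x / real m) ^ m \<le> (1 + x / real m) ^ m" using x by (intro power_mono) auto
  also have "\<dots> \<le> exp x" using exp_ge_one_plus_x_over_n_power_n[where x=x and n=m] x by (simp add: m_def)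
  finally have "inverse (exp x) \<le> inverse ((x / real m) ^ m)"
    using x by (intro le_imp_inverse_le) (auto simp: m_def)
  then have 1: "exp (- x) \<le> (real m / x) ^ m"
    by (simp add: exp_minus power_divide)
  have "(1/1024) / (4 * ?t) \<le> (sqn z + \<epsilon>) / (4 * ?t)" using z e by (intro divide_right_mono) auto
  then have "exp (- (sqn z + \<epsilon>) / (4 * ?t)) \<le> exp (- x)"
    using minus_divide_left[of "sqn z + \<epsilon>" "4 * ?t"] by (simp add: x_def)
  with 1 have 2: "exp (- (sqn z + \<epsilon>) / (4 * ?t)) \<le> (real m / x) ^ m" by linarith
  have "?t powr (- real ?n / 2) \<le> ?t powr (- real ?n)"
    using z by (intro powr_mono') auto
  also have "\<dots> = 1 / ?t ^ ?n" using z by (simp add: powr_minus_divide powr_realpow)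
  finally have 3: "?t powr (- real ?n / 2) \<le> 1 / ?t ^ ?n" .
  have "gam \<epsilon> z = ?t powr (- real ?n / 2) * exp (- (sqn z + \<epsilon>) / (4 * ?t))" using z by (simp add: gam_def)
  also have "\<dots> \<le> 1 / ?t ^ ?n * (real m / x) ^ m"
    using z by (intro mult_mono 2 3) auto
  finally have "gam \<epsilon> z \<le> 1 / ?t ^ ?n * (real m / x) ^ m" .
  moreover have "(real m / x) ^ m = C * ?t ^ m"
    using z by (simp add: x_def C_def m_def power_mult_distrib mult_ac)
  moreover have "1 / ?t ^ ?n * (C * ?t ^ m) = C * ?t ^ 3"
    using z by (simp add: m_def power_add)
  ultimately have g3: "gam \<epsilon> z \<le> C * ?t ^ 3" by simp
  have C: "C \<ge> 0" by (simp add: C_def)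
  have t32: "?t ^ 3 \<le> ?t\<^sup>2" using z by (intro power_decreasing) auto
  show "gam \<epsilon> z \<le> C * ?t\<^sup>2" using g3 mult_left_mono[OF t32 C] by linarith
  have xi: "\<bar>fst z $ i\<bar> \<le> 1" using component_le_norm_cart[of "fst z" i] z by linarith
  have "\<bar>dir_deriv (space_dir i) (gam \<epsilon>) z\<bar> = \<bar>fst z $ i\<bar> / (2 * ?t) * gam \<epsilon> z"
    using z gam_nonneg[of \<epsilon> z] by (simp add: gam_space abs_mult)
  also have "\<dots> \<le> 1 / (2 * ?t) * (C * ?t ^ 3)"
    using xi z g3 gam_nonneg[of \<epsilon> z] by (intro mult_mono divide_right_mono) auto
  also have "\<dots> = (C * ?t\<^sup>2) / 2" using z by (simp add: power2_eq_square power3_eq_cube)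
  also have "\<dots> \<le> C * ?t\<^sup>2" using C by simp
  finally show "\<bar>dir_deriv (space_dir i) (gam \<epsilon>) z\<bar> \<le> C * ?t\<^sup>2" .
qed

section \<open>Cutoffs and remainder terms for the growth estimate\<close>

lemma adj_heat_cong_open:
  assumes "open S" "smooth_on S f" "\<And>w. w \<in> S \<Longrightarrow> f w = g w" "z \<in> S"
  shows "adj_heat f z = adj_heat g z" "dir_deriv v f z = dir_deriv v g z"
proof -
  have 1: "dir_deriv v f w = dir_deriv v g w" if "w \<in> S" for v w
    by (rule dir_deriv_cong_open(2)[OF assms(1) that assms(3) smooth_on_differentiable[OF assms(2) that]])
  have 2: "dir_deriv v (dir_deriv v f) z = dir_deriv v (dir_deriv v g) z" for v
    by (rule dir_deriv_cong_open(2)[OF assms(1,4) 1 smooth_on_differentiable[OF smooth_on_dir_deriv[OF assms(2)] assms(4)]])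
  show "dir_deriv v f z = dir_deriv v g z" using 1 assms(4) by simp
  show "adj_heat f z = adj_heat g z" unfolding adj_heat_def laplacian_x_def using 1 2 assms(4) by simp
qed

lemma adj_heat_const: "adj_heat (\<lambda>z. c) z = 0"
proof -
  have "dir_deriv v (\<lambda>z::'a spacetime. c) = (\<lambda>z. 0)" for v using dir_deriv_const by blast
  then show ?thesis by (simp add: adj_heat_def laplacian_x_def dir_deriv_const)
qed

text \<open>Equal to 1 for |x| \<le> 1/16 and to 0 for |x| \<ge> 1/8.\<close>

definition space_cut :: "'n::finite spacetime \<Rightarrow> real" where
  "space_cut z = step ((1/64 - sqn z) * (256/3))"
text \<open>Rises from 0 at time -3s to 1 at time -2s, exactly the times of the lower set. No cutoff
  is made towards the future, where the reflected kernel vanishes by itself.\<close>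

definition time_cut :: "real \<Rightarrow> 'n::finite spacetime \<Rightarrow> real" where
  "time_cut s z = step (snd z * (1/s) + 3)"

lemma smooth_space_cut: "smooth_on UNIV space_cut"
  unfolding space_cut_def[abs_def]
  by (intro smooth_step_compose smooth_on_mult smooth_on_diff smooth_sqn smooth_on_const open_UNIV)
lemma smooth_time_cut: "smooth_on UNIV (time_cut s)"
  unfolding time_cut_def[abs_def]
  by (intro smooth_step_compose smooth_on_add smooth_on_mult smooth_snd smooth_on_const open_UNIV)

definition cut :: "real \<Rightarrow> 'n::finite spacetime \<Rightarrow> real" where
  "cut s z = space_cut z * time_cut s z"

lemma smooth_cut: "smooth_on UNIV (cut s)"
  unfolding cut_def[abs_def] by (intro smooth_on_mult smooth_space_cut smooth_time_cut open_UNIV)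

lemma cut_range: "0 \<le> cut s z" "cut s z \<le> 1"
  unfolding cut_def space_cut_def time_cut_def by (auto simp: step_nonneg step_le_1 intro!: mult_le_one)

text \<open>Everything in \<open>adj_heat\<close> of the cut-off kernel except the approximate
  identity; nonzero only where the cutoff varies.\<close>

definition remainder :: "('n::finite spacetime \<Rightarrow> real) \<Rightarrow> real \<Rightarrow> 'n spacetime \<Rightarrow> 'n spacetime \<Rightarrow> real" where
  "remainder \<eta> \<epsilon> a z = gam \<epsilon> (a - z) * adj_heat \<eta> z
    + 2 * (\<Sum>i\<in>UNIV. dir_deriv (space_dir i) \<eta> z * dir_deriv (space_dir i) (gam \<epsilon>) (a - z))"

lemma adj_heat_cutoff:
  "\<epsilon> > 0 \<Longrightarrow> smooth_on UNIV \<eta> \<Longrightarrow> adj_heat (\<lambda>w. \<eta> w * gam \<epsilon> (a - w)) z = \<eta> z * conc \<epsilon> (a - z) + remainder \<eta> \<epsilon> a z"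
  by (simp add: adj_heat_cutoff_gam remainder_def)

lemma remainder_le:
  fixes z :: "'n::finite spacetime"
  assumes "\<bar>adj_heat \<eta> z\<bar> \<le> B" "\<And>i. \<bar>dir_deriv (space_dir i) \<eta> z\<bar> \<le> B" "gam \<epsilon> (a - z) \<le> D"
    "\<And>i. \<bar>dir_deriv (space_dir i) (gam \<epsilon>) (a - z)\<bar> \<le> D"
  shows "\<bar>remainder \<eta> \<epsilon> a z\<bar> \<le> (1 + 2 * real CARD('n)) * B * D"
proof -
  have B: "B \<ge> 0" and D: "D \<ge> 0" using assms(1,3) gam_nonneg[of \<epsilon> "a - z"] by linarith+
  have "\<bar>remainder \<eta> \<epsilon> a z\<bar> \<le> \<bar>gam \<epsilon> (a - z) * adj_heat \<eta> z\<bar> 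
     + 2 * \<bar>\<Sum>i\<in>UNIV. dir_deriv (space_dir i) \<eta> z * dir_deriv (space_dir i) (gam \<epsilon>) (a - z)\<bar>"
    unfolding remainder_def by (rule order_trans[OF abs_triangle_ineq]) (simp add: abs_mult)
  also have "\<bar>gam \<epsilon> (a - z) * adj_heat \<eta> z\<bar> \<le> D * B"
    unfolding abs_mult using assms gam_nonneg[of \<epsilon> "a - z"] D by (intro mult_mono) auto
  also have "\<bar>\<Sum>i\<in>UNIV. dir_deriv (space_dir i) \<eta> z * dir_deriv (space_dir i) (gam \<epsilon>) (a - z)\<bar> \<le> (\<Sum>i\<in>(UNIV::'n set). B * D)"
    by (rule order_trans[OF sum_abs]) (unfold abs_mult, intro sum_mono mult_mono assms B D abs_ge_zero)
  finally show ?thesis by (simp add: algebra_simps)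
qed

lemma bounded_on_compact:
  fixes f :: "'a::euclidean_space \<Rightarrow> real"
  assumes "compact K" "continuous_on K f"
  shows "\<exists>B. \<forall>z\<in>K. \<bar>f z\<bar> \<le> B"
  using compact_imp_bounded[OF compact_continuous_image[OF assms(2,1)]] unfolding bounded_iff by auto

lemma cutoff_derivs_bounded:
  fixes \<eta> :: "'n::finite spacetime \<Rightarrow> real"
  assumes "smooth_on UNIV \<eta>" "compact K"
  shows "\<exists>B. \<forall>z\<in>K. \<bar>adj_heat \<eta> z\<bar> \<le> B \<and> (\<forall>i. \<bar>dir_deriv (space_dir i) \<eta> z\<bar> \<le> B)"
proof -
  have c: "continuous_on K (\<lambda>z. \<bar>adj_heat \<eta> z\<bar> + (\<Sum>i\<in>UNIV. \<bar>dir_deriv (space_dir i) \<eta> z\<bar>))"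
    using smooth_on_continuous[OF smooth_on_subset[OF smooth_on_adj_heat[OF open_UNIV assms(1)] subset_UNIV]]
      smooth_on_continuous[OF smooth_on_subset[OF smooth_on_dir_deriv[OF assms(1)] subset_UNIV]]
    by (intro continuous_on_add continuous_on_rabs continuous_on_sum)
  obtain B where B: "\<And>z. z \<in> K \<Longrightarrow> \<bar>\<bar>adj_heat \<eta> z\<bar> + (\<Sum>i\<in>UNIV. \<bar>dir_deriv (space_dir i) \<eta> z\<bar>)\<bar> \<le> B"
    using bounded_on_compact[OF assms(2) c] by auto
  have "\<bar>adj_heat \<eta> z\<bar> \<le> B \<and> (\<forall>i. \<bar>dir_deriv (space_dir i) \<eta> z\<bar> \<le> B)" if "z \<in> K" for z
  proof -
    have s: "\<bar>dir_deriv (space_dir i) \<eta> z\<bar> \<le> (\<Sum>i\<in>UNIV. \<bar>dir_deriv (space_dir i) \<eta> z\<bar>)" for i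
      by (rule member_le_sum) auto
    have s0: "0 \<le> (\<Sum>i\<in>UNIV. \<bar>dir_deriv (space_dir i) \<eta> z\<bar>)" by (intro sum_nonneg) auto
    show ?thesis using B[OF that] s s0 by (smt (verit))
  qed
  then show ?thesis by blast
qed

lemma dir_deriv_gam_nonpos: "\<epsilon> > 0 \<Longrightarrow> snd z \<le> 0 \<Longrightarrow> dir_deriv v (gam \<epsilon>) z = 0"
  using dir_deriv_gam_past(1)[OF open_UNIV smooth_gam] by blast

lemma gam_snd_nonpos: "snd z \<le> 0 \<Longrightarrow> gam \<epsilon> z = 0" by (simp add: gam_def)

definition upper_set :: "real \<Rightarrow> 'n::finite spacetime set" where
  "upper_set s = cball 0 (1/8) \<times> {- (3 * s) .. s}"

text \<open>Away from the lower set only the spatial cutoff is active. Its derivatives live at a fixed distance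
  from the pole, where the kernel is \<open>O(s\<^sup>2)\<close> after elapsed time \<open>O(s)\<close>; this beats the factor \<open>s\<close> needed for quadratic growth.\<close>

lemma remainder_upper:
  "\<exists>C\<ge>0. \<forall>s. 0 < s \<and> s \<le> 1/1024 \<longrightarrow> (\<forall>\<epsilon> a z. \<epsilon> > 0 \<and> norm (fst a) < 1/32 \<and> \<bar>snd a\<bar> < s \<and> z \<in> upper_set s \<and> z \<notin> lower_set s
     \<longrightarrow> \<bar>remainder (cut s :: 'n::finite spacetime \<Rightarrow> real) \<epsilon> a z\<bar> \<le> C * s\<^sup>2)"
proof -
  have cK: "compact (cball 0 1 \<times> {-1..1} :: 'n spacetime set)" by (intro compact_Times compact_cball compact_Icc)
  obtain B0 where B0: "\<forall>z\<in>cball 0 1 \<times> {-1..1}. \<bar>adj_heat space_cut z\<bar> \<le> B0 \<and> (\<forall>i. \<bar>dir_deriv (space_dir i) (space_cut :: 'n spacetime \<Rightarrow> real) z\<bar> \<le> B0)"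
    using cutoff_derivs_bounded[OF smooth_space_cut cK] by blast
  define B where "B = max B0 0"
  define D where "D = (4096 * real (CARD('n) + 3)) ^ (CARD('n) + 3)"
  have D: "D \<ge> 0" by (simp add: D_def)
  have "\<bar>remainder (cut s) \<epsilon> a z\<bar> \<le> (1 + 2 * real CARD('n)) * B * (D * 9) * s\<^sup>2"
    if s: "0 < s" "s \<le> 1/1024" and e: "\<epsilon> > 0" and a: "norm (fst a) < 1/32" "\<bar>snd a\<bar> < s" 
      and z: "z \<in> upper_set s" "z \<notin> lower_set s" for s \<epsilon> and a z :: "'n spacetime"
  proof -
    let ?S = "{z::'n spacetime. snd z > - (2 * s)}"
    have S: "open ?S" by (intro open_Collect_less continuous_intros)
    have zS: "z \<in> ?S" using z by (cases z) (auto simp: upper_set_def lower_set_def)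
    have nz: "norm (fst z) \<le> 1/8" "snd z \<le> s" "-(3 * s) \<le> snd z" using z by (auto simp: upper_set_def)
    have cc: "cut s w = space_cut w" if "w \<in> ?S" for w
    proof -
      have "snd w * (1/s) + 3 \<ge> 1" using that s by (simp add: field_simps)
      then show ?thesis by (simp add: cut_def time_cut_def step_1)
    qed
    have ce: "adj_heat (cut s) z = adj_heat space_cut z" "dir_deriv v (cut s) z = dir_deriv v space_cut z" for v
      using adj_heat_cong_open[OF S smooth_on_subset[OF smooth_cut subset_UNIV] cc zS] by auto
    have rhs: "0 \<le> (1 + 2 * real CARD('n)) * B * (D * 9) * s\<^sup>2" using D by (simp add: B_def)
    show ?thesis
    \<comment> \<open>1/256 is the square of the radius 1/16 within which the spatial cutoff is
      identically 1.\<close>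
    proof (cases "sqn z < 1/256")
      case True
      let ?T = "{z::'n spacetime. sqn z < 1/256}"
      have T: "open ?T" by (intro open_Collect_less continuous_intros)
      have "space_cut w = 1" if "w \<in> ?T" for w
        using that by (simp add: space_cut_def step_1)
      then have "adj_heat space_cut z = adj_heat (\<lambda>z. 1) z" "dir_deriv v space_cut z = dir_deriv v (\<lambda>z. 1) z" for v
        using adj_heat_cong_open[OF T smooth_on_subset[OF smooth_space_cut subset_UNIV], of "\<lambda>z. 1" z] True by auto
      then have "remainder (cut s) \<epsilon> a z = 0" unfolding remainder_def ce by (simp add: dir_deriv_const adj_heat_const)
      then show ?thesis using rhs by simp
    next
      case False
      show ?thesis
      proof (cases "snd (a - z) > 0")
        case True
        \<comment> \<open>The cutoff varies at radius at least 1/16 and the pole has radius below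
          1/32; the square of the gap 1/32 is the 1/1024 in the smallness estimate for the
          kernel.\<close>
        have "(1/16)\<^sup>2 \<le> (norm (fst z))\<^sup>2" using False by (simp add: dot_square_norm power2_eq_square)
        then have "1/16 \<le> norm (fst z)" by (rule power2_le_imp_le) simp
        moreover have "norm (fst z) - norm (fst a) \<le> norm (fst (a - z))"
          using norm_triangle_ineq2[of "fst z" "fst a"] by (simp add: norm_minus_commute)
        ultimately have n1: "1/32 \<le> norm (fst (a - z))" using a by linarith
        then have "(1/32)\<^sup>2 \<le> (norm (fst (a - z)))\<^sup>2" by (intro power_mono) auto
        then have q: "sqn (a - z) \<ge> 1/1024" by (simp only: dot_square_norm) (simp add: power2_eq_square)
        have n2: "norm (fst (a - z)) \<le> 1" using norm_triangle_ineq4[of "fst a" "fst z"] a nz by simp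
        have t3: "snd (a - z) \<le> 3 * s" using a zS by simp
        then have t1: "snd (a - z) \<le> 1" using s by simp
        note gs = gam_small[OF less_imp_le[OF e] q n2 True t1, folded D_def]
        have "(snd (a - z))\<^sup>2 \<le> (3 * s)\<^sup>2" using t3 True by (intro power_mono) auto
        then have "D * (snd (a - z))\<^sup>2 \<le> D * 9 * s\<^sup>2" using D mult_left_mono[of _ _ D] by (fastforce simp: power_mult_distrib mult.assoc)
        then have g: "gam \<epsilon> (a - z) \<le> D * 9 * s\<^sup>2" "\<And>i. \<bar>dir_deriv (space_dir i) (gam \<epsilon>) (a - z)\<bar> \<le> D * 9 * s\<^sup>2"
          using gs order_trans by blast+
        have "z \<in> cball 0 1 \<times> {-1..1}" using nz s by (cases z) auto
        then have "\<bar>adj_heat (cut s) z\<bar> \<le> B" "\<And>i. \<bar>dir_deriv (space_dir i) (cut s) z\<bar> \<le> B"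
          using B0 unfolding ce B_def by (auto simp: le_max_iff_disj)
        from remainder_le[OF this g] show ?thesis by (simp add: mult.assoc)
      next
        case False
        then have "remainder (cut s) \<epsilon> a z = 0" unfolding remainder_def
          using dir_deriv_gam_nonpos[OF e, of "a - z"] gam_snd_nonpos[of "a - z" \<epsilon>] by simp
        then show ?thesis using rhs by simp
      qed
    qed
  qed
  moreover have "0 \<le> (1 + 2 * real CARD('n)) * B * (D * 9)" using D by (simp add: B_def)
  ultimately show ?thesis by blast
qed

text \<open>On the lower set the elapsed time is at least \<open>s\<close>, so the kernel is
  bounded. The constant may blow up as \<open>s\<close> shrinks; it will only multiply the integral
  over the lower set, which is controlled by \<open>k\<close>.\<close>

lemma remainder_lower:
  assumes s: "0 < s" "s \<le> 1/1024"
  shows "\<exists>C\<ge>0. \<forall>\<epsilon> a z. \<epsilon> > 0 \<and> norm (fst a) < 1/32 \<and> \<bar>snd a\<bar> < s \<and> z \<in> lower_set s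
     \<longrightarrow> \<bar>remainder (cut s :: 'n::finite spacetime \<Rightarrow> real) \<epsilon> a z\<bar> \<le> C"
proof -
  have cK: "compact (lower_set s :: 'n spacetime set)" unfolding lower_set_def by (intro compact_Times compact_cball compact_Icc)
  obtain B0 where B0: "\<forall>z\<in>lower_set s. \<bar>adj_heat (cut s) z\<bar> \<le> B0 \<and> (\<forall>i. \<bar>dir_deriv (space_dir i) (cut s :: 'n spacetime \<Rightarrow> real) z\<bar> \<le> B0)"
    using cutoff_derivs_bounded[OF smooth_cut cK] by blast
  define B where "B = max B0 0"
  let ?p = "s powr (- real CARD('n) / 2)"
  define D where "D = max ?p (1 / (2 * s) * ?p)"
  have "\<bar>remainder (cut s) \<epsilon> a z\<bar> \<le> (1 + 2 * real CARD('n)) * B * D"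
    if e: "\<epsilon> > 0" and a: "norm (fst a) < 1/32" "\<bar>snd a\<bar> < s" and z: "z \<in> lower_set s" for \<epsilon> and a z :: "'n spacetime"
  proof -
    have nz: "norm (fst z) \<le> 1/8" "snd z \<le> - (2 * s)" using z by (auto simp: lower_set_def)
    have t: "snd (a - z) \<ge> s" using a nz by simp
    then have t0: "snd (a - z) > 0" using s by linarith
    have n2: "norm (fst (a - z)) \<le> 1" using norm_triangle_ineq4[of "fst a" "fst z"] a nz by simp
    have "gam \<epsilon> (a - z) \<le> (snd (a - z)) powr (- real CARD('n) / 2) * 1"
    proof -
      have "- (sqn (a - z) + \<epsilon>) / (4 * snd (a - z)) \<le> 0"
        using inner_ge_zero[of "fst (a - z)"] e t0 by (intro divide_nonpos_pos) linarith+
      then have "exp (- (sqn (a - z) + \<epsilon>) / (4 * snd (a - z))) \<le> 1" by simp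
      then show ?thesis unfolding gam_def using t0 by (simp only: if_True) (intro mult_left_mono, auto)
    qed
    also have "\<dots> \<le> ?p" using t s by (simp, intro powr_mono2') auto
    finally have g1: "gam \<epsilon> (a - z) \<le> ?p" .
    have xi: "\<bar>fst (a - z) $ i\<bar> \<le> 1" for i using component_le_norm_cart[of "fst (a - z)" i] n2 by linarith
    have g2: "\<bar>dir_deriv (space_dir i) (gam \<epsilon>) (a - z)\<bar> \<le> D" for i
    proof -
      have "\<bar>dir_deriv (space_dir i) (gam \<epsilon>) (a - z)\<bar> = \<bar>fst (a - z) $ i\<bar> / (2 * snd (a - z)) * gam \<epsilon> (a - z)"
        using t0 gam_nonneg[of \<epsilon> "a - z"] unfolding gam_space[OF t0] by (simp add: abs_mult)
      also have "\<dots> \<le> 1 / (2 * s) * ?p"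
        using xi[of i] t s t0 g1 gam_nonneg[of \<epsilon> "a - z"] by (intro mult_mono frac_le) auto
      finally show ?thesis by (simp add: D_def le_max_iff_disj)
    qed
    have g1': "gam \<epsilon> (a - z) \<le> D" using g1 by (simp add: D_def le_max_iff_disj)
    have "\<bar>adj_heat (cut s) z\<bar> \<le> B" "\<And>i. \<bar>dir_deriv (space_dir i) (cut s) z\<bar> \<le> B"
      using B0 z unfolding B_def by (auto simp: le_max_iff_disj)
    from remainder_le[OF this g1' g2] show ?thesis .
  qed
  moreover have "0 \<le> (1 + 2 * real CARD('n)) * B * D" by (simp add: B_def D_def le_max_iff_disj)
  ultimately show ?thesis by blast
qed

text \<open>The upper sign of \<open>heat_ineq\<close> makes the concentration term at most the
  integral of \<open>u\<close> times the modulus of the remainder; that integral is split into the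
  lower set and the rest. As \<epsilon> tends to 0 the concentration term becomes a multiple of
  \<open>u a\<close>.\<close>

lemma pointwise_bound_by_integral:
  fixes u :: "'n::finite spacetime \<Rightarrow> real"
  assumes s: "0 < s" "s \<le> 1/1024"
    and C1: "C1 \<ge> 0" "\<And>\<epsilon> a z. \<epsilon> > 0 \<Longrightarrow> norm (fst a) < 1/32 \<Longrightarrow> \<bar>snd a\<bar> < s \<Longrightarrow> z \<in> lower_set s
       \<Longrightarrow> \<bar>remainder (cut s :: 'n::finite spacetime \<Rightarrow> real) \<epsilon> a z\<bar> \<le> C1"
    and C2: "C2 \<ge> 0" "\<And>\<epsilon> a z. \<epsilon> > 0 \<Longrightarrow> norm (fst a) < 1/32 \<Longrightarrow> \<bar>snd a\<bar> < s \<Longrightarrow> z \<in> upper_set s \<Longrightarrow> z \<notin> lower_set s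
       \<Longrightarrow> \<bar>remainder (cut s :: 'n::finite spacetime \<Rightarrow> real) \<epsilon> a z\<bar> \<le> C2"
    and u: "continuous_on (Q0 1) u" "\<And>z. z \<in> Q0 1 \<Longrightarrow> u z \<ge> 0" "\<And>z. z \<in> Q0 1 \<Longrightarrow> u z \<le> M" and H: "heat_ineq (Q0 1) u k"
    and a: "norm (fst a) < 1/32" "\<bar>snd a\<bar> < s"
  shows "u a * integral\<^sup>L lborel (conc 1 :: 'n spacetime \<Rightarrow> real) \<le> C1 * (\<integral>z. indicator (lower_set s) z * u z \<partial>lborel)
     + C2 * M * measure lborel (cball 0 1 \<times> {-1..1} :: 'n spacetime set)"
proof -
  define K :: "'n spacetime set" where "K = upper_set s"
  define V :: "'n spacetime set" where "V = cball 0 1 \<times> {-1..1}"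
  have K: "compact K" unfolding K_def upper_set_def by (intro compact_Times compact_cball compact_Icc)
  have V: "compact V" unfolding V_def by (intro compact_Times compact_cball compact_Icc)
  have KQ: "K \<subseteq> Q0 1" using s by (auto simp: K_def upper_set_def Q0_iff)
  have KV: "K \<subseteq> V" using s by (auto simp: K_def V_def upper_set_def)
  have EK: "lower_set s \<subseteq> K" using s by (auto simp: K_def lower_set_def upper_set_def)
  have uK: "continuous_on K u" using u(1) KQ continuous_on_subset by blast
  have "(0::'n spacetime) \<in> Q0 1" by (simp add: Q0_iff)
  then have M: "M \<ge> 0" using u(2,3)[of 0] by linarith
  have ucK: "continuous_on K (\<lambda>z. u z * cut s z)"
    by (intro continuous_on_mult uK continuous_on_subset[OF smooth_cont[OF smooth_cut]]) auto
  define g where "g = (\<lambda>w. indicator K w * (u w * cut s w))"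
  obtain Mg where g: "g \<in> borel_measurable borel" and Mg: "\<And>w. \<bar>g w\<bar> \<le> Mg"
    using bounded_measurable_on_compact[OF K ucK] unfolding g_def by blast
  define I where "I = {z::'n spacetime. norm (fst z) < 1/8 \<and> - (3 * s) < snd z \<and> snd z < s}"
  have I: "open I" unfolding I_def by (intro open_Collect_conj open_Collect_less continuous_intros)
  have IK: "I \<subseteq> K" by (auto simp: I_def K_def upper_set_def)
  have aI: "a \<in> I" using a s by (auto simp: I_def)
  \<comment> \<open>The pole is interior to \<open>K\<close> this time, so cutting off by the
    indicator keeps continuity there although \<open>u a\<close> need not vanish.\<close>
  have "isCont (\<lambda>z. u z * cut s z) a"
    using continuous_on_subset[OF ucK IK] I aI by (simp add: continuous_on_eq_continuous_at)
  moreover have "\<forall>\<^sub>F x in nhds a. u x * cut s x = g x"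
    using eventually_nhds_in_open[OF I aI] by (rule eventually_mono) (use IK in \<open>auto simp: g_def\<close>)
  ultimately have gc: "isCont g a" by (simp only: isCont_cong)
  have cut_center: "cut s a = 1"
  proof -
    have "(norm (fst a))\<^sup>2 \<le> (1/32)\<^sup>2" using a by (intro power_mono) auto
    then have "sqn a \<le> 1/1024" by (simp only: dot_square_norm) (simp add: power2_eq_square)
    moreover have "snd a * (1/s) + 3 \<ge> 1" using a s by (simp add: field_simps)
    ultimately show ?thesis by (simp add: cut_def space_cut_def time_cut_def step_1)
  qed
  have ga: "g a = u a" using aI IK cut_center by (auto simp: g_def)
  define X where "X = (\<lambda>j. inverse (real (Suc j)))"
  have X: "X j > 0" for j by (simp add: X_def)
  have Xl: "X \<longlonglongrightarrow> 0" unfolding X_def by (rule LIMSEQ_inverse_real_of_nat)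
  have lim: "(\<lambda>j. \<integral>z. g z * conc (X j) (a - z) \<partial>lborel) \<longlonglongrightarrow> u a * integral\<^sup>L lborel (conc 1 :: 'n spacetime \<Rightarrow> real)"
    using concentration(1)[OF g Mg gc X Xl] unfolding ga .
  have gi: "integrable lborel (\<lambda>z. g z * conc (X j) (a - z))" for j
    by (rule concentration(2)[OF g Mg gc X Xl])
  have iE: "integrable lborel (\<lambda>z. indicator (lower_set s) z * u z)"
  proof -
    have "compact (lower_set s :: 'n spacetime set)" unfolding lower_set_def by (intro compact_Times compact_cball compact_Icc)
    then show ?thesis using borel_integrable_compact[of "lower_set s" u] uK EK continuous_on_subset by fastforce
  qed
  have iV: "integrable lborel (indicator V :: 'n spacetime \<Rightarrow> real)"
    using emeasure_compact_finite[OF V] borel_closed[OF compact_imp_closed[OF V]] by (intro integrable_real_indicator) auto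
  have "(\<integral>z. g z * conc (X j) (a - z) \<partial>lborel) \<le> C1 * (\<integral>z. indicator (lower_set s) z * u z \<partial>lborel) + C2 * M * measure lborel V" for j
  proof -
    define \<phi> where "\<phi> = (\<lambda>w. cut s w * gam (X j) (a - w))"
    have \<phi>s: "smooth_on UNIV \<phi>" unfolding \<phi>_def by (intro smooth_on_mult open_UNIV smooth_cut smooth_gam_reflect X)
    have \<phi>K: "\<phi> z = 0" if "z \<notin> K" for z
    proof -
      consider "norm (fst z) > 1/8" | "snd z < - (3 * s)" | "snd z > s"
      proof -
        have "\<not> (norm (fst z) \<le> 1/8 \<and> - (3 * s) \<le> snd z \<and> snd z \<le> s)"
          using \<open>z \<notin> K\<close> by (cases z) (auto simp: K_def upper_set_def)
        then show thesis using that by linarith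
      qed
      then show ?thesis
      proof cases
        case 1
        then have "(1/8)\<^sup>2 \<le> (norm (fst z))\<^sup>2" by (intro power_mono) auto
        then have "sqn z \<ge> 1/64" by (simp only: dot_square_norm) (simp add: power2_eq_square)
        then show ?thesis by (simp add: \<phi>_def cut_def space_cut_def step_0)
      next
        case 2
        then have "snd z * (1/s) + 3 \<le> 0" using s by (simp add: field_simps)
        then show ?thesis by (simp add: \<phi>_def cut_def time_cut_def step_0)
      next
        case 3
        \<comment> \<open>The kernel vanishes at all times after its pole, and the pole lies before
          time \<open>s\<close>.\<close>
        then show ?thesis using a by (simp add: \<phi>_def gam_def)
      qed
    qed
    have test: "test_function (Q0 1) \<phi>" by (rule test_functionI[OF \<phi>s K KQ \<phi>K])
    have i1: "integrable lborel (\<lambda>z. u z * adj_heat \<phi> z)" by (rule integrable_adj_heat[OF \<phi>s K \<phi>K uK])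
    have H0: "(\<integral>z. u z * adj_heat \<phi> z \<partial>lborel) \<le> 0"
      using H test unfolding heat_ineq_def by (simp add: \<phi>_def cut_range gam_nonneg)
    have i2: "integrable lborel (\<lambda>z. C1 * (indicator (lower_set s) z * u z))" using iE by simp
    have i3: "integrable lborel (\<lambda>z. C2 * M * indicat_real V z)" using iV by simp
    have i4: "integrable lborel (\<lambda>z. u z * adj_heat \<phi> z + C1 * (indicator (lower_set s) z * u z) + C2 * M * indicat_real V z)"
      by (intro Bochner_Integration.integrable_add i1 i2 i3)
    have "(\<integral>z. g z * conc (X j) (a - z) \<partial>lborel) \<le> (\<integral>z. u z * adj_heat \<phi> z + C1 * (indicator (lower_set s) z * u z) + C2 * M * indicator V z \<partial>lborel)"
    proof (rule integral_mono[OF gi i4])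
      fix z :: "'n spacetime"
      show "g z * conc (X j) (a - z) \<le> u z * adj_heat \<phi> z + C1 * (indicator (lower_set s) z * u z) + C2 * M * indicator V z"
      proof (cases "z \<in> K")
        case True
        then have uz: "u z \<ge> 0" "u z \<le> M" using u(2,3)[of z] KQ by auto
        have ah: "adj_heat \<phi> z = cut s z * conc (X j) (a - z) + remainder (cut s) (X j) a z"
          unfolding \<phi>_def by (rule adj_heat_cutoff[OF X smooth_cut])
        have "u z * \<bar>remainder (cut s) (X j) a z\<bar> \<le> C1 * (indicator (lower_set s) z * u z) + C2 * M * indicator V z"
        proof (cases "z \<in> lower_set s")
          case T: True
          have "u z * \<bar>remainder (cut s) (X j) a z\<bar> \<le> u z * C1"
            using C1(2)[OF X a T] uz by (intro mult_left_mono) auto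
          then show ?thesis using T C2(1) M by (simp add: mult.commute add_increasing2)
        next
          case F: False
          have "u z * \<bar>remainder (cut s) (X j) a z\<bar> \<le> M * C2"
            using C2(2)[OF X a True[unfolded K_def] F] uz M by (intro mult_mono) auto
          then show ?thesis using F True KV by (auto simp: mult.commute)
        qed
        moreover have "- (u z * remainder (cut s) (X j) a z) \<le> u z * \<bar>remainder (cut s) (X j) a z\<bar>"
          using uz by (metis abs_ge_minus_self abs_mult abs_of_nonneg)
        ultimately show ?thesis using True unfolding ah g_def by (simp add: algebra_simps)
      next
        case False
        then have "z \<notin> lower_set s" using EK by blast
        then show ?thesis using False adj_heat_vanish[OF compact_imp_closed[OF K] \<phi>K] C2(1) M by (simp add: g_def)
      qed
    qed
    also have "\<dots> = (\<integral>z. u z * adj_heat \<phi> z \<partial>lborel) + C1 * (\<integral>z. indicator (lower_set s) z * u z \<partial>lborel) + C2 * M * measure lborel V"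
      using i1 i2 i3 iE iV by (simp add: Bochner_Integration.integral_add)
    finally show ?thesis using H0 by linarith
  qed
  then show ?thesis unfolding V_def[symmetric] using LIMSEQ_le_const2[OF lim] by blast
qed

text \<open>The order of choices matters: \<open>C2\<close> does not depend on \<open>s\<close>, so
  \<open>s\<close> can be fixed to make \<open>C2 * s\<^sup>2\<close> small against s; only then is
  \<open>C1\<close>, which depends on \<open>s\<close>, chosen.\<close>

lemma harnack_improvement:
  "\<exists>s C. 0 < s \<and> s < 1 \<and> C \<ge> 0 \<and> (\<forall>(u::'n::finite spacetime \<Rightarrow> real) k M.
     continuous_on (Q0 1) u \<and> (\<forall>z\<in>Q0 1. 0 \<le> u z \<and> u z \<le> M) \<and> u 0 = 0 \<and> heat_ineq (Q0 1) u k \<and> k \<ge> 0 \<longrightarrow>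
     (\<forall>z\<in>Q0 (sqrt s). u z \<le> C * k + s / 2 * M))"
proof -
  let ?G = "integral\<^sup>L lborel (conc 1 :: 'n spacetime \<Rightarrow> real)"
  let ?V = "measure lborel (cball 0 1 \<times> {-1..1} :: 'n spacetime set)"
  have G: "?G > 0" by (rule integral_conc_pos)
  obtain C2 where C2: "C2 \<ge> 0" "\<forall>s. 0 < s \<and> s \<le> 1/1024 \<longrightarrow> (\<forall>\<epsilon> a z. \<epsilon> > 0 \<and> norm (fst a) < 1/32 \<and> \<bar>snd a\<bar> < s \<and> z \<in> upper_set s \<and> z \<notin> lower_set s
     \<longrightarrow> \<bar>remainder (cut s :: 'n::finite spacetime \<Rightarrow> real) \<epsilon> a z\<bar> \<le> C2 * s\<^sup>2)"
    using remainder_upper[where 'n='n] by blast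
  \<comment> \<open>The first entry yields both s \<le> 1/1024 and s \<le> 1/(40 n). The second
    yields \<open>2 * s * C2 * ?V \<le> ?G\<close>, which turns the quadratic term into s/2; the
    added 1 keeps its denominator positive.\<close>
  define s where "s = min (1 / (1024 * real CARD('n))) (?G / (2 * (C2 * ?V + 1)))"
  have CV: "C2 * ?V \<ge> 0" using C2 by simp
  have n: "real CARD('n) \<ge> 1" by (simp add: Suc_leI)
  have s0: "s > 0" using G CV by (auto simp: s_def)
  have "1 / (1024 * real CARD('n)) \<le> 1 / (1024 * 1)" using n by (intro divide_left_mono) auto
  moreover have sle: "s \<le> 1 / (1024 * real CARD('n))" by (simp add: s_def)
  ultimately have s1: "s \<le> 1/1024" by linarith
  have "1 / (1024 * real CARD('n)) \<le> 1 / (40 * real CARD('n))" using n by (intro divide_left_mono) auto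
  with sle have s2: "s \<le> 1 / (40 * real CARD('n))" by linarith
  have "s \<le> ?G / (2 * (C2 * ?V + 1))" by (simp add: s_def)
  then have "s * (2 * (C2 * ?V + 1)) \<le> ?G" using CV by (simp add: pos_le_divide_eq)
  then have s3: "2 * s * C2 * ?V \<le> ?G" using s0 by (simp add: algebra_simps)
  obtain C1 where C1: "C1 \<ge> 0" "\<forall>\<epsilon> a z. \<epsilon> > 0 \<and> norm (fst a) < 1/32 \<and> \<bar>snd a\<bar> < s \<and> z \<in> lower_set s
     \<longrightarrow> \<bar>remainder (cut s :: 'n::finite spacetime \<Rightarrow> real) \<epsilon> a z\<bar> \<le> C1"
    using remainder_lower[OF s0 s1, where 'n='n] by blast
  define c where "c = exp (- (1 / (4 * ((4 * s) powr (- real CARD('n) / 2) * (exp (- (1 / (256 * s))) - exp (- (1 / (200 * s))))))))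
      * ((4 * s) powr (- real CARD('n) / 2) * exp (- (1 / (100 * s))) / (200 * s\<^sup>2))"
  have c: "c > 0" using s0 by (simp add: c_def)
  define L where "L = 4 * s * enn2real (gauss_mass TYPE('n)) / c"
  have L: "L \<ge> 0" using s0 c by (simp add: L_def)
  have "u z \<le> C1 * L / ?G * k + s / 2 * M"
    if u: "continuous_on (Q0 1) u" "\<forall>z\<in>Q0 1. 0 \<le> u z \<and> u z \<le> M" "u 0 = 0" "heat_ineq (Q0 1) u k" "k \<ge> 0" and z: "z \<in> Q0 (sqrt s)"
    for u :: "'n spacetime \<Rightarrow> real" and k M z
  proof -
    have u1: "z \<in> Q0 1 \<Longrightarrow> u z \<ge> 0" and u2: "z \<in> Q0 1 \<Longrightarrow> u z \<le> M" for z using u(2) by blast+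
    have "(0::'n spacetime) \<in> Q0 1" by (simp add: Q0_iff)
    then have M: "M \<ge> 0" using u1[of 0] u2[of 0] by linarith
    have "sqrt s \<le> sqrt ((1/32)\<^sup>2)" using s1 by (intro real_sqrt_le_mono) (simp add: power2_eq_square)
    then have z1: "norm (fst z) < 1/32" using z by (simp add: Q0_iff)
    have z2: "\<bar>snd z\<bar> < s" using z s0 by (simp add: Q0_iff)
    have "c * (\<integral>z. indicator (lower_set s) z * u z \<partial>lborel) \<le> k * (4 * s * enn2real (gauss_mass TYPE('n)))"
      unfolding c_def by (rule integral_bound_below_zero[OF s0 s2 u(1) u1 u(3,4,5)])
    then have l: "(\<integral>z. indicator (lower_set s) z * u z \<partial>lborel) \<le> L * k"
      using c by (simp add: L_def field_simps)
    have "u z * ?G \<le> C1 * (\<integral>z. indicator (lower_set s) z * u z \<partial>lborel) + (C2 * s\<^sup>2) * M * ?V"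
      by (rule pointwise_bound_by_integral[OF s0 s1 C1(1) _ _ _ u(1) u1 u2 u(4) z1 z2]) (use C1(2) C2 s0 s1 in auto)
    also have "\<dots> \<le> C1 * (L * k) + s / 2 * M * ?G"
    proof (rule add_mono)
      show "C1 * (\<integral>z. indicator (lower_set s) z * u z \<partial>lborel) \<le> C1 * (L * k)" using l C1(1) by (rule mult_left_mono)
      have "(s * M / 2) * (2 * s * C2 * ?V) \<le> (s * M / 2) * ?G" using s3 s0 M by (intro mult_left_mono) auto
      then show "(C2 * s\<^sup>2) * M * ?V \<le> s / 2 * M * ?G" by (simp add: power2_eq_square algebra_simps)
    qed
    also have "\<dots> = (C1 * L / ?G * k + s / 2 * M) * ?G" using G by (simp add: field_simps)
    finally show ?thesis using G by simp
  qed
  moreover have "C1 * L / ?G \<ge> 0" using C1(1) L G by simp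
  moreover have "s < 1" using s1 by simp
  ultimately show ?thesis using s0 by blast
qed

section \<open>Iteration over scales\<close>

lemma paff_in_cylinder:
  assumes "r > 0"
  shows "paff z0 r (r\<^sup>2) z \<in> parabolic_cylinder (r * \<rho>) z0 \<longleftrightarrow> z \<in> Q0 \<rho>"
proof -
  have "norm (r *\<^sub>R fst z) = r * norm (fst z)" "\<bar>r\<^sup>2 * snd z\<bar> = r\<^sup>2 * \<bar>snd z\<bar>" using assms by (simp_all add: abs_mult)
  then show ?thesis using assms by (simp add: parabolic_cylinder_def paff_def power_mult_distrib)
qed

lemma paff_surj:
  assumes "r > 0"
  obtains w where "z = paff z0 r (r\<^sup>2) w"
proof
  show "z = paff z0 r (r\<^sup>2) ((1/r) *\<^sub>R fst (z - z0), (1/r\<^sup>2) * snd (z - z0))"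
    using assms by (simp add: paff_def prod_eq_iff)
qed

lemma cylinder_mono: "0 \<le> r \<Longrightarrow> r \<le> \<rho> \<Longrightarrow> parabolic_cylinder r z0 \<subseteq> parabolic_cylinder \<rho> z0"
  unfolding parabolic_cylinder_def using power_mono[of r \<rho> 2]
  by (intro Collect_mono impI conjI) (auto intro: less_le_trans)

lemma continuous_paff: "continuous_on S (paff z0 a b)"
  unfolding paff_def[abs_def] by (intro continuous_intros)

text \<open>Induction along the radii \<open>sqrt s ^ j * R\<close>: rescaled to the unit cylinder,
  the bound A r^2 improves to C K r^2 + (s/2) A r^2, which is at most A s r^2 as soon as 2 C K \<le>
  A s.\<close>

lemma quadratic_growth:
  assumes R: "R > 0" and K: "K \<ge> 0"
  shows "\<exists>A>0. \<forall>(u::'n::finite spacetime \<Rightarrow> real) z0.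
     continuous_on (parabolic_cylinder R z0) u \<and> (\<forall>z\<in>parabolic_cylinder R z0. 0 \<le> u z \<and> u z \<le> K) \<and> u z0 = 0
       \<and> heat_ineq (parabolic_cylinder R z0) u K \<longrightarrow>
     (\<forall>r. 0 < r \<and> r \<le> R \<longrightarrow> (\<forall>z\<in>parabolic_cylinder r z0. u z \<le> A * r\<^sup>2))"
proof -
  obtain s C where s: "0 < s" "s < 1" and C: "C \<ge> 0" and st: "\<forall>(u::'n::finite spacetime \<Rightarrow> real) k M.
     continuous_on (Q0 1) u \<and> (\<forall>z\<in>Q0 1. 0 \<le> u z \<and> u z \<le> M) \<and> u 0 = 0 \<and> heat_ineq (Q0 1) u k \<and> k \<ge> 0 \<longrightarrow>
     (\<forall>z\<in>Q0 (sqrt s). u z \<le> C * k + s / 2 * M)"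
    using harnack_improvement[where 'n='n] by blast
  \<comment> \<open>The first entry closes the induction step and the second starts the induction at
    radius \<open>R\<close>; the 1 makes \<open>A\<close> positive.\<close>
  define A where "A = max (2 * C * K / s) (K / R\<^sup>2) + 1"
  have A1: "2 * C * K / s \<le> A" and A2: "K / R\<^sup>2 \<le> A" and A0: "A > 0"
    using C K s R by (auto simp: A_def le_max_iff_disj intro!: add_nonneg_pos)
  have main: "\<forall>z\<in>parabolic_cylinder (sqrt s ^ j * R) z0. u z \<le> A * (sqrt s ^ j * R)\<^sup>2"
    if u: "continuous_on (parabolic_cylinder R z0) u" "\<forall>z\<in>parabolic_cylinder R z0. 0 \<le> u z \<and> u z \<le> K" "u z0 = 0"
       "heat_ineq (parabolic_cylinder R z0) u K" for u :: "'n spacetime \<Rightarrow> real" and z0 j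
  proof (induction j)
    case 0
    have "K \<le> A * R\<^sup>2" using A2 R by (simp add: field_simps)
    then show ?case using u(2) by fastforce
  next
    case (Suc j)
    define r where "r = sqrt s ^ j * R"
    have r: "r > 0" using s R by (simp add: r_def)
    have rR: "r \<le> R" using s R unfolding r_def by (intro mult_left_le_one_le power_le_one) auto
    define v where "v = (\<lambda>z. u (paff z0 r (r\<^sup>2) z))"
    have sub: "paff z0 r (r\<^sup>2) z \<in> parabolic_cylinder r z0" if "z \<in> Q0 1" for z
      using paff_in_cylinder[OF r, of z0 z 1] that by simp
    have subR: "paff z0 r (r\<^sup>2) z \<in> parabolic_cylinder R z0" if "z \<in> Q0 1" for z
      using sub[OF that] cylinder_mono[of r R z0] r rR by auto
    have v1: "continuous_on (Q0 1) v" unfolding v_def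
      by (rule continuous_on_compose2[OF u(1) continuous_paff]) (use subR in auto)
    have v2: "\<forall>z\<in>Q0 1. 0 \<le> v z \<and> v z \<le> A * r\<^sup>2"
      using sub subR u(2) Suc.IH unfolding v_def r_def by blast
    have v3: "v 0 = 0" using u(3) by (simp add: v_def paff_def zero_prod_def[symmetric])
    have v4: "heat_ineq (Q0 1) v (K * r\<^sup>2)" unfolding v_def
      by (rule heat_ineq_scale[OF u(4) r u(1) subR])
    have step: "v z \<le> C * (K * r\<^sup>2) + s / 2 * (A * r\<^sup>2)" if "z \<in> Q0 (sqrt s)" for z
      using st v1 v2 v3 v4 that K by auto
    have "2 * C * K \<le> A * s" using A1 s by (simp add: field_simps)
    moreover have "s / 2 * A = A * s / 2" by simp
    ultimately have "C * K + s / 2 * A \<le> A * s" by linarith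
    then have "(C * K + s / 2 * A) * r\<^sup>2 \<le> A * s * r\<^sup>2" by (intro mult_right_mono) auto
    then have fin: "C * (K * r\<^sup>2) + s / 2 * (A * r\<^sup>2) \<le> A * (r * sqrt s)\<^sup>2"
      using s by (simp add: algebra_simps power_mult_distrib)
    have "u z \<le> A * (r * sqrt s)\<^sup>2" if z: "z \<in> parabolic_cylinder (r * sqrt s) z0" for z
    proof -
      obtain w where w: "z = paff z0 r (r\<^sup>2) w" using paff_surj[OF r] by blast
      then have "w \<in> Q0 (sqrt s)" using z paff_in_cylinder[OF r, of z0 w "sqrt s"] by simp
      from step[OF this] fin show ?thesis by (simp add: v_def w)
    qed
    then show ?case by (simp add: r_def mult_ac)
  qed
  have "\<forall>z\<in>parabolic_cylinder r z0. u z \<le> (A / s) * r\<^sup>2"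
    if u: "continuous_on (parabolic_cylinder R z0) u \<and> (\<forall>z\<in>parabolic_cylinder R z0. 0 \<le> u z \<and> u z \<le> K) \<and> u z0 = 0
       \<and> heat_ineq (parabolic_cylinder R z0) u K" and r: "0 < r" "r \<le> R" for u :: "'n spacetime \<Rightarrow> real" and z0 r
  proof -
    have "\<exists>n. sqrt s ^ n < r / R" using real_arch_pow_inv[of "r / R" "sqrt s"] r R s by simp
    \<comment> \<open>\<open>r\<close> lies between two consecutive radii of the iteration; using
      the bound on the larger one costs the factor 1/s.\<close>
    define m where "m = (LEAST n. sqrt s ^ n < r / R)"
    have m: "sqrt s ^ m < r / R" unfolding m_def using \<open>\<exists>n. _\<close> by (rule LeastI_ex)
    have "m \<noteq> 0" using m r R by (intro notI) simp
    then obtain j where j: "m = Suc j" using not0_implies_Suc by blast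
    have "\<not> sqrt s ^ j < r / R" using not_less_Least[of j "\<lambda>n. sqrt s ^ n < r / R"] j by (simp add: m_def)
    then have 1: "r \<le> sqrt s ^ j * R" using R by (simp add: field_simps)
    have "sqrt s * (sqrt s ^ j * R) \<le> r" using m j R by (simp add: field_simps)
    then have "(sqrt s * (sqrt s ^ j * R))\<^sup>2 \<le> r\<^sup>2" using s R by (intro power_mono) auto
    then have "s * (sqrt s ^ j * R)\<^sup>2 \<le> r\<^sup>2" using s by (simp add: power_mult_distrib)
    then have 2: "(sqrt s ^ j * R)\<^sup>2 \<le> r\<^sup>2 / s" using s by (simp add: field_simps)
    show ?thesis
    proof
      fix z assume "z \<in> parabolic_cylinder r z0"
      then have "z \<in> parabolic_cylinder (sqrt s ^ j * R) z0" using cylinder_mono[of r _ z0] 1 r by auto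
      then have "u z \<le> A * (sqrt s ^ j * R)\<^sup>2" using main[of z0 u j] u by blast
      also have "\<dots> \<le> A * (r\<^sup>2 / s)" using 2 A0 by (intro mult_left_mono) auto
      finally show "u z \<le> (A / s) * r\<^sup>2" by simp
    qed
  qed
  moreover have "A / s > 0" using A0 s by simp
  ultimately show ?thesis by blast
qed

section \<open>Convolution with a smooth kernel\<close>

definition conv :: "('a::euclidean_space \<Rightarrow> real) \<Rightarrow> ('a \<Rightarrow> real) \<Rightarrow> 'a \<Rightarrow> real" where
  "conv g \<Phi> z = (\<integral>w. g w * \<Phi> (z - w) \<partial>lborel)"

text \<open>The density needs no continuity, since all smoothness will come from the kernel. The
  bound \<open>m\<close> is kept explicit so that the estimates come out linear in it.\<close>

definition cpt_bdd :: "'a::euclidean_space set \<Rightarrow> real \<Rightarrow> ('a \<Rightarrow> real) \<Rightarrow> bool" where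
  "cpt_bdd K m g \<longleftrightarrow> compact K \<and> g \<in> borel_measurable borel \<and> (\<forall>w. \<bar>g w\<bar> \<le> m * indicator K w)"

lemma integrable_indicator_compact: "compact K \<Longrightarrow> integrable lborel (indicator K :: 'a::euclidean_space \<Rightarrow> real)"
  using emeasure_compact_finite[of K] borel_closed[OF compact_imp_closed, of K]
  by (intro integrable_real_indicator) auto

lemma integrable_cpt_bdd:
  assumes g: "cpt_bdd K m g" and [measurable]: "h \<in> borel_measurable borel" and B: "\<And>w. w \<in> K \<Longrightarrow> \<bar>h w\<bar> \<le> B"
  shows "integrable lborel (\<lambda>w. g w * h w)" and "\<bar>\<integral>w. g w * h w \<partial>lborel\<bar> \<le> m * B * measure lborel K"
proof -
  have K: "compact K" and [measurable]: "g \<in> borel_measurable borel" and gb: "\<And>w. \<bar>g w\<bar> \<le> m * indicator K w"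
    using g by (auto simp: cpt_bdd_def)
  have b: "\<bar>g w * h w\<bar> \<le> m * B * indicator K w" for w
  proof (cases "w \<in> K")
    case True
    then have "\<bar>g w\<bar> \<le> m" using gb[of w] by simp
    moreover from this have "0 \<le> m" by linarith
    ultimately show ?thesis using B[OF True] True by (auto simp: abs_mult intro!: mult_mono)
  next
    case False
    then show ?thesis using gb[of w] by simp
  qed
  have i: "integrable lborel (\<lambda>w. m * B * indicator K w)" using integrable_indicator_compact[OF K] by simp
  show i2: "integrable lborel (\<lambda>w. g w * h w)"
  proof (rule Bochner_Integration.integrable_bound[OF i])
    show "AE w in lborel. norm (g w * h w) \<le> norm (m * B * indicator K w)"
    proof (intro always_eventually allI)
      fix w
      show "norm (g w * h w) \<le> norm (m * B * indicator K w)"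
        using order_trans[OF b[of w] abs_ge_self] by (simp only: real_norm_def)
    qed
  qed measurable
  have "\<bar>\<integral>w. g w * h w \<partial>lborel\<bar> \<le> (\<integral>w. m * B * indicator K w \<partial>lborel)"
  proof (rule order_trans[OF integral_abs_bound])
    show "(\<integral>w. \<bar>g w * h w\<bar> \<partial>lborel) \<le> (\<integral>w. m * B * indicator K w \<partial>lborel)"
      by (rule integral_mono[OF integrable_abs[OF i2] i b])
  qed
  then show "\<bar>\<integral>w. g w * h w \<partial>lborel\<bar> \<le> m * B * measure lborel K"
    using borel_closed[OF compact_imp_closed[OF K]] by simp
qed

lemma measurable_reflect:
  "continuous_on UNIV (\<Phi> :: 'a::euclidean_space \<Rightarrow> real) \<Longrightarrow> (\<lambda>w. \<Phi> (z - w)) \<in> borel_measurable borel"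
  by (rule borel_measurable_continuous_onI, erule continuous_on_compose2[of UNIV \<Phi> UNIV "\<lambda>w. z - w"])
    (auto intro!: continuous_intros)

lemma conv_integrable:
  assumes g: "cpt_bdd K m g" and c: "continuous_on UNIV \<Phi>"
  shows "integrable lborel (\<lambda>w. g w * \<Phi> (z - w))"
proof -
  have K: "compact K" using g by (simp add: cpt_bdd_def)
  have "continuous_on K (\<lambda>w. \<Phi> (z - w))"
    by (rule continuous_on_compose2[OF c]) (auto intro!: continuous_intros)
  then obtain B where "\<forall>w\<in>K. \<bar>\<Phi> (z - w)\<bar> \<le> B" using bounded_on_compact[OF K] by blast
  then show ?thesis using integrable_cpt_bdd(1)[OF g measurable_reflect[OF c]] by blast
qed

lemma dir_deriv_Basis:
  fixes f :: "'a::euclidean_space \<Rightarrow> real"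
  assumes "f differentiable (at z)"
  shows "dir_deriv v f z = (\<Sum>b\<in>Basis. (v \<bullet> b) * dir_deriv b f z)"
proof -
  have l: "linear (\<lambda>v. dir_deriv v f z)"
    using has_derivative_linear[OF dir_deriv_has_derivative[OF assms]] .
  have "dir_deriv v f z = dir_deriv (\<Sum>b\<in>Basis. (v \<bullet> b) *\<^sub>R b) f z" by (simp add: euclidean_representation)
  also have "\<dots> = (\<Sum>b\<in>Basis. (v \<bullet> b) * dir_deriv b f z)"
    using linear_sum[OF l, of "\<lambda>b. (v \<bullet> b) *\<^sub>R b" Basis] linear_cmul[OF l] by simp
  finally show ?thesis .
qed

text \<open>The normalised remainder \<open>q\<close> of the first order expansion of \<Phi> tends
  to 0 pointwise and is bounded on the support of the density, so dominated convergence applies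
  under the integral.\<close>

lemma conv_has_derivative:
  fixes \<Phi> :: "'a::euclidean_space \<Rightarrow> real"
  assumes g: "cpt_bdd K m g" and \<Phi>: "smooth_on UNIV \<Phi>"
  shows "(conv g \<Phi> has_derivative (\<lambda>v. conv g (dir_deriv v \<Phi>) z)) (at z)"
proof -
  have K: "compact K" and [measurable]: "g \<in> borel_measurable borel" and gb: "\<And>w. \<bar>g w\<bar> \<le> m * indicator K w"
    using g by (auto simp: cpt_bdd_def)
  \<comment> \<open>The bound \<open>m\<close> can be negative when \<open>K\<close> is
    empty.\<close>
  define m' where "m' = max m 0"
  have g': "cpt_bdd K m' g" unfolding cpt_bdd_def
  proof (intro conjI allI K)
    show "\<bar>g w\<bar> \<le> m' * indicator K w" for w
      by (rule order_trans[OF gb]) (auto simp: m'_def intro!: mult_right_mono)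
  qed measurable
  have c: "continuous_on UNIV \<Phi>" and cd: "\<And>v. continuous_on UNIV (dir_deriv v \<Phi>)"
    using smooth_cont[OF \<Phi>] smooth_cont[OF smooth_on_dir_deriv[OF \<Phi>]] by auto
  note ci = conv_integrable[OF g c] conv_integrable[OF g cd]
  have df: "\<Phi> differentiable (at x)" for x using smooth_diff[OF \<Phi>] .
  let ?D = "\<lambda>v. conv g (dir_deriv v \<Phi>) z"
  have "linear ?D"
  proof (rule linearI)
    fix v w :: 'a and r :: real
    have lin: "linear (\<lambda>v. dir_deriv v \<Phi> x)" for x
      using has_derivative_linear[OF dir_deriv_has_derivative[OF df]] .
    show "?D (v + w) = ?D v + ?D w"
      unfolding conv_def linear_add[OF lin] distrib_left by (rule Bochner_Integration.integral_add[OF ci(2) ci(2)])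
    show "?D (r *\<^sub>R v) = r *\<^sub>R ?D v"
      unfolding conv_def linear_cmul[OF lin] by (simp flip: integral_mult_right_zero add: mult_ac)
  qed
  then have bl: "bounded_linear ?D" by (simp add: linear_conv_bounded_linear)
  \<comment> \<open>Every point at which derivatives of \<Phi> get evaluated when \<open>z\<close>
    is moved by at most 1.\<close>
  define S where "S = (\<lambda>(w, t). z - w + t) ` (K \<times> cball 0 1)"
  have S: "compact S" unfolding S_def
    by (intro compact_continuous_image compact_Times K compact_cball) (auto intro!: continuous_intros simp: split_beta)
  have "continuous_on S (\<lambda>x. \<Sum>b\<in>Basis. \<bar>dir_deriv b \<Phi> x\<bar>)"
    by (intro continuous_on_sum continuous_on_rabs continuous_on_subset[OF cd]) auto
  then obtain B where B0: "\<forall>x\<in>S. \<bar>\<Sum>b\<in>Basis. \<bar>dir_deriv b \<Phi> x\<bar>\<bar> \<le> B" using bounded_on_compact[OF S] by blast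
  have B: "\<bar>dir_deriv h \<Phi> x\<bar> \<le> norm h * B" if "x \<in> S" for h x
  proof -
    have "\<bar>dir_deriv h \<Phi> x\<bar> \<le> (\<Sum>b\<in>Basis. \<bar>(h \<bullet> b) * dir_deriv b \<Phi> x\<bar>)"
      unfolding dir_deriv_Basis[OF df, of h] by (rule sum_abs)
    also have "\<dots> \<le> (\<Sum>b\<in>Basis. norm h * \<bar>dir_deriv b \<Phi> x\<bar>)"
      by (intro sum_mono) (auto simp: abs_mult intro!: mult_right_mono Basis_le_norm)
    also have "\<dots> = norm h * (\<Sum>b\<in>Basis. \<bar>dir_deriv b \<Phi> x\<bar>)" by (simp add: sum_distrib_left)
    also have "\<dots> \<le> norm h * B" using B0 that by (intro mult_left_mono) auto
    finally show ?thesis .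
  qed
  have "(\<lambda>h. norm (conv g \<Phi> (z + h) - conv g \<Phi> z - ?D h) / norm h) \<midarrow>0\<rightarrow> 0"
    unfolding tendsto_at_iff_sequentially comp_def
  proof (intro allI impI)
    fix X :: "nat \<Rightarrow> 'a" assume X: "\<forall>i. X i \<in> UNIV - {0}" "X \<longlonglongrightarrow> 0"
    obtain N where N: "\<And>k. k \<ge> N \<Longrightarrow> norm (X k) < 1"
      using LIMSEQ_D[OF X(2), of 1] by auto
    \<comment> \<open>Dropping finitely many terms keeps all increments within the unit ball, as the
      choice of \<open>S\<close> presupposes.\<close>
    define Y where "Y k = X (k + N)" for k
    have Y: "Y k \<noteq> 0" "norm (Y k) \<le> 1" for k using X(1) N[of "k + N"] by (auto simp: Y_def less_imp_le)
    have Yl: "Y \<longlonglongrightarrow> 0" unfolding Y_def using X(2) by (rule LIMSEQ_ignore_initial_segment)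
    define q where "q k w = (\<Phi> (z + Y k - w) - \<Phi> (z - w) - dir_deriv (Y k) \<Phi> (z - w)) / norm (Y k)" for k w
    have qm: "q k \<in> borel_measurable borel" for k
      unfolding q_def[abs_def] by (intro borel_measurable_divide borel_measurable_diff measurable_reflect c cd borel_measurable_const)
    have qb: "\<bar>q k w\<bar> \<le> 2 * B" if w: "w \<in> K" for k w
    proof -
      have inS: "z - w + t \<in> S" if "norm t \<le> 1" for t
        unfolding S_def using w that by (intro image_eqI[of _ _ "(w, t)"]) auto
      obtain s where s: "0 < s" "s < 1" "\<Phi> (z - w + 1 *\<^sub>R Y k) - \<Phi> (z - w + 0 *\<^sub>R Y k) = (1 - 0) * dir_deriv (Y k) \<Phi> (z - w + s *\<^sub>R Y k)"
        using MVT2[of 0 1 "\<lambda>s. \<Phi> (z - w + s *\<^sub>R Y k)" "\<lambda>s. dir_deriv (Y k) \<Phi> (z - w + s *\<^sub>R Y k)"]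
          line_has_real_derivative[OF df] by auto
      have "norm (s *\<^sub>R Y k) \<le> 1" using s Y(2)[of k] by (simp add: mult_le_one)
      then have "\<bar>\<Phi> (z + Y k - w) - \<Phi> (z - w)\<bar> \<le> norm (Y k) * B"
        using s(3) B[OF inS, of "s *\<^sub>R Y k" "Y k"] by (simp add: algebra_simps)
      moreover have "\<bar>dir_deriv (Y k) \<Phi> (z - w)\<bar> \<le> norm (Y k) * B"
        using B[OF inS, of 0 "Y k"] by simp
      ultimately have "\<bar>\<Phi> (z + Y k - w) - \<Phi> (z - w) - dir_deriv (Y k) \<Phi> (z - w)\<bar> \<le> (2 * B) * norm (Y k)"
        by (simp add: algebra_simps)
      then show ?thesis using Y(1)[of k] by (simp add: q_def divide_le_eq)
    qed
    have ql: "(\<lambda>k. q k w) \<longlonglongrightarrow> 0" for w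
    proof -
      have "(\<lambda>h. norm (\<Phi> (z - w + h) - \<Phi> (z - w) - dir_deriv h \<Phi> (z - w)) / norm h) \<midarrow>0\<rightarrow> 0"
        using dir_deriv_has_derivative[OF df, of "z - w"] unfolding has_derivative_at by blast
      then have "(\<lambda>k. norm (\<Phi> (z - w + Y k) - \<Phi> (z - w) - dir_deriv (Y k) \<Phi> (z - w)) / norm (Y k)) \<longlonglongrightarrow> 0"
        unfolding tendsto_at_iff_sequentially comp_def using Y(1) Yl by auto
      then have "(\<lambda>k. \<bar>q k w\<bar>) \<longlonglongrightarrow> 0" by (simp add: q_def algebra_simps)
      then show ?thesis by (rule tendsto_rabs_zero_cancel)
    qed
    have e: "conv g \<Phi> (z + Y k) - conv g \<Phi> z - ?D (Y k) = norm (Y k) * (\<integral>w. g w * q k w \<partial>lborel)" for k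
    proof -
      have "conv g \<Phi> (z + Y k) - conv g \<Phi> z - ?D (Y k) = (\<integral>w. g w * \<Phi> (z + Y k - w) - g w * \<Phi> (z - w) - g w * dir_deriv (Y k) \<Phi> (z - w) \<partial>lborel)"
        unfolding conv_def by (simp add: Bochner_Integration.integral_diff Bochner_Integration.integrable_diff ci)
      also have "\<dots> = (\<integral>w. norm (Y k) * (g w * q k w) \<partial>lborel)"
        using Y(1)[of k] by (intro Bochner_Integration.integral_cong) (auto simp: q_def right_diff_distrib diff_divide_distrib)
      finally show ?thesis by simp
    qed
    have "(\<lambda>k. \<integral>w. g w * q k w \<partial>lborel) \<longlonglongrightarrow> (\<integral>w. 0 \<partial>(lborel :: 'a measure))"
    proof (rule integral_dominated_convergence[where w="\<lambda>w. m' * (2 * B) * indicator K w"])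
      show "AE x in lborel. (\<lambda>k. g x * q k x) \<longlonglongrightarrow> 0"
        using tendsto_mult_right_zero[OF ql] by (intro always_eventually allI) (auto simp: mult.commute)
      show "AE x in lborel. norm (g x * q k x) \<le> m' * (2 * B) * indicator K x" for k
      proof (intro always_eventually allI)
        fix x
        show "norm (g x * q k x) \<le> m' * (2 * B) * indicator K x"
        proof (cases "x \<in> K")
          case True
          then show ?thesis using g' qb[OF True, of k] by (auto simp: cpt_bdd_def abs_mult m'_def intro!: mult_mono dest!: spec[of _ x])
        next
          case False
          then show ?thesis using gb[of x] by simp
        qed
      qed
    qed (use qm integrable_indicator_compact[OF K] in \<open>auto intro!: borel_measurable_times\<close>)
    then have "(\<lambda>k. \<bar>\<integral>w. g w * q k w \<partial>lborel\<bar>) \<longlonglongrightarrow> 0" using tendsto_rabs_zero by fastforce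
    then have "(\<lambda>k. norm (conv g \<Phi> (z + Y k) - conv g \<Phi> z - ?D (Y k)) / norm (Y k)) \<longlonglongrightarrow> 0"
      unfolding e using Y(1) by (simp add: abs_mult)
    then show "(\<lambda>k. norm (conv g \<Phi> (z + X k) - conv g \<Phi> z - ?D (X k)) / norm (X k)) \<longlonglongrightarrow> 0"
      unfolding Y_def by (rule LIMSEQ_offset)
  qed
  then show ?thesis unfolding has_derivative_at using bl by blast
qed

lemma dir_deriv_conv:
  assumes "cpt_bdd K m g" "smooth_on UNIV \<Phi>"
  shows "dir_deriv v (conv g \<Phi>) = conv g (dir_deriv v \<Phi>)"
  by (rule ext, rule dir_deriv_eq[OF conv_has_derivative[OF assms]])

lemma smooth_conv:
  assumes "cpt_bdd K m g" "smooth_on UNIV \<Phi>"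
  shows "smooth_on UNIV (conv g \<Phi>)"
proof -
  have d: "\<forall>z. conv g \<Phi> differentiable (at z)" if "smooth_on UNIV \<Phi>" for \<Phi>
    using conv_has_derivative[OF assms(1) that] unfolding differentiable_def by blast
  have "Ck_on k UNIV (conv g \<Phi>)" for k using assms(2)
  proof (induction k arbitrary: \<Phi>)
    case 0
    then show ?case using d[OF 0] by (simp add: continuous_at_imp_continuous_on differentiable_imp_continuous_within)
  next
    case (Suc k)
    then show ?case
      using d[OF Suc.prems] Suc.IH[OF smooth_on_dir_deriv[OF Suc.prems]] dir_deriv_conv[OF assms(1) Suc.prems] by simp
  qed
  then show ?thesis by (simp add: smooth_on_def)
qed

lemma smooth_foldr: "smooth_on S f \<Longrightarrow> smooth_on S (foldr dir_deriv ds f)"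
  by (induction ds) (auto intro: smooth_on_dir_deriv)

lemma foldr_conv:
  "cpt_bdd K m g \<Longrightarrow> smooth_on UNIV \<Phi> \<Longrightarrow> foldr dir_deriv ds (conv g \<Phi>) = conv g (foldr dir_deriv ds \<Phi>)"
  by (induction ds) (auto simp: dir_deriv_conv smooth_foldr)

lemma dir_deriv_sum:
  assumes "finite I" "\<And>i. i \<in> I \<Longrightarrow> smooth_on UNIV (f i)"
  shows "dir_deriv v (\<lambda>z. \<Sum>i\<in>I. f i z) = (\<lambda>z. \<Sum>i\<in>I. dir_deriv v (f i) z)"
  by (rule ext, rule dir_deriv_eq[OF has_derivative_sum]) (rule dir_deriv_has_derivative[OF smooth_diff[OF assms(2)]])

lemma foldr_sum:
  assumes "finite I" "\<And>i. i \<in> I \<Longrightarrow> smooth_on UNIV (f i)"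
  shows "foldr dir_deriv ds (\<lambda>z. \<Sum>i\<in>I. f i z) = (\<lambda>z. \<Sum>i\<in>I. foldr dir_deriv ds (f i) z)"
  by (induction ds) (auto simp: dir_deriv_sum[OF assms(1) smooth_foldr] assms)

text \<open>The constant depends on the kernel and the compact sets but not on the density;
  linearity in \<open>m\<close> lets the estimate be rescaled later.\<close>

lemma conv_bound:
  fixes \<Phi> :: "'a::euclidean_space \<Rightarrow> real"
  assumes "compact K" "compact S" "continuous_on UNIV \<Phi>"
  shows "\<exists>C\<ge>0. \<forall>g m z. cpt_bdd K m g \<and> m \<ge> 0 \<and> z \<in> S \<longrightarrow> \<bar>conv g \<Phi> z\<bar> \<le> C * m"
proof -
  have "compact ((\<lambda>(z, w). z - w) ` (S \<times> K))"
    by (intro compact_continuous_image compact_Times assms) (auto intro!: continuous_intros simp: split_beta)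
  then obtain B where B: "\<forall>x\<in>(\<lambda>(z, w). z - w) ` (S \<times> K). \<bar>\<Phi> x\<bar> \<le> B"
    using bounded_on_compact[OF _ continuous_on_subset[OF assms(3) subset_UNIV]] by blast
  have "\<bar>conv g \<Phi> z\<bar> \<le> (\<bar>B\<bar> * measure lborel K) * m" if "cpt_bdd K m g" "m \<ge> 0" "z \<in> S" for g m z
  proof -
    have "\<bar>conv g \<Phi> z\<bar> \<le> m * \<bar>B\<bar> * measure lborel K" unfolding conv_def
      by (rule integrable_cpt_bdd(2)[OF that(1) measurable_reflect[OF assms(3)]]) (use B that in force)
    then show ?thesis by (simp add: mult_ac)
  qed
  then show ?thesis by (intro exI[of _ "\<bar>B\<bar> * measure lborel K"]) auto
qed

section \<open>Interior regularity\<close>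

text \<open>Removing the singularity of the kernel at the origin turns the representation formula into a convolution
  with a smooth function.\<close>

definition off0 :: "'n::finite spacetime \<Rightarrow> real" where
  "off0 z = 1 - step ((1/64 - (sqn z + (snd z)\<^sup>2)) * 128)"
definition ghat :: "'n::finite spacetime \<Rightarrow> real" where
  "ghat z = off0 z * gam 0 z"

lemma smooth_off0: "smooth_on UNIV off0"
  unfolding off0_def[abs_def] power2_eq_square
  by (intro smooth_step_compose smooth_on_diff smooth_on_add smooth_on_mult smooth_snd smooth_sqn smooth_on_const open_UNIV)

lemma smooth_ghat: "smooth_on UNIV (ghat :: 'n::finite spacetime \<Rightarrow> real)"
proof (rule smooth_on_Union)
  fix z :: "'n spacetime"
  show "\<exists>T. open T \<and> z \<in> T \<and> smooth_on T (ghat :: 'n spacetime \<Rightarrow> real)"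
  proof (cases "z = 0")
    case True
    let ?T = "{z::'n spacetime. sqn z + (snd z)\<^sup>2 < 1/128}"
    have T: "open ?T" by (intro open_Collect_less continuous_intros)
    have "smooth_on ?T (ghat :: 'n spacetime \<Rightarrow> real)"
      by (rule smooth_on_cong_imp[OF T _ smooth_on_const[of _ 0]]) (simp add: ghat_def off0_def step_1)
    then show ?thesis using T True by auto
  next
    case False
    have o: "open (- {0::'n spacetime})" by (intro open_Compl closed_singleton)
    have "smooth_on (- {0::'n spacetime}) ghat"
      unfolding ghat_def[abs_def] by (intro smooth_on_mult o smooth_on_subset[OF smooth_off0] smooth_gam_off) auto
    then show ?thesis using o False by auto
  qed
qed

lemma ghat_eq:
  fixes a :: "'n::finite spacetime"
  assumes "sqn a + (snd a)\<^sup>2 > 1/64"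
  shows "ghat a = gam 0 a" "dir_deriv v ghat a = dir_deriv v (gam 0) a"
proof -
  let ?T = "{z::'n spacetime. sqn z + (snd z)\<^sup>2 > 1/64}"
  have T: "open ?T" by (intro open_Collect_less continuous_intros)
  have e: "ghat z = gam 0 z" if "z \<in> ?T" for z using that by (simp add: ghat_def off0_def step_0)
  show "ghat a = gam 0 a" using e assms by simp
  show "dir_deriv v ghat a = dir_deriv v (gam 0) a"
    by (rule dir_deriv_cong_open(2)[OF T _ e smooth_diff[OF smooth_ghat]]) (use assms in simp)
qed

text \<open>Equal to 1 for |x| \<le> 5/8 and |t| \<le> 1/2, and vanishing outside |x| \<le> 7/8, |t|
  \<le> 3/4.\<close>

definition rcut :: "'n::finite spacetime \<Rightarrow> real" where
  "rcut z = step ((49/64 - sqn z) * (64/24)) * step ((9/16 - (snd z)\<^sup>2) * (16/5))"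

lemma smooth_rcut: "smooth_on UNIV rcut"
  unfolding rcut_def[abs_def] power2_eq_square
  by (intro smooth_on_mult smooth_step_compose smooth_on_diff smooth_snd smooth_sqn smooth_on_const open_UNIV)

definition rset :: "'n::finite spacetime set" where "rset = cball 0 (7/8) \<times> {-3/4..3/4}"

lemma compact_rset: "compact rset" unfolding rset_def by (intro compact_Times compact_cball compact_Icc)
lemma rset_Q0: "rset \<subseteq> Q0 1" by (auto simp: rset_def Q0_iff)

lemma rcut_vanish: "z \<notin> rset \<Longrightarrow> rcut z = 0"
proof -
  assume z: "z \<notin> rset"
  have "\<not> (norm (fst z) \<le> 7/8 \<and> \<bar>snd z\<bar> \<le> 3/4)" using z by (cases z) (auto simp: rset_def)
  then consider "norm (fst z) > 7/8" | "\<bar>snd z\<bar> > 3/4" by linarith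
  then show ?thesis
  proof cases
    case 1
    then have "(7/8)\<^sup>2 \<le> (norm (fst z))\<^sup>2" by (intro power_mono) auto
    then have "sqn z \<ge> 49/64" by (simp only: dot_square_norm) (simp add: power2_eq_square)
    then show ?thesis by (simp add: rcut_def step_0)
  next
    case 2
    then have "(3/4)\<^sup>2 \<le> \<bar>snd z\<bar>\<^sup>2" by (intro power_mono) auto
    then have "(snd z)\<^sup>2 \<ge> 9/16" by (simp add: power2_eq_square)
    then show ?thesis by (simp add: rcut_def step_0)
  qed
qed

lemma rcut_const:
  fixes z :: "'n::finite spacetime"
  assumes "sqn z < 25/64" "(snd z)\<^sup>2 < 1/4"
  shows "rcut z = 1" "adj_heat rcut z = 0" "dir_deriv v rcut z = 0"
proof -
  let ?T = "{z::'n spacetime. sqn z < 25/64 \<and> (snd z)\<^sup>2 < 1/4}"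
  have T: "open ?T" by (intro open_Collect_conj open_Collect_less continuous_intros)
  have e: "rcut z = 1" if "z \<in> ?T" for z using that by (simp add: rcut_def step_1)
  show "rcut z = 1" using e assms by simp
  show "adj_heat rcut z = 0" "dir_deriv v rcut z = 0"
    using adj_heat_cong_open[OF T smooth_on_subset[OF smooth_rcut subset_UNIV] e] assms by (simp_all add: adj_heat_const dir_deriv_const)
qed

text \<open>Between the cylinder of radius 1/2 and the region where \<open>rcut\<close> varies there
  is a gap of 5/8 - 1/2 = 1/8 in space or 1/2 - 1/4 = 1/4 in time, enough for \<open>ghat\<close> to
  agree with the kernel.\<close>

lemma rcut_separated:
  fixes a z :: "'n::finite spacetime"
  assumes a: "a \<in> Q0 (1/2)" and z: "\<not> (sqn z < 25/64 \<and> (snd z)\<^sup>2 < 1/4)"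
  shows "sqn (a - z) + (snd (a - z))\<^sup>2 > 1/64"
proof (cases "sqn z < 25/64")
  case False
  have "(5/8)\<^sup>2 \<le> (norm (fst z))\<^sup>2" using False by (simp add: dot_square_norm power2_eq_square)
  then have "5/8 \<le> norm (fst z)" by (rule power2_le_imp_le) simp
  moreover have "norm (fst z) - norm (fst a) \<le> norm (fst (a - z))"
    using norm_triangle_ineq2[of "fst z" "fst a"] by (simp add: norm_minus_commute)
  ultimately have "1/8 < norm (fst (a - z))" using a by (simp add: Q0_iff)
  then have "(1/8)\<^sup>2 < (norm (fst (a - z)))\<^sup>2" by (intro power_strict_mono) auto
  then have "sqn (a - z) > 1/64" by (simp only: dot_square_norm) (simp add: power2_eq_square)
  then show ?thesis by (simp add: add_pos_nonneg less_le_trans)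
next
  case True
  then have "(1/2)\<^sup>2 \<le> \<bar>snd z\<bar>\<^sup>2" using z by (simp add: power2_eq_square)
  then have "1/2 \<le> \<bar>snd z\<bar>" by (rule power2_le_imp_le) simp
  moreover have "\<bar>snd a\<bar> < 1/4" using a by (simp add: Q0_iff power2_eq_square)
  moreover have "\<bar>snd z\<bar> \<le> \<bar>snd a\<bar> + \<bar>snd (a - z)\<bar>" by simp
  ultimately have "1/4 < \<bar>snd (a - z)\<bar>" by linarith
  then have "(1/4)\<^sup>2 < \<bar>snd (a - z)\<bar>\<^sup>2" by (intro power_strict_mono) auto
  then have "(snd (a - z))\<^sup>2 > 1/64" by (simp add: power2_eq_square)
  then show ?thesis by (simp add: add_nonneg_pos less_le_trans)
qed

lemma gam_limit: "X \<longlonglongrightarrow> 0 \<Longrightarrow> (\<lambda>j. gam (X j) a) \<longlonglongrightarrow> gam 0 a"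
proof -
  assume X: "X \<longlonglongrightarrow> 0"
  show ?thesis
  proof (cases "snd a > 0")
    case True
    have "(\<lambda>j. snd a powr (- real CARD('a) / 2) * exp (- (sqn a + X j) / (4 * snd a))) \<longlonglongrightarrow> snd a powr (- real CARD('a) / 2) * exp (- (sqn a + 0) / (4 * snd a))"
      using True by (intro tendsto_intros X) auto
    then show ?thesis using True by (simp add: gam_def)
  qed (simp add: gam_def)
qed

text \<open>The spatial derivative is \<open>gam\<close> times a factor free of \<epsilon>, so the
  limit kernel dominates the regularised ones.\<close>

lemma dir_gam_limit:
  assumes X: "X \<longlonglongrightarrow> 0" "\<And>j. X j > 0" and a: "a \<noteq> 0"
  shows "(\<lambda>j. dir_deriv (space_dir i) (gam (X j)) a) \<longlonglongrightarrow> dir_deriv (space_dir i) (gam 0) a"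
    and "\<bar>dir_deriv (space_dir i) (gam (X j)) a\<bar> \<le> \<bar>dir_deriv (space_dir i) (gam 0) a\<bar>"
proof -
  have "(\<lambda>j. dir_deriv (space_dir i) (gam (X j)) a) \<longlonglongrightarrow> dir_deriv (space_dir i) (gam 0) a \<and>
     \<bar>dir_deriv (space_dir i) (gam (X j)) a\<bar> \<le> \<bar>dir_deriv (space_dir i) (gam 0) a\<bar>"
  proof (cases "snd a > 0")
    case True
    have "\<bar>- (fst a $ i / (2 * snd a)) * gam (X j) a\<bar> \<le> \<bar>- (fst a $ i / (2 * snd a)) * gam 0 a\<bar>"
      unfolding abs_mult using gam_le[of 0 "X j" a] X(2)[of j] gam_nonneg[of "X j" a]
      by (intro mult_left_mono) auto
    then show ?thesis unfolding gam_space[OF True]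
      by (intro conjI tendsto_mult tendsto_const gam_limit X(1))
  next
    case False
    have "dir_deriv (space_dir i) (gam 0) a = 0"
      by (rule dir_deriv_gam_past(1)[OF _ smooth_gam_off[of 0]]) (use a False in \<open>auto simp: open_Compl\<close>)
    moreover have "snd a \<le> 0" using False by simp
    ultimately show ?thesis using dir_deriv_gam_nonpos[OF X(2), where z=a] by simp
  qed
  then show "(\<lambda>j. dir_deriv (space_dir i) (gam (X j)) a) \<longlonglongrightarrow> dir_deriv (space_dir i) (gam 0) a"
    and "\<bar>dir_deriv (space_dir i) (gam (X j)) a\<bar> \<le> \<bar>dir_deriv (space_dir i) (gam 0) a\<bar>" by auto
qed

text \<open>The test function is \<open>rcut\<close> times the kernel with pole \<open>a\<close>.
  The concentration part tends to \<open>v a\<close> times the mass of \<open>conc 1\<close>; the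
  remainder lives where \<open>rcut\<close> varies, away from the pole, and there the kernel may be
  replaced by the smooth \<open>ghat\<close>.\<close>

lemma representation:
  fixes v :: "'n::finite spacetime \<Rightarrow> real"
  assumes v: "continuous_on (Q0 1) v" "weakly_caloric (Q0 1) v" and a: "a \<in> Q0 (1/2)"
  shows "v a * integral\<^sup>L lborel (conc 1 :: 'n spacetime \<Rightarrow> real) =
    - (\<integral>z. v z * (ghat (a - z) * adj_heat rcut z + 2 * (\<Sum>i\<in>UNIV. dir_deriv (space_dir i) rcut z * dir_deriv (space_dir i) ghat (a - z))) \<partial>lborel)"
proof -
  let ?K = "rset :: 'n spacetime set"
  note K = compact_rset[where 'a='n]
  have vK: "continuous_on ?K v" using v(1) rset_Q0 continuous_on_subset by blast
  have vcK: "continuous_on ?K (\<lambda>z. v z * rcut z)"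
    by (intro continuous_on_mult vK continuous_on_subset[OF smooth_cont[OF smooth_rcut]]) auto
  define g where "g = (\<lambda>w. indicator ?K w * (v w * rcut w))"
  obtain Mg where g: "g \<in> borel_measurable borel" and Mg: "\<And>w. \<bar>g w\<bar> \<le> Mg"
    using bounded_measurable_on_compact[OF K vcK] unfolding g_def by blast
  have aI: "sqn a < 25/64" "(snd a)\<^sup>2 < 1/4"
  proof -
    have "(norm (fst a))\<^sup>2 \<le> (1/2)\<^sup>2" using a by (intro power_mono) (auto simp: Q0_iff)
    then show "sqn a < 25/64" by (simp only: dot_square_norm) (simp add: power2_eq_square)
    have "\<bar>snd a\<bar>\<^sup>2 \<le> (1/4)\<^sup>2" using a by (intro power_mono) (auto simp: Q0_iff power2_eq_square)
    then show "(snd a)\<^sup>2 < 1/4" by (simp add: power2_eq_square)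
  qed
  define I :: "'n spacetime set" where "I = Q0 (3/4)"
  have IK: "I \<subseteq> ?K" by (auto simp: I_def rset_def Q0_iff power2_eq_square)
  have aII: "a \<in> I" using a by (auto simp: I_def Q0_iff power2_eq_square)
  have I: "open I" unfolding I_def by (rule parabolic_cylinder_open)
  have "isCont (\<lambda>z. v z * rcut z) a"
    using continuous_on_subset[OF vcK IK] I aII by (simp add: continuous_on_eq_continuous_at)
  moreover have "\<forall>\<^sub>F x in nhds a. v x * rcut x = g x"
    using eventually_nhds_in_open[OF I aII] by (rule eventually_mono) (use IK in \<open>auto simp: g_def\<close>)
  ultimately have gc: "isCont g a" by (simp only: isCont_cong)
  have ga: "g a = v a" using aII IK rcut_const(1)[OF aI] by (auto simp: g_def)
  define X where "X = (\<lambda>j. inverse (real (Suc j)))"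
  have X: "X j > 0" for j by (simp add: X_def)
  have Xl: "X \<longlonglongrightarrow> 0" unfolding X_def by (rule LIMSEQ_inverse_real_of_nat)
  have lim: "(\<lambda>j. \<integral>z. g z * conc (X j) (a - z) \<partial>lborel) \<longlonglongrightarrow> v a * integral\<^sup>L lborel (conc 1 :: 'n spacetime \<Rightarrow> real)"
    using concentration(1)[OF g Mg gc X Xl] unfolding ga .
  have gi: "integrable lborel (\<lambda>z. g z * conc (X j) (a - z))" for j
    by (rule concentration(2)[OF g Mg gc X Xl])
  let ?r = "\<lambda>z. ghat (a - z) * adj_heat rcut z + 2 * (\<Sum>i\<in>UNIV. dir_deriv (space_dir i) rcut z * dir_deriv (space_dir i) ghat (a - z))"
  have id: "(\<integral>z. g z * conc (X j) (a - z) \<partial>lborel) = - (\<integral>z. v z * remainder rcut (X j) a z \<partial>lborel)"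
    and mr: "(\<lambda>z. v z * remainder rcut (X j) a z) \<in> borel_measurable lborel" for j
  proof -
    define \<phi> where "\<phi> = (\<lambda>w. rcut w * gam (X j) (a - w))"
    have \<phi>s: "smooth_on UNIV \<phi>" unfolding \<phi>_def by (intro smooth_on_mult open_UNIV smooth_rcut smooth_gam_reflect X)
    have \<phi>K: "z \<notin> ?K \<Longrightarrow> \<phi> z = 0" for z by (simp add: \<phi>_def rcut_vanish)
    have test: "test_function (Q0 1) \<phi>" by (rule test_functionI[OF \<phi>s K rset_Q0 \<phi>K])
    have i1: "integrable lborel (\<lambda>z. v z * adj_heat \<phi> z)" by (rule integrable_adj_heat[OF \<phi>s K \<phi>K vK])
    have z0: "(\<integral>z. v z * adj_heat \<phi> z \<partial>lborel) = 0" using v(2) test unfolding weakly_caloric_def by blast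
    have e: "v z * remainder rcut (X j) a z = v z * adj_heat \<phi> z - g z * conc (X j) (a - z)" for z
      unfolding \<phi>_def adj_heat_cutoff[OF X smooth_rcut] g_def
      using rcut_vanish[of z] by (cases "z \<in> ?K") (auto simp: algebra_simps)
    show "(\<integral>z. g z * conc (X j) (a - z) \<partial>lborel) = - (\<integral>z. v z * remainder rcut (X j) a z \<partial>lborel)"
      unfolding e Bochner_Integration.integral_diff[OF i1 gi] z0 by simp
    show "(\<lambda>z. v z * remainder rcut (X j) a z) \<in> borel_measurable lborel"
      unfolding e using i1 gi by (intro borel_measurable_diff) auto
  qed
  \<comment> \<open>A majorant of the remainder that does not depend on the regularisation.\<close>
  define b where "b z = \<bar>ghat (a - z)\<bar> * \<bar>adj_heat rcut z\<bar> + 2 * (\<Sum>i\<in>UNIV. \<bar>dir_deriv (space_dir i) rcut z\<bar> * \<bar>dir_deriv (space_dir i) ghat (a - z)\<bar>)" for z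
  have van: "adj_heat rcut z = 0" "dir_deriv w rcut z = 0" if "z \<notin> ?K" for z w
    using adj_heat_vanish[where \<phi>=rcut, OF compact_imp_closed[OF K] rcut_vanish that] dir_deriv_vanish[where \<phi>=rcut, OF compact_imp_closed[OF K] rcut_vanish that] by auto
  have cs: "continuous_on S f" if "smooth_on UNIV f" for S and f :: "'n spacetime \<Rightarrow> real"
    using smooth_on_continuous[OF smooth_on_subset[OF that subset_UNIV]] .
  have cr: "continuous_on S (\<lambda>z. f (a - z))" if "smooth_on UNIV f" for S and f :: "'n spacetime \<Rightarrow> real"
    by (rule continuous_on_compose2[OF smooth_cont[OF that]]) (auto intro!: continuous_intros)
  note sm = smooth_ghat smooth_on_dir_deriv[OF smooth_ghat] smooth_on_dir_deriv[OF smooth_rcut] smooth_on_adj_heat[OF open_UNIV smooth_rcut]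
  have ib: "integrable lborel (\<lambda>z. \<bar>v z\<bar> * b z)"
  proof (rule integrable_times_compact[OF K])
    show "continuous_on ?K (\<lambda>z. \<bar>v z\<bar>)" by (intro continuous_on_rabs vK)
    show "continuous_on ?K b" unfolding b_def
      by (intro continuous_on_add continuous_on_mult continuous_on_sum continuous_on_rabs continuous_on_const cs cr sm)
    show "b z = 0" if "z \<notin> ?K" for z using van[OF that] by (simp add: b_def)
  qed
  have ir: "integrable lborel (\<lambda>z. v z * ?r z)"
  proof (rule integrable_times_compact[OF K vK])
    show "continuous_on ?K ?r"
      by (intro continuous_on_add continuous_on_mult continuous_on_sum continuous_on_const cs cr sm)
    show "?r z = 0" if "z \<notin> ?K" for z using van[OF that] by simp
  qed
  have rl: "(\<lambda>j. remainder rcut (X j) a z) \<longlonglongrightarrow> ?r z" and rb: "\<bar>remainder rcut (X j) a z\<bar> \<le> b z" for j z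
  proof -
    have "(\<lambda>j. remainder rcut (X j) a z) \<longlonglongrightarrow> ?r z \<and> \<bar>remainder rcut (X j) a z\<bar> \<le> b z"
    \<comment> \<open>Where \<open>rcut\<close> is locally constant both sides vanish whatever the
      kernel does; elsewhere \<open>ghat\<close> and \<open>gam 0\<close> coincide.\<close>
    proof (cases "sqn z < 25/64 \<and> (snd z)\<^sup>2 < 1/4")
      case True
      then show ?thesis using rcut_const(2,3)[of z] by (simp add: remainder_def b_def)
    next
      case False
      note sep = rcut_separated[OF a False]
      have an: "a - z \<noteq> 0" using sep by auto
      note gh = ghat_eq[OF sep]
      have 1: "(\<lambda>j. remainder rcut (X j) a z) \<longlonglongrightarrow> ?r z"
        unfolding remainder_def gh
        by (intro tendsto_add tendsto_mult tendsto_sum tendsto_const gam_limit[OF Xl] dir_gam_limit[OF Xl X an])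
      have "\<bar>remainder rcut (X j) a z\<bar> \<le> \<bar>gam (X j) (a - z) * adj_heat rcut z\<bar> 
         + \<bar>2 * (\<Sum>i\<in>UNIV. dir_deriv (space_dir i) rcut z * dir_deriv (space_dir i) (gam (X j)) (a - z))\<bar>"
        unfolding remainder_def by (rule abs_triangle_ineq)
      also have "\<dots> \<le> b z"
      proof -
        have "\<bar>gam (X j) (a - z) * adj_heat rcut z\<bar> \<le> \<bar>ghat (a - z)\<bar> * \<bar>adj_heat rcut z\<bar>"
          unfolding gh abs_mult using gam_le[of 0 "X j" "a - z"] X[of j] gam_nonneg[of "X j" "a - z"]
          by (intro mult_right_mono) auto
        moreover have "\<bar>\<Sum>i\<in>UNIV. dir_deriv (space_dir i) rcut z * dir_deriv (space_dir i) (gam (X j)) (a - z)\<bar>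
          \<le> (\<Sum>i\<in>UNIV. \<bar>dir_deriv (space_dir i) rcut z\<bar> * \<bar>dir_deriv (space_dir i) ghat (a - z)\<bar>)"
          unfolding gh by (rule order_trans[OF sum_abs]) (unfold abs_mult, intro sum_mono mult_left_mono dir_gam_limit(2)[OF Xl X an] abs_ge_zero)
        ultimately show ?thesis unfolding b_def abs_mult[of 2] by simp
      qed
      finally show ?thesis using 1 by blast
    qed
    then show "(\<lambda>j. remainder rcut (X j) a z) \<longlonglongrightarrow> ?r z" and "\<bar>remainder rcut (X j) a z\<bar> \<le> b z" by auto
  qed
  have "(\<lambda>j. \<integral>z. v z * remainder rcut (X j) a z \<partial>lborel) \<longlonglongrightarrow> (\<integral>z. v z * ?r z \<partial>lborel)"
  proof (rule integral_dominated_convergence[OF _ mr ib])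
    show "(\<lambda>z. v z * ?r z) \<in> borel_measurable lborel" using ir by blast
    show "AE x in lborel. (\<lambda>j. v x * remainder rcut (X j) a x) \<longlonglongrightarrow> v x * ?r x"
      by (intro always_eventually allI tendsto_mult tendsto_const rl)
    show "AE x in lborel. norm (v x * remainder rcut (X j) a x) \<le> \<bar>v x\<bar> * b x" for j
      by (intro always_eventually allI) (auto simp: abs_mult intro!: mult_left_mono rb)
  qed
  then have "(\<lambda>j. - (\<integral>z. v z * remainder rcut (X j) a z \<partial>lborel)) \<longlonglongrightarrow> - (\<integral>z. v z * ?r z \<partial>lborel)" by (rule tendsto_minus)
  then show ?thesis using LIMSEQ_unique[OF lim] unfolding id by blast
qed

text \<open>Indexes the summands of the representation formula: \<open>None\<close> for the term
  with the kernel itself, \<open>Some i\<close> for its i-th spatial derivative.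
  \<open>reg_cut\<close> holds the matching factor built from the cutoff, and
  \<open>reg_density\<close> also absorbs the sign and the mass of \<open>conc 1\<close>.\<close>

definition reg_kernel :: "'n::finite option \<Rightarrow> 'n spacetime \<Rightarrow> real" where
  "reg_kernel p = (case p of None \<Rightarrow> ghat | Some i \<Rightarrow> dir_deriv (space_dir i) ghat)"
definition reg_cut :: "'n::finite option \<Rightarrow> 'n spacetime \<Rightarrow> real" where
  "reg_cut p z = (case p of None \<Rightarrow> adj_heat rcut z | Some i \<Rightarrow> 2 * dir_deriv (space_dir i) rcut z)"
definition reg_density :: "('n::finite spacetime \<Rightarrow> real) \<Rightarrow> 'n option \<Rightarrow> 'n spacetime \<Rightarrow> real" where
  "reg_density v p z = - (1 / integral\<^sup>L lborel (conc 1 :: 'n spacetime \<Rightarrow> real)) * (indicator rset z * (v z * reg_cut p z))"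
definition regularize :: "('n::finite spacetime \<Rightarrow> real) \<Rightarrow> 'n spacetime \<Rightarrow> real" where
  "regularize v z = (\<Sum>p\<in>UNIV. conv (reg_density v p) (reg_kernel p) z)"

lemma smooth_reg_kernel: "smooth_on UNIV (reg_kernel p)"
  unfolding reg_kernel_def by (cases p) (auto intro: smooth_ghat smooth_on_dir_deriv)

lemma smooth_reg_cut: "smooth_on UNIV (reg_cut p)"
  unfolding reg_cut_def
  by (cases p) (auto intro!: smooth_on_adj_heat smooth_rcut smooth_on_mult smooth_on_const smooth_on_dir_deriv)

lemma reg_density_bdd:
  "\<exists>c\<ge>0. \<forall>p (v :: 'n::finite spacetime \<Rightarrow> real) M. continuous_on (Q0 1) v \<and> (\<forall>z\<in>Q0 1. \<bar>v z\<bar> \<le> M) \<longrightarrow>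
     cpt_bdd rset (c * M) (reg_density v p)"
proof -
  let ?K = "rset :: 'n spacetime set" and ?G = "integral\<^sup>L lborel (conc 1 :: 'n spacetime \<Rightarrow> real)"
  note K = compact_rset[where 'a='n]
  have G: "?G > 0" by (rule integral_conc_pos)
  have "continuous_on ?K (\<lambda>z. \<Sum>p\<in>UNIV. \<bar>reg_cut p z\<bar>)"
    by (intro continuous_on_sum continuous_on_rabs continuous_on_subset[OF smooth_cont[OF smooth_reg_cut]]) auto
  then obtain B where B: "\<forall>z\<in>?K. \<bar>\<Sum>p\<in>UNIV. \<bar>reg_cut p z\<bar>\<bar> \<le> B" using bounded_on_compact[OF K] by blast
  have Bp: "\<bar>reg_cut p z\<bar> \<le> \<bar>B\<bar>" if "z \<in> ?K" for p z
    using member_le_sum[of p UNIV "\<lambda>p. \<bar>reg_cut p z\<bar>"] B that by fastforce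
  have "cpt_bdd rset (\<bar>B\<bar> / ?G * M) (reg_density v p)"
    if v: "continuous_on (Q0 1) v" "\<forall>z\<in>Q0 1. \<bar>v z\<bar> \<le> M" for p and v :: "'n spacetime \<Rightarrow> real" and M
    unfolding cpt_bdd_def
  proof (intro conjI allI K)
    have "continuous_on ?K (\<lambda>z. v z * reg_cut p z)"
      using continuous_on_subset[OF v(1) rset_Q0] continuous_on_subset[OF smooth_cont[OF smooth_reg_cut]]
      by (intro continuous_on_mult) auto
    from bounded_measurable_on_compact(1)[OF K this]
    show "reg_density v p \<in> borel_measurable borel"
      unfolding reg_density_def[abs_def] by (rule borel_measurable_times[OF borel_measurable_const])
    fix z
    show "\<bar>reg_density v p z\<bar> \<le> \<bar>B\<bar> / ?G * M * indicator rset z"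
    proof (cases "z \<in> rset")
      case True
      then have "\<bar>v z\<bar> \<le> M" using v(2) rset_Q0 by blast
      then have "\<bar>v z\<bar> * \<bar>reg_cut p z\<bar> \<le> M * \<bar>B\<bar>" using Bp[OF True, of p] by (intro mult_mono) auto
      then show ?thesis using True G by (simp add: reg_density_def abs_mult divide_right_mono mult.commute)
    qed (simp add: reg_density_def)
  qed
  moreover have "\<bar>B\<bar> / ?G \<ge> 0" using G by simp
  ultimately show ?thesis by blast
qed

text \<open>The representation formula regrouped into convolutions. \<open>regularize v\<close> is
  smooth everywhere, whereas agreement with \<open>v\<close> is claimed only in the inner
  cylinder.\<close>

lemma regularize_eq:
  fixes v :: "'n::finite spacetime \<Rightarrow> real"
  assumes v: "continuous_on (Q0 1) v" "\<forall>z\<in>Q0 1. \<bar>v z\<bar> \<le> M" "weakly_caloric (Q0 1) v"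
  shows "smooth_on UNIV (regularize v)" and "a \<in> Q0 (1/2) \<Longrightarrow> regularize v a = v a"
proof -
  obtain c where cb: "\<And>p. cpt_bdd rset (c * M) (reg_density v p)" using reg_density_bdd v(1,2) by blast
  show "smooth_on UNIV (regularize v)" unfolding regularize_def[abs_def]
    by (intro smooth_on_sum open_UNIV smooth_conv[OF cb] smooth_reg_kernel)
  assume a: "a \<in> Q0 (1/2)"
  let ?G = "integral\<^sup>L lborel (conc 1 :: 'n spacetime \<Rightarrow> real)"
  have G: "?G > 0" by (rule integral_conc_pos)
  let ?r = "\<lambda>z. ghat (a - z) * adj_heat rcut z + 2 * (\<Sum>i\<in>UNIV. dir_deriv (space_dir i) rcut z * dir_deriv (space_dir i) ghat (a - z))"
  have opt: "(\<Sum>p\<in>UNIV. F p) = F None + (\<Sum>i\<in>UNIV. F (Some i))" for F :: "'n option \<Rightarrow> real"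
    unfolding UNIV_option_conv by (simp add: sum.reindex)
  have van: "adj_heat rcut z = 0" "dir_deriv w rcut z = 0" if "z \<notin> rset" for z w
    using adj_heat_vanish[where \<phi>=rcut, OF compact_imp_closed[OF compact_rset] rcut_vanish that] dir_deriv_vanish[where \<phi>=rcut, OF compact_imp_closed[OF compact_rset] rcut_vanish that] by auto
  have "regularize v a = (\<integral>z. (\<Sum>p\<in>UNIV. reg_density v p z * reg_kernel p (a - z)) \<partial>lborel)"
    unfolding regularize_def conv_def
    by (rule Bochner_Integration.integral_sum[symmetric]) (rule conv_integrable[OF cb smooth_cont[OF smooth_reg_kernel]])
  also have "\<dots> = (\<integral>z. - (1 / ?G) * (v z * ?r z) \<partial>lborel)"
  proof (rule Bochner_Integration.integral_cong[OF refl])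
    fix z
    show "(\<Sum>p\<in>UNIV. reg_density v p z * reg_kernel p (a - z)) = - (1 / ?G) * (v z * ?r z)"
      unfolding opt reg_density_def reg_cut_def reg_kernel_def
      using van[of z] by (cases "z \<in> rset") (simp_all add: sum_distrib_left algebra_simps)
  qed
  also have "\<dots> = (1 / ?G) * (- (\<integral>z. v z * ?r z \<partial>lborel))" by simp
  also have "\<dots> = v a" unfolding representation[OF v(1,3) a, symmetric] using G by simp
  finally show "regularize v a = v a" .
qed

lemma regularize_bound:
  "\<exists>C\<ge>0. \<forall>(v :: 'n::finite spacetime \<Rightarrow> real) M. continuous_on (Q0 1) v \<and> (\<forall>z\<in>Q0 1. \<bar>v z\<bar> \<le> M) \<longrightarrow>
     (\<forall>z\<in>Q0 (1/2). \<bar>foldr dir_deriv ds (regularize v) z\<bar> \<le> C * M)"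
proof -
  obtain c where c: "c \<ge> 0" "\<And>p (v :: 'n::finite spacetime \<Rightarrow> real) M. continuous_on (Q0 1) v \<and> (\<forall>z\<in>Q0 1. \<bar>v z\<bar> \<le> M) \<Longrightarrow>
     cpt_bdd rset (c * M) (reg_density v p)" using reg_density_bdd[where 'n='n] by blast
  let ?S = "cball 0 1 \<times> {-1..1} :: 'n spacetime set"
  have S: "compact ?S" by (intro compact_Times compact_cball compact_Icc)
  have "\<exists>C\<ge>0. \<forall>g m z. cpt_bdd rset m g \<and> m \<ge> 0 \<and> z \<in> ?S \<longrightarrow> \<bar>conv g (foldr dir_deriv ds (reg_kernel p)) z\<bar> \<le> C * m" for p :: "'n option"
    by (rule conv_bound[OF compact_rset S smooth_cont[OF smooth_foldr[OF smooth_reg_kernel]]])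
  then obtain Cf where Cf: "\<And>p. Cf p \<ge> 0" "\<And>p g m z. cpt_bdd rset m g \<and> m \<ge> 0 \<and> z \<in> ?S \<longrightarrow> \<bar>conv g (foldr dir_deriv ds (reg_kernel (p :: 'n option))) z\<bar> \<le> Cf p * m"
    by metis
  have "\<bar>foldr dir_deriv ds (regularize v) z\<bar> \<le> ((\<Sum>p\<in>UNIV. Cf p) * c) * M"
    if v: "continuous_on (Q0 1) v" "\<forall>z\<in>Q0 1. \<bar>v z\<bar> \<le> M" and z: "z \<in> Q0 (1/2)" for v :: "'n spacetime \<Rightarrow> real" and M z
  proof -
    have cb: "cpt_bdd rset (c * M) (reg_density v p)" for p using c(2) v by blast
    have "(0::'n spacetime) \<in> Q0 1" by (simp add: Q0_iff)
    then have "\<bar>v 0\<bar> \<le> M" using v(2) by blast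
    then have M: "c * M \<ge> 0" using c(1) by simp
    have zS: "z \<in> ?S" using z by (cases z) (auto simp: Q0_iff power2_eq_square)
    have "foldr dir_deriv ds (regularize v) z = (\<Sum>p\<in>UNIV. conv (reg_density v p) (foldr dir_deriv ds (reg_kernel p)) z)"
      unfolding regularize_def[abs_def]
      by (simp add: foldr_sum smooth_conv[OF cb smooth_reg_kernel] foldr_conv[OF cb smooth_reg_kernel])
    also have "\<bar>\<dots>\<bar> \<le> (\<Sum>p\<in>UNIV. Cf p * (c * M))"
      by (rule order_trans[OF sum_abs]) (intro sum_mono, use Cf(2) cb M zS in blast)
    finally show ?thesis by (simp add: sum_distrib_right mult.assoc)
  qed
  moreover have "(\<Sum>p\<in>UNIV. Cf p) * c \<ge> 0" using Cf(1) c(1) by (intro mult_nonneg_nonneg sum_nonneg) auto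
  ultimately show ?thesis by blast
qed

lemma interior_regularity:
  "\<exists>C\<ge>0. \<forall>(v :: 'n::finite spacetime \<Rightarrow> real) M. continuous_on (Q0 1) v \<and> (\<forall>z\<in>Q0 1. \<bar>v z\<bar> \<le> M) \<and> weakly_caloric (Q0 1) v \<longrightarrow>
     smooth_on (Q0 (1/2)) v \<and> (\<forall>z\<in>Q0 (1/2). \<bar>dir_deriv time_dir v z\<bar> \<le> C * M \<and> 
        (\<forall>i. \<bar>dir_deriv (space_dir i) v z\<bar> \<le> C * M) \<and> (\<forall>i j. \<bar>dir_deriv (space_dir i) (dir_deriv (space_dir j) v) z\<bar> \<le> C * M))"
proof -
  obtain Cf where Cf: "\<And>ds. Cf ds \<ge> 0" "\<And>ds (v :: 'n::finite spacetime \<Rightarrow> real) M. continuous_on (Q0 1) v \<and> (\<forall>z\<in>Q0 1. \<bar>v z\<bar> \<le> M) \<longrightarrow>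
     (\<forall>z\<in>Q0 (1/2). \<bar>foldr dir_deriv ds (regularize v) z\<bar> \<le> Cf ds * M)" using regularize_bound[where 'n='n] by metis
  \<comment> \<open>Only finitely many derivatives occur, so the sum of their constants is a common
    one.\<close>
  define Ds :: "'n spacetime list set" where "Ds = insert [time_dir] (range (\<lambda>i. [space_dir i]) \<union> range (\<lambda>(i, j). [space_dir i, space_dir j]))"
  have fin: "finite Ds" by (simp add: Ds_def)
  define C where "C = (\<Sum>ds\<in>Ds. Cf ds)"
  have CfC: "Cf ds \<le> C" if "ds \<in> Ds" for ds unfolding C_def by (rule member_le_sum[OF that]) (auto simp: Cf fin)
  have C0: "C \<ge> 0" unfolding C_def by (intro sum_nonneg Cf)
  have "smooth_on (Q0 (1/2)) v \<and> (\<forall>z\<in>Q0 (1/2). \<bar>dir_deriv time_dir v z\<bar> \<le> C * M \<and> 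
        (\<forall>i. \<bar>dir_deriv (space_dir i) v z\<bar> \<le> C * M) \<and> (\<forall>i j. \<bar>dir_deriv (space_dir i) (dir_deriv (space_dir j) v) z\<bar> \<le> C * M))"
    if v: "continuous_on (Q0 1) v" "\<forall>z\<in>Q0 1. \<bar>v z\<bar> \<le> M" "weakly_caloric (Q0 1) v" for v :: "'n spacetime \<Rightarrow> real" and M
  proof -
    let ?Q = "Q0 (1/2) :: 'n spacetime set"
    have Q: "open ?Q" by (rule parabolic_cylinder_open)
    note re = regularize_eq[OF v]
    have sQ: "smooth_on ?Q (regularize v)" using smooth_on_subset[OF re(1) subset_UNIV] .
    have sm: "smooth_on ?Q v" by (rule smooth_on_cong_imp[OF Q re(2) sQ])
    have d1: "dir_deriv w (regularize v) z = dir_deriv w v z" if "z \<in> ?Q" for w z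
      by (rule dir_deriv_cong_open(2)[OF Q that re(2) smooth_diff[OF re(1)]])
    have d2: "dir_deriv w (dir_deriv w' (regularize v)) z = dir_deriv w (dir_deriv w' v) z" if "z \<in> ?Q" for w w' z
      by (rule dir_deriv_cong_open(2)[OF Q that d1 smooth_diff[OF smooth_on_dir_deriv[OF re(1)]]])
    have "(0::'n spacetime) \<in> Q0 1" by (simp add: Q0_iff)
    then have "\<bar>v 0\<bar> \<le> M" using v(2) by blast
    then have M: "M \<ge> 0" by linarith
    have b: "\<bar>foldr dir_deriv ds (regularize v) z\<bar> \<le> C * M" if "z \<in> ?Q" "ds \<in> Ds" for z ds
      using Cf(2)[of v M ds] v that mult_right_mono[OF CfC[OF that(2)] M] by fastforce
    have "\<bar>dir_deriv time_dir v z\<bar> \<le> C * M" if "z \<in> ?Q" for z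
      using b[OF that, of "[time_dir]"] d1[OF that] by (simp add: Ds_def)
    moreover have "\<bar>dir_deriv (space_dir i) v z\<bar> \<le> C * M" if "z \<in> ?Q" for z i
      using b[OF that, of "[space_dir i]"] d1[OF that] by (simp add: Ds_def)
    moreover have "\<bar>dir_deriv (space_dir i) (dir_deriv (space_dir j) v) z\<bar> \<le> C * M" if "z \<in> ?Q" for z i j
    proof -
      have "[space_dir i, space_dir j] \<in> Ds"
        unfolding Ds_def by (intro insertI2 UnI2 range_eqI[of _ _ "(i, j)"]) simp
      from b[OF that this] show ?thesis using d2[OF that] by simp
    qed
    ultimately show ?thesis using sm by blast
  qed
  then show ?thesis using C0 by blast
qed

section \<open>Estimates in the positivity set\<close>

lemma test_function_mono: "test_function \<Omega>' \<phi> \<Longrightarrow> \<Omega>' \<subseteq> \<Omega> \<Longrightarrow> test_function \<Omega> \<phi>"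
  unfolding test_function_def by blast

lemma heat_ineq_mono: "heat_ineq \<Omega> u k \<Longrightarrow> \<Omega>' \<subseteq> \<Omega> \<Longrightarrow> heat_ineq \<Omega>' u k"
  unfolding heat_ineq_def using test_function_mono by blast

text \<open>All that the estimates use of \<open>f\<close>: the two-sided inequality in the whole
  cylinder, and the exact constant against test functions supported in the positivity set.\<close>

definition admissible :: "real \<Rightarrow> ('n::finite spacetime \<Rightarrow> real) \<Rightarrow> real \<Rightarrow> bool" where
  "admissible K u c \<longleftrightarrow> continuous_on (Q0 1) u \<and> (\<forall>z\<in>Q0 1. 0 \<le> u z \<and> u z \<le> K) \<and> heat_ineq (Q0 1) u K
     \<and> \<bar>c\<bar> \<le> K \<and> (\<forall>\<phi>. test_function (positivity_set u) \<phi> \<longrightarrow> (\<integral>z. u z * adj_heat \<phi> z \<partial>lborel) = c * integral\<^sup>L lborel \<phi>)"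

definition radii :: "('n::finite spacetime \<Rightarrow> real) \<Rightarrow> 'n spacetime \<Rightarrow> real set" where
  "radii u z = {\<rho>. \<rho> > 0 \<and> parabolic_cylinder \<rho> z \<subseteq> positivity_set u}"

lemma positivity_subset: "positivity_set u \<subseteq> Q0 1" by (auto simp: positivity_set_def)

lemma open_positivity: "continuous_on (Q0 1) u \<Longrightarrow> open (positivity_set u)"
proof -
  assume c: "continuous_on (Q0 1) u"
  have "open (Q0 1 \<inter> u -` {0<..})" by (rule continuous_open_preimage[OF c parabolic_cylinder_open open_greaterThan])
  moreover have "Q0 1 \<inter> u -` {0<..} = positivity_set u" by (auto simp: positivity_set_def)
  ultimately show ?thesis by simp
qed

lemma center_in_cylinder: "r > 0 \<Longrightarrow> z \<in> parabolic_cylinder r z" by (simp add: parabolic_cylinder_def)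

lemma cylinder_subset_ball:
  fixes z :: "'n::finite spacetime"
  assumes "\<epsilon> > 0"
  shows "\<exists>\<rho>>0. parabolic_cylinder \<rho> z \<subseteq> ball z \<epsilon>"
proof -
  define \<rho> where "\<rho> = min 1 (\<epsilon> / 2)"
  have \<rho>: "\<rho> > 0" "\<rho> \<le> 1" "\<rho> \<le> \<epsilon> / 2" using assms by (auto simp: \<rho>_def)
  have "w \<in> ball z \<epsilon>" if w: "w \<in> parabolic_cylinder \<rho> z" for w
  proof -
    have "\<rho>\<^sup>2 \<le> \<rho>" using \<rho> by (simp add: power2_eq_square mult_left_le_one_le)
    then have "norm (fst w - fst z) + \<bar>snd w - snd z\<bar> < \<epsilon>" using w \<rho> by (auto simp: parabolic_cylinder_def)
    moreover have "norm (w - z) \<le> norm (fst w - fst z) + \<bar>snd w - snd z\<bar>"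
      using norm_Pair_le[of "fst w - fst z" "snd w - snd z"] by (cases w; cases z) simp
    ultimately show ?thesis by (simp add: dist_norm norm_minus_commute)
  qed
  then show ?thesis using \<rho>(1) by blast
qed

text \<open>The real supremum is informative only for a nonempty set bounded above, so both
  properties have to accompany \<delta>.\<close>

lemma radii_props:
  fixes u :: "'n::finite spacetime \<Rightarrow> real"
  assumes u: "continuous_on (Q0 1) u" and z: "z \<in> positivity_set u"
  shows "radii u z \<noteq> {}" "bdd_above (radii u z)" "0 < Sup (radii u z)"
proof -
  obtain \<epsilon> where e: "\<epsilon> > 0" "ball z \<epsilon> \<subseteq> positivity_set u"
    using open_positivity[OF u] z open_contains_ball by blast
  then obtain \<rho> where r: "\<rho> > 0" "\<rho> \<in> radii u z" using cylinder_subset_ball[OF e(1), of z] unfolding radii_def by blast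
  then show ne: "radii u z \<noteq> {}" by blast
  have "\<rho> \<le> 2" if "\<rho> \<in> radii u z" for \<rho>
  proof (rule ccontr)
    assume a: "\<not> \<rho> \<le> 2"
    then have "2\<^sup>2 < \<rho>\<^sup>2" by (intro power_strict_mono) auto
    then have r: "4 < \<rho>\<^sup>2" by simp
    \<comment> \<open>A radius above 2 reaches times 2 before and 2 after the centre, which cannot
      both lie in (-1, 1).\<close>
    have "z + (0, 2) \<in> parabolic_cylinder \<rho> z" "z + (0, -2) \<in> parabolic_cylinder \<rho> z"
      using a r by (auto simp: parabolic_cylinder_def)
    then have "z + (0, 2) \<in> Q0 1" "z + (0, -2) \<in> Q0 1" using that positivity_subset[of u] unfolding radii_def by blast+
    then show False by (simp add: Q0_iff)
  qed
  then show b: "bdd_above (radii u z)" by (rule bdd_aboveI)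
  show "0 < Sup (radii u z)" using cSup_upper[OF r(2) b] r(1) by linarith
qed

lemma radii_less:
  assumes "continuous_on (Q0 1) u" "z \<in> positivity_set u" "0 < \<rho>" "\<rho> < Sup (radii u z)"
  shows "\<rho> \<in> radii u z"
proof -
  obtain \<rho>' where "\<rho>' \<in> radii u z" "\<rho> < \<rho>'"
    using less_cSupD[OF radii_props(1)[OF assms(1,2)] assms(4)] by blast
  then show ?thesis using cylinder_mono[of \<rho> \<rho>' z] assms(3) unfolding radii_def by auto
qed

text \<open>If \<delta> is not small, the trivial bound \<open>K\<close> is already quadratic at a
  fixed radius. If it is small, some zero lies within parabolic distance 2 \<delta>, and the growth
  bound at that zero covers a cylinder around \<open>z0\<close>.\<close>

lemma cylinder_choice:
  assumes K: "K > 0"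
  shows "\<exists>A>0. \<forall>(u :: 'n::finite spacetime \<Rightarrow> real) c. admissible K u c \<longrightarrow> (\<forall>z0 \<in> positivity_set u \<inter> Q0 (1/2).
    \<exists>\<rho>. 0 < \<rho> \<and> \<rho> \<le> Sup (radii u z0) \<and> parabolic_cylinder \<rho> z0 \<subseteq> positivity_set u \<and> (\<forall>z\<in>parabolic_cylinder \<rho> z0. u z \<le> A * \<rho>\<^sup>2))"
proof -
  obtain A where A: "A > 0" "\<forall>(u::'n::finite spacetime \<Rightarrow> real) z0.
     continuous_on (parabolic_cylinder (1/4) z0) u \<and> (\<forall>z\<in>parabolic_cylinder (1/4) z0. 0 \<le> u z \<and> u z \<le> K) \<and> u z0 = 0
       \<and> heat_ineq (parabolic_cylinder (1/4) z0) u K \<longrightarrow>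
     (\<forall>r. 0 < r \<and> r \<le> 1/4 \<longrightarrow> (\<forall>z\<in>parabolic_cylinder r z0. u z \<le> A * r\<^sup>2))"
    using quadratic_growth[of "1/4" K, where 'n='n] K by auto
  \<comment> \<open>1024 is 32^2, for the fixed radius 1/32; 64 A (\<delta>/2)^2 = A (4 \<delta>)^2,
    for passing from radius 4 \<delta> at the zero to \<delta>/2 at \<open>z0\<close>.\<close>
  define A' where "A' = max (64 * A) (1024 * K)"
  have "\<exists>\<rho>. 0 < \<rho> \<and> \<rho> \<le> Sup (radii u z0) \<and> parabolic_cylinder \<rho> z0 \<subseteq> positivity_set u \<and> (\<forall>z\<in>parabolic_cylinder \<rho> z0. u z \<le> A' * \<rho>\<^sup>2)"
    if ad: "admissible K u c" and z0: "z0 \<in> positivity_set u" "z0 \<in> Q0 (1/2)" for u :: "'n spacetime \<Rightarrow> real" and c z0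
  proof -
    have u: "continuous_on (Q0 1) u" "\<forall>z\<in>Q0 1. 0 \<le> u z \<and> u z \<le> K" "heat_ineq (Q0 1) u K" using ad by (auto simp: admissible_def)
    define \<delta> where "\<delta> = Sup (radii u z0)"
    have \<delta>: "\<delta> > 0" using radii_props(3)[OF u(1) z0(1)] by (simp add: \<delta>_def)
    show ?thesis
    proof (cases "\<delta> < 1/16")
      case False
      have "1/32 \<in> radii u z0" by (rule radii_less[OF u(1) z0(1)]) (use False in \<open>auto simp: \<delta>_def\<close>)
      then have P: "parabolic_cylinder (1/32) z0 \<subseteq> positivity_set u" by (simp add: radii_def)
      have "u z \<le> A' * (1/32)\<^sup>2" if "z \<in> parabolic_cylinder (1/32) z0" for z
      proof -
        have "z \<in> Q0 1" using P positivity_subset[of u] that by blast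
        then have "u z \<le> K" using u(2) by blast
        moreover have "1024 * K \<le> A'" by (simp add: A'_def)
        ultimately show ?thesis by (simp add: power2_eq_square)
      qed
      then show ?thesis using P False by (intro exI[of _ "1/32"]) (auto simp: \<delta>_def)
    next
      case True
      have d2: "\<delta>\<^sup>2 < 1/256" using power_strict_mono[OF True, of 2] \<delta> by (simp add: power2_eq_square)
      have z0b: "norm (fst z0) < 1/2" "\<bar>snd z0\<bar> < 1/4" using z0(2) by (auto simp: Q0_iff power2_eq_square)
      \<comment> \<open>Being above the supremum, this radius produces a cylinder that leaves the
        positivity set; its point \<open>z1\<close> outside will turn out to be a genuine zero,
        because it still lies in the unit cylinder.\<close>
      have "2 * \<delta> \<notin> radii u z0"
        using cSup_upper[OF _ radii_props(2)[OF u(1) z0(1)], of "2 * \<delta>"] \<delta> unfolding \<delta>_def[symmetric] by auto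
      then obtain z1 where z1: "z1 \<in> parabolic_cylinder (2 * \<delta>) z0" "z1 \<notin> positivity_set u"
        using \<delta> by (auto simp: radii_def)
      have z1b: "norm (fst z1 - fst z0) < 2 * \<delta>" "\<bar>snd z1 - snd z0\<bar> < 4 * \<delta>\<^sup>2"
        using z1(1) by (auto simp: parabolic_cylinder_def power_mult_distrib)
      have n1: "norm (fst z1) \<le> norm (fst z0) + norm (fst z1 - fst z0)" by (rule norm_triangle_sub)
      \<comment> \<open>Room count: 1/2 + 1/8 + 1/4 < 1 in space and 1/4 + 1/64 + 1/16 < 1 in
        time.\<close>
      have Q: "parabolic_cylinder (1/4) z1 \<subseteq> Q0 1"
      proof
        fix z assume "z \<in> parabolic_cylinder (1/4) z1"
        then have zb: "norm (fst z - fst z1) < 1/4" "\<bar>snd z - snd z1\<bar> < 1/16" by (auto simp: parabolic_cylinder_def power2_eq_square)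
        have "norm (fst z) \<le> norm (fst z1) + norm (fst z - fst z1)" by (rule norm_triangle_sub)
        then have "norm (fst z) < 1" using zb n1 z1b z0b True by linarith
        moreover have "\<bar>snd z\<bar> < 1" using zb z1b z0b d2 by linarith
        ultimately show "z \<in> Q0 1" by (simp add: Q0_iff)
      qed
      have "z1 \<in> Q0 1" using Q center_in_cylinder[of "1/4" z1] by auto
      then have u0: "u z1 = 0" using z1(2) u(2) by (force simp: positivity_set_def)
      have growth: "u z \<le> A * (4 * \<delta>)\<^sup>2" if "z \<in> parabolic_cylinder (4 * \<delta>) z1" for z
      proof -
        have "\<forall>z\<in>parabolic_cylinder (1/4) z1. 0 \<le> u z \<and> u z \<le> K" using u(2) Q by blast
        then have "\<forall>r. 0 < r \<and> r \<le> 1/4 \<longrightarrow> (\<forall>z\<in>parabolic_cylinder r z1. u z \<le> A * r\<^sup>2)"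
          using A(2)[THEN spec[of _ u], THEN spec[of _ z1]] continuous_on_subset[OF u(1) Q] u0 heat_ineq_mono[OF u(3) Q] by blast
        moreover have "0 < 4 * \<delta>" "4 * \<delta> \<le> 1/4" using True \<delta> by auto
        ultimately show ?thesis using that by blast
      qed
      have "\<delta> / 2 \<in> radii u z0" by (rule radii_less[OF u(1) z0(1)]) (use \<delta> in \<open>auto simp: \<delta>_def[symmetric]\<close>)
      then have P: "parabolic_cylinder (\<delta> / 2) z0 \<subseteq> positivity_set u" by (simp add: radii_def)
      have "u z \<le> A' * (\<delta> / 2)\<^sup>2" if z: "z \<in> parabolic_cylinder (\<delta> / 2) z0" for z
      proof -
        have zb: "norm (fst z - fst z0) < \<delta> / 2" "\<bar>snd z - snd z0\<bar> < \<delta>\<^sup>2 / 4"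
          using z by (auto simp: parabolic_cylinder_def power_divide)
        have "norm (fst z - fst z1) \<le> norm (fst z - fst z0) + norm (fst z1 - fst z0)"
          using norm_triangle_ineq4[of "fst z - fst z0" "fst z1 - fst z0"] by simp
        then have "norm (fst z - fst z1) < 4 * \<delta>" using zb z1b \<delta> by linarith
        moreover have "\<bar>snd z - snd z1\<bar> < 16 * \<delta>\<^sup>2" using zb z1b \<delta> by linarith
        ultimately have "z \<in> parabolic_cylinder (4 * \<delta>) z1" by (simp add: parabolic_cylinder_def power_mult_distrib)
        from growth[OF this] have "u z \<le> (64 * A) * (\<delta> / 2)\<^sup>2" by (simp add: power_mult_distrib power_divide)
        also have "\<dots> \<le> A' * (\<delta> / 2)\<^sup>2" by (intro mult_right_mono) (auto simp: A'_def)
        finally show ?thesis .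
      qed
      then show ?thesis using P \<delta> by (intro exI[of _ "\<delta> / 2"]) (auto simp: \<delta>_def[symmetric])
    qed
  qed
  moreover have "A' > 0" using A K by (simp add: A'_def less_max_iff_disj)
  ultimately show ?thesis by blast
qed

text \<open>Rescaled to the unit cylinder, \<open>u\<close> minus a linear function of time is
  caloric and of size (A + K) \<rho>^2. Undoing the scaling divides the time derivative and the
  Hessian by \<rho>^2 and the gradient by \<rho>, which gives exactly the stated powers.\<close>

lemma scaled_estimates:
  assumes K: "K > 0" and A: "A > 0"
  shows "\<exists>C>0. \<forall>(u :: 'n::finite spacetime \<Rightarrow> real) c z0 \<rho>. admissible K u c \<and> 0 < \<rho> \<and> parabolic_cylinder \<rho> z0 \<subseteq> positivity_set u
     \<and> (\<forall>z\<in>parabolic_cylinder \<rho> z0. u z \<le> A * \<rho>\<^sup>2) \<longrightarrow>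
     smooth_on (parabolic_cylinder (\<rho>/2) z0) u \<and> (\<forall>z\<in>parabolic_cylinder (\<rho>/2) z0. \<bar>dir_deriv time_dir u z\<bar> \<le> C \<and>
       (\<forall>i. \<bar>dir_deriv (space_dir i) u z\<bar> \<le> C * \<rho>) \<and> (\<forall>i j. \<bar>dir_deriv (space_dir i) (dir_deriv (space_dir j) u) z\<bar> \<le> C))"
proof -
  obtain C where C: "C \<ge> 0" "\<And>(v :: 'n::finite spacetime \<Rightarrow> real) M. continuous_on (Q0 1) v \<and> (\<forall>z\<in>Q0 1. \<bar>v z\<bar> \<le> M) \<and> weakly_caloric (Q0 1) v \<Longrightarrow>
     smooth_on (Q0 (1/2)) v \<and> (\<forall>z\<in>Q0 (1/2). \<bar>dir_deriv time_dir v z\<bar> \<le> C * M \<and> 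
        (\<forall>i. \<bar>dir_deriv (space_dir i) v z\<bar> \<le> C * M) \<and> (\<forall>i j. \<bar>dir_deriv (space_dir i) (dir_deriv (space_dir j) v) z\<bar> \<le> C * M))"
    using interior_regularity[where 'n='n] by blast
  \<comment> \<open>The extra \<open>K\<close> pays for the constant that the subtracted linear
    function contributes to the time derivative.\<close>
  define D where "D = C * (A + K) + K"
  have "smooth_on (parabolic_cylinder (\<rho>/2) z0) u \<and> (\<forall>z\<in>parabolic_cylinder (\<rho>/2) z0. \<bar>dir_deriv time_dir u z\<bar> \<le> D \<and>
       (\<forall>i. \<bar>dir_deriv (space_dir i) u z\<bar> \<le> D * \<rho>) \<and> (\<forall>i j. \<bar>dir_deriv (space_dir i) (dir_deriv (space_dir j) u) z\<bar> \<le> D))"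
    if ad: "admissible K u c" and r: "\<rho> > 0" and sub: "parabolic_cylinder \<rho> z0 \<subseteq> positivity_set u"
      and ub: "\<forall>z\<in>parabolic_cylinder \<rho> z0. u z \<le> A * \<rho>\<^sup>2" for u :: "'n spacetime \<Rightarrow> real" and c z0 \<rho>
  proof -
    have u: "continuous_on (Q0 1) u" "\<forall>z\<in>Q0 1. 0 \<le> u z \<and> u z \<le> K" "\<bar>c\<bar> \<le> K"
      and uc: "\<And>\<phi>. test_function (positivity_set u) \<phi> \<Longrightarrow> (\<integral>z. u z * adj_heat \<phi> z \<partial>lborel) = c * integral\<^sup>L lborel \<phi>"
      using ad by (auto simp: admissible_def)
    let ?P = "paff z0 \<rho> (\<rho>\<^sup>2)"
    define v where "v = (\<lambda>z. u (?P z) - c * \<rho>\<^sup>2 * snd z)"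
    have inP: "?P z \<in> parabolic_cylinder \<rho> z0" if "z \<in> Q0 1" for z using paff_in_cylinder[OF r, of z0 z 1] that by simp
    have inQ: "?P z \<in> Q0 1" if "z \<in> Q0 1" for z using inP[OF that] sub positivity_subset[of u] by blast
    have cu: "continuous_on (Q0 1) (\<lambda>z. u (?P z))"
      by (rule continuous_on_compose2[OF u(1) continuous_paff]) (use inQ in auto)
    have v1: "continuous_on (Q0 1) v" unfolding v_def by (intro continuous_on_diff cu continuous_intros)
    have v2: "\<bar>v z\<bar> \<le> (A + K) * \<rho>\<^sup>2" if "z \<in> Q0 1" for z
    proof -
      have "0 \<le> u (?P z)" "u (?P z) \<le> A * \<rho>\<^sup>2" using inP[OF that] inQ[OF that] u(2) ub by blast+
      moreover have "\<bar>c * \<rho>\<^sup>2 * snd z\<bar> \<le> K * \<rho>\<^sup>2 * 1"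
        unfolding abs_mult using u(3) that K by (intro mult_mono) (auto simp: Q0_iff)
      ultimately show ?thesis unfolding v_def by (simp add: algebra_simps abs_le_iff)
    qed
    have v3: "weakly_caloric (Q0 1) v" unfolding weakly_caloric_def
    proof (intro allI impI)
      fix \<phi> :: "'n spacetime \<Rightarrow> real" assume \<phi>: "test_function (Q0 1) \<phi>"
      obtain Kc where Kc: "smooth_on UNIV \<phi>" "compact Kc" "Kc \<subseteq> Q0 1" "\<And>z. z \<notin> Kc \<Longrightarrow> \<phi> z = 0"
        using test_functionD[OF \<phi>] by auto
      have up: "continuous_on (positivity_set u) u" using u(1) positivity_subset continuous_on_subset by blast
      have s: "?P z \<in> positivity_set u" if "z \<in> Q0 1" for z using inP[OF that] sub by blast
      obtain \<psi> where \<psi>: "test_function (positivity_set u) \<psi>" "(\<forall>z. \<phi> z \<ge> 0) \<longrightarrow> (\<forall>z. \<psi> z \<ge> 0)"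
        "integral\<^sup>L lborel \<psi> = \<rho> ^ CARD('n) * \<rho>\<^sup>2 * integral\<^sup>L lborel \<phi>"
        "(\<integral>z. u z * adj_heat \<psi> z \<partial>lborel) = \<rho> ^ CARD('n) * (\<integral>z. u (?P z) * adj_heat \<phi> z \<partial>lborel)"
        by (rule scaled_test[OF r up \<phi> s])
      have "\<rho> ^ CARD('n) * (\<integral>z. u (?P z) * adj_heat \<phi> z \<partial>lborel) = \<rho> ^ CARD('n) * (c * \<rho>\<^sup>2 * integral\<^sup>L lborel \<phi>)"
        using uc[OF \<psi>(1)] \<psi>(3,4) by (simp add: mult.assoc mult.left_commute)
      then have 1: "(\<integral>z. u (?P z) * adj_heat \<phi> z \<partial>lborel) = c * \<rho>\<^sup>2 * integral\<^sup>L lborel \<phi>" using r by simp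
      have 2: "(\<integral>z. snd z * adj_heat \<phi> z \<partial>lborel) = integral\<^sup>L lborel \<phi>" using integral_time_adj_heat[OF \<phi>, of 0] by simp
      have i1: "integrable lborel (\<lambda>z. u (?P z) * adj_heat \<phi> z)"
        by (rule integrable_adj_heat[OF Kc(1,2,4) continuous_on_subset[OF cu Kc(3)]])
      have i2: "integrable lborel (\<lambda>z. snd z * adj_heat \<phi> z)"
        by (rule integrable_adj_heat[OF Kc(1,2,4) continuous_on_snd[OF continuous_on_id]])
      have "(\<integral>z. v z * adj_heat \<phi> z \<partial>lborel) = (\<integral>z. u (?P z) * adj_heat \<phi> z - (c * \<rho>\<^sup>2) * (snd z * adj_heat \<phi> z) \<partial>lborel)"
        by (rule Bochner_Integration.integral_cong) (auto simp: v_def algebra_simps)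
      also have "\<dots> = (\<integral>z. u (?P z) * adj_heat \<phi> z \<partial>lborel) - (c * \<rho>\<^sup>2) * (\<integral>z. snd z * adj_heat \<phi> z \<partial>lborel)"
        using i1 i2 by simp
      finally show "(\<integral>z. v z * adj_heat \<phi> z \<partial>lborel) = 0" unfolding 1 2 by simp
    qed
    have reg: "smooth_on (Q0 (1/2)) v" "\<And>z. z \<in> Q0 (1/2) \<Longrightarrow> \<bar>dir_deriv time_dir v z\<bar> \<le> C * ((A + K) * \<rho>\<^sup>2)"
        "\<And>z i. z \<in> Q0 (1/2) \<Longrightarrow> \<bar>dir_deriv (space_dir i) v z\<bar> \<le> C * ((A + K) * \<rho>\<^sup>2)"
        "\<And>z i j. z \<in> Q0 (1/2) \<Longrightarrow> \<bar>dir_deriv (space_dir i) (dir_deriv (space_dir j) v) z\<bar> \<le> C * ((A + K) * \<rho>\<^sup>2)"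
      using C(2)[of v "(A + K) * \<rho>\<^sup>2"] v1 v2 v3 by auto
    define L where "L = (\<lambda>w::'n spacetime. ((1/\<rho>) *\<^sub>R fst w, (1/\<rho>\<^sup>2) * snd w))"
    have L: "bounded_linear L" unfolding L_def by (rule bounded_linear_par)
    define b where "b = - L z0"
    have PL: "?P (L w + b) = w" for w
      using r by (simp add: L_def b_def paff_def prod_eq_iff algebra_simps add_divide_distrib)
    have sL: "snd (L w + b) = (snd w - snd z0) / \<rho>\<^sup>2" for w by (simp add: L_def b_def diff_divide_distrib)
    have ueq: "u = (\<lambda>w. v (L w + b) + c * (snd w - snd z0))"
    proof
      fix w
      have "v (L w + b) = u w - c * \<rho>\<^sup>2 * ((snd w - snd z0) / \<rho>\<^sup>2)" unfolding v_def PL sL ..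
      also have "c * \<rho>\<^sup>2 * ((snd w - snd z0) / \<rho>\<^sup>2) = c * (snd w - snd z0)" using r by simp
      finally show "u w = v (L w + b) + c * (snd w - snd z0)" by simp
    qed
    let ?H = "parabolic_cylinder (\<rho>/2) z0"
    have H: "open ?H" by (rule parabolic_cylinder_open)
    have LH: "L w + b \<in> Q0 (1/2)" if "w \<in> ?H" for w
      using paff_in_cylinder[OF r, of z0 "L w + b" "1/2"] that unfolding PL by simp
    have sv: "smooth_on ?H (\<lambda>w. v (L w + b))"
      by (rule smooth_on_affine[OF H parabolic_cylinder_open L LH reg(1)])
    have st: "smooth_on ?H (\<lambda>w. c * (snd w - snd z0))"
      by (intro smooth_on_mult smooth_on_diff smooth_snd smooth_on_const H)
    have su: "smooth_on ?H u" by (subst ueq) (rule smooth_on_add[OF H sv st])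
    have Lt: "L time_dir = (1/\<rho>\<^sup>2) *\<^sub>R time_dir" by (simp add: L_def time_dir_def)
    have Ls: "L (space_dir i) = (1/\<rho>) *\<^sub>R space_dir i" for i by (simp add: L_def space_dir_def)
    have dv: "v differentiable (at (L w + b))" "dir_deriv d v differentiable (at (L w + b))" if "w \<in> ?H" for w d
      using smooth_on_differentiable[OF reg(1) LH[OF that]] smooth_on_differentiable[OF smooth_on_dir_deriv[OF reg(1)] LH[OF that]] by auto
    have dc: "dir_deriv d (\<lambda>w. c * (snd w - snd z0)) w = c * snd d" for d w
      by (rule dir_deriv_eq) (auto intro!: derivative_eq_intros)
    have du: "dir_deriv d u w = dir_deriv (L d) v (L w + b) + c * snd d" if "w \<in> ?H" for d w
    proof -
      have "dir_deriv d u w = dir_deriv d (\<lambda>w. v (L w + b)) w + dir_deriv d (\<lambda>w. c * (snd w - snd z0)) w"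
        by (subst ueq) (rule dir_deriv_add[OF smooth_on_differentiable[OF sv that] smooth_on_differentiable[OF st that]])
      then show ?thesis unfolding dc dir_deriv_affine(2)[OF L dv(1)[OF that]] .
    qed
    have dt: "dir_deriv time_dir u w = (1/\<rho>\<^sup>2) * dir_deriv time_dir v (L w + b) + c" if "w \<in> ?H" for w
      unfolding du[OF that] Lt dir_deriv_scaleR[OF dv(1)[OF that]] by (simp add: time_dir_def)
    have ds: "dir_deriv (space_dir i) u w = (1/\<rho>) * dir_deriv (space_dir i) v (L w + b)" if "w \<in> ?H" for w i
      unfolding du[OF that] Ls dir_deriv_scaleR[OF dv(1)[OF that]] by (simp add: space_dir_def)
    have ds2: "dir_deriv (space_dir i) (dir_deriv (space_dir j) u) w = (1/\<rho>\<^sup>2) * dir_deriv (space_dir i) (dir_deriv (space_dir j) v) (L w + b)"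
      if w: "w \<in> ?H" for w i j
    proof -
      have "dir_deriv (space_dir i) (dir_deriv (space_dir j) u) w = dir_deriv (space_dir i) (\<lambda>w. (1/\<rho>) * dir_deriv (space_dir j) v (L w + b)) w"
        by (rule dir_deriv_cong_open(2)[OF H w ds smooth_on_differentiable[OF smooth_on_dir_deriv[OF su] w]])
      also have "\<dots> = (1/\<rho>) * dir_deriv (space_dir i) (\<lambda>w. dir_deriv (space_dir j) v (L w + b)) w"
        by (rule dir_deriv_cmult[OF dir_deriv_affine(1)[OF L dv(2)[OF w]]])
      also have "\<dots> = (1/\<rho>) * ((1/\<rho>) * dir_deriv (space_dir i) (dir_deriv (space_dir j) v) (L w + b))"
        unfolding dir_deriv_affine(2)[OF L dv(2)[OF w]] Ls dir_deriv_scaleR[OF dv(2)[OF w]] ..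
      finally show ?thesis by (simp add: power2_eq_square)
    qed
    have CAK: "C * (A + K) \<ge> 0" using C(1) A K by simp
    have DC: "C * (A + K) \<le> D" using K by (simp add: D_def)
    have "\<bar>dir_deriv time_dir u w\<bar> \<le> D" if "w \<in> ?H" for w
    proof -
      have "\<bar>(1/\<rho>\<^sup>2) * dir_deriv time_dir v (L w + b)\<bar> \<le> (1/\<rho>\<^sup>2) * (C * ((A + K) * \<rho>\<^sup>2))"
        unfolding abs_mult using reg(2)[OF LH[OF that]] by (intro mult_mono) auto
      also have "\<dots> = C * (A + K)" using r by simp
      finally show ?thesis unfolding dt[OF that] D_def using u(3) by linarith
    qed
    moreover have "\<bar>dir_deriv (space_dir i) u w\<bar> \<le> D * \<rho>" if "w \<in> ?H" for w i
    proof -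
      have "\<bar>(1/\<rho>) * dir_deriv (space_dir i) v (L w + b)\<bar> \<le> (1/\<rho>) * (C * ((A + K) * \<rho>\<^sup>2))"
        unfolding abs_mult using reg(3)[OF LH[OF that]] r by (intro mult_mono) auto
      also have "\<dots> = C * (A + K) * \<rho>" using r by (simp add: power2_eq_square)
      also have "\<dots> \<le> D * \<rho>" using DC r by (intro mult_right_mono) auto
      finally show ?thesis unfolding ds[OF that] .
    qed
    moreover have "\<bar>dir_deriv (space_dir i) (dir_deriv (space_dir j) u) w\<bar> \<le> D" if "w \<in> ?H" for w i j
    proof -
      have "\<bar>(1/\<rho>\<^sup>2) * dir_deriv (space_dir i) (dir_deriv (space_dir j) v) (L w + b)\<bar> \<le> (1/\<rho>\<^sup>2) * (C * ((A + K) * \<rho>\<^sup>2))"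
        unfolding abs_mult using reg(4)[OF LH[OF that]] by (intro mult_mono) auto
      also have "\<dots> = C * (A + K)" using r by simp
      finally show ?thesis unfolding ds2[OF that] using DC by linarith
    qed
    ultimately show ?thesis using su by blast
  qed
  moreover have "D > 0" using C(1) A K by (simp add: D_def add_nonneg_pos)
  ultimately show ?thesis by blast
qed

text \<open>A nonnegative function cannot descend along its gradient for longer than its value allows.\<close>

lemma gradient_le_value:
  fixes u :: "'n::finite spacetime \<Rightarrow> real"
  assumes sm: "smooth_on S u" and S: "S = parabolic_cylinder (\<rho>/2) z0" and r: "\<rho> > 0" and C: "C > 0"
    and pos: "\<And>z. z \<in> S \<Longrightarrow> u z \<ge> 0" and g: "\<bar>dir_deriv (space_dir i) u z0\<bar> \<le> C * \<rho>"
    and h: "\<And>z. z \<in> S \<Longrightarrow> \<bar>dir_deriv (space_dir i) (dir_deriv (space_dir i) u) z\<bar> \<le> C"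
  shows "(dir_deriv (space_dir i) u z0)\<^sup>2 \<le> 6 * C * u z0"
proof -
  define d where "d = dir_deriv (space_dir i) u z0"
  define w where "w = (- d) *\<^sub>R (space_dir i :: 'n spacetime)"
  \<comment> \<open>With |d| \<le> C \<rho> the path has length at most \<rho>/4 and stays in the
    cylinder; the second derivative changes the slope by at most d^2/4 along it, leaving a descent
    rate of at least 3/4 d^2.\<close>
  define s1 where "s1 = 1 / (4 * C)"
  have s1: "s1 > 0" using C by (simp add: s1_def)
  have inS: "z0 + s *\<^sub>R w \<in> S" if "0 \<le> s" "s \<le> s1" for s
  proof -
    have "s * \<bar>d\<bar> \<le> s1 * (C * \<rho>)" using that g s1 by (intro mult_mono) (auto simp: d_def)
    also have "\<dots> < \<rho> / 2" using C r by (simp add: s1_def)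
    finally show ?thesis unfolding S using that r
      by (simp add: parabolic_cylinder_def w_def space_dir_def abs_mult)
  qed
  have df: "u differentiable (at z)" "dir_deriv v u differentiable (at z)" if "z \<in> S" for z v
    using smooth_on_differentiable[OF sm that] smooth_on_differentiable[OF smooth_on_dir_deriv[OF sm] that] by auto
  have z0S: "z0 \<in> S" using inS[of 0] s1 by simp
  have S': "open S" unfolding S by (rule parabolic_cylinder_open)
  define p where "p = (\<lambda>s. u (z0 + s *\<^sub>R w))"
  define p1 where "p1 = (\<lambda>s. dir_deriv w u (z0 + s *\<^sub>R w))"
  define p2 where "p2 = (\<lambda>s. dir_deriv w (dir_deriv w u) (z0 + s *\<^sub>R w))"
  have D1: "(p has_real_derivative p1 s) (at s)" if "0 \<le> s" "s \<le> s1" for s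
    unfolding p_def p1_def by (rule line_has_real_derivative[OF df(1)[OF inS[OF that]]])
  have D2: "(p1 has_real_derivative p2 s) (at s)" if "0 \<le> s" "s \<le> s1" for s
    unfolding p1_def p2_def by (rule line_has_real_derivative[OF df(2)[OF inS[OF that]]])
  have wd: "dir_deriv w u z = - d * dir_deriv (space_dir i) u z" if "z \<in> S" for z
    unfolding w_def by (rule dir_deriv_scaleR[OF df(1)[OF that]])
  have p10: "p1 0 = - d\<^sup>2" using wd[OF z0S] by (simp add: p1_def d_def power2_eq_square)
  have p2b: "p2 s \<le> d\<^sup>2 * C" if "0 \<le> s" "s \<le> s1" for s
  proof -
    let ?z = "z0 + s *\<^sub>R w"
    have "p2 s = - d * dir_deriv (space_dir i) (dir_deriv w u) ?z"
      unfolding p2_def by (subst (1) w_def) (rule dir_deriv_scaleR[OF df(2)[OF inS[OF that]]])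
    also have "dir_deriv (space_dir i) (dir_deriv w u) ?z = dir_deriv (space_dir i) (\<lambda>z. - d * dir_deriv (space_dir i) u z) ?z"
      by (rule dir_deriv_cong_open(2)[OF S' inS[OF that] wd df(2)[OF inS[OF that]]])
    also have "\<dots> = - d * dir_deriv (space_dir i) (dir_deriv (space_dir i) u) ?z"
      by (rule dir_deriv_cmult[OF df(2)[OF inS[OF that]]])
    also have "- d * (- d * dir_deriv (space_dir i) (dir_deriv (space_dir i) u) ?z) = d\<^sup>2 * dir_deriv (space_dir i) (dir_deriv (space_dir i) u) ?z"
      by (simp add: power2_eq_square)
    also have "\<dots> \<le> d\<^sup>2 * C" using h[OF inS[OF that]] by (intro mult_left_mono) (auto simp: abs_le_iff)
    finally show ?thesis .
  qed
  obtain x where x: "0 < x" "x < s1" "p s1 - p 0 = (s1 - 0) * p1 x"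
    using MVT2[OF s1, of p p1] D1 by auto
  obtain y where y: "0 < y" "y < x" "p1 x - p1 0 = (x - 0) * p2 y"
    using MVT2[OF x(1), of p1 p2] D2 x(2) by auto
  have "x * p2 y \<le> s1 * (d\<^sup>2 * C)"
  proof -
    have "x * p2 y \<le> x * (d\<^sup>2 * C)" using p2b[of y] x y by (intro mult_left_mono) auto
    also have "\<dots> \<le> s1 * (d\<^sup>2 * C)" using x C by (intro mult_right_mono) auto
    finally show ?thesis .
  qed
  also have "s1 * (d\<^sup>2 * C) = d\<^sup>2 / 4" using C by (simp add: s1_def)
  finally have "p1 x \<le> - (3/4) * d\<^sup>2" using y(3) p10 by simp
  then have "s1 * p1 x \<le> s1 * (- (3/4) * d\<^sup>2)" using s1 by (intro mult_left_mono) auto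
  moreover have "0 \<le> p s1" using pos[OF inS[of s1]] s1 by (simp add: p_def)
  ultimately have "0 \<le> u z0 + s1 * (- (3/4) * d\<^sup>2)" using x(3) by (simp add: p_def)
  \<comment> \<open>16/3 is rounded up to the 6 of the statement, which uses that the value is
    nonnegative.\<close>
  then have "3 * d\<^sup>2 \<le> 16 * C * u z0" using C by (simp add: s1_def field_simps)
  moreover have "0 \<le> C * u z0" using pos[OF z0S] C by simp
  ultimately show ?thesis unfolding d_def by linarith
qed

text \<open>Each point is the centre of its own cylinder, and the bounds on derivatives are read off
  there; 6C covers them and the gradient-value inequality at once.\<close>

lemma pointwise_estimates:
  assumes K: "K > 0"
  shows "\<exists>C>0. \<forall>(u :: 'n::finite spacetime \<Rightarrow> real) c. admissible K u c \<longrightarrow> smooth_on (positivity_set u \<inter> Q0 (1/2)) u \<and>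
     (\<forall>z \<in> positivity_set u \<inter> Q0 (1/2). \<bar>dir_deriv time_dir u z\<bar> \<le> C \<and>
       (\<forall>i. \<bar>dir_deriv (space_dir i) u z\<bar> \<le> C * Sup (radii u z)) \<and>
       (\<forall>i j. \<bar>dir_deriv (space_dir i) (dir_deriv (space_dir j) u) z\<bar> \<le> C) \<and>
       (\<forall>i. (dir_deriv (space_dir i) u z)\<^sup>2 \<le> C * u z))"
proof -
  obtain A where A: "A > 0" "\<And>(u :: 'n::finite spacetime \<Rightarrow> real) c z0. admissible K u c \<Longrightarrow> z0 \<in> positivity_set u \<inter> Q0 (1/2) \<Longrightarrow>
    \<exists>\<rho>. 0 < \<rho> \<and> \<rho> \<le> Sup (radii u z0) \<and> parabolic_cylinder \<rho> z0 \<subseteq> positivity_set u \<and> (\<forall>z\<in>parabolic_cylinder \<rho> z0. u z \<le> A * \<rho>\<^sup>2)"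
    using cylinder_choice[OF K, where 'n='n] by blast
  obtain C where C: "C > 0" "\<And>(u :: 'n::finite spacetime \<Rightarrow> real) c z0 \<rho>. admissible K u c \<and> 0 < \<rho> \<and> parabolic_cylinder \<rho> z0 \<subseteq> positivity_set u
     \<and> (\<forall>z\<in>parabolic_cylinder \<rho> z0. u z \<le> A * \<rho>\<^sup>2) \<Longrightarrow>
     smooth_on (parabolic_cylinder (\<rho>/2) z0) u \<and> (\<forall>z\<in>parabolic_cylinder (\<rho>/2) z0. \<bar>dir_deriv time_dir u z\<bar> \<le> C \<and>
       (\<forall>i. \<bar>dir_deriv (space_dir i) u z\<bar> \<le> C * \<rho>) \<and> (\<forall>i j. \<bar>dir_deriv (space_dir i) (dir_deriv (space_dir j) u) z\<bar> \<le> C))"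
    using scaled_estimates[OF K A(1), where 'n='n] by blast
  have main: "(\<exists>T. open T \<and> z0 \<in> T \<and> smooth_on T u) \<and> \<bar>dir_deriv time_dir u z0\<bar> \<le> 6 * C \<and>
       (\<forall>i. \<bar>dir_deriv (space_dir i) u z0\<bar> \<le> 6 * C * Sup (radii u z0)) \<and>
       (\<forall>i j. \<bar>dir_deriv (space_dir i) (dir_deriv (space_dir j) u) z0\<bar> \<le> 6 * C) \<and>
       (\<forall>i. (dir_deriv (space_dir i) u z0)\<^sup>2 \<le> 6 * C * u z0)"
    if ad: "admissible K u c" and z0: "z0 \<in> positivity_set u \<inter> Q0 (1/2)" for u :: "'n spacetime \<Rightarrow> real" and c z0
  proof -
    obtain \<rho> where \<rho>: "0 < \<rho>" "\<rho> \<le> Sup (radii u z0)" "parabolic_cylinder \<rho> z0 \<subseteq> positivity_set u" "\<forall>z\<in>parabolic_cylinder \<rho> z0. u z \<le> A * \<rho>\<^sup>2"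
      using A(2)[OF ad z0] by blast
    let ?H = "parabolic_cylinder (\<rho>/2) z0"
    have est: "smooth_on ?H u" "\<And>z. z \<in> ?H \<Longrightarrow> \<bar>dir_deriv time_dir u z\<bar> \<le> C"
       "\<And>z i. z \<in> ?H \<Longrightarrow> \<bar>dir_deriv (space_dir i) u z\<bar> \<le> C * \<rho>" "\<And>z i j. z \<in> ?H \<Longrightarrow> \<bar>dir_deriv (space_dir i) (dir_deriv (space_dir j) u) z\<bar> \<le> C"
      using C(2)[of u c \<rho> z0] ad \<rho> by auto
    have z0H: "z0 \<in> ?H" using \<rho>(1) by (intro center_in_cylinder) simp
    have HP: "?H \<subseteq> positivity_set u" using \<rho>(1,3) cylinder_mono[of "\<rho>/2" \<rho> z0] by auto
    have pos: "u z \<ge> 0" if "z \<in> ?H" for z using HP that by (force simp: positivity_set_def)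
    have q: "(dir_deriv (space_dir i) u z0)\<^sup>2 \<le> 6 * C * u z0" for i
      by (rule gradient_le_value[OF est(1) refl \<rho>(1) C(1) pos est(3)[OF z0H] est(4)])
    have gr: "\<bar>dir_deriv (space_dir i) u z0\<bar> \<le> 6 * C * Sup (radii u z0)" for i
    proof -
      have "\<bar>dir_deriv (space_dir i) u z0\<bar> \<le> C * \<rho>" by (rule est(3)[OF z0H])
      also have "\<dots> \<le> C * Sup (radii u z0)" using \<rho>(2) C(1) by (intro mult_left_mono) auto
      also have "\<dots> \<le> 6 * C * Sup (radii u z0)" using C(1) \<rho>(1,2) by (intro mult_right_mono) auto
      finally show ?thesis .
    qed
    have C6: "C \<le> 6 * C" using C(1) by simp
    show ?thesis using est(1) z0H parabolic_cylinder_open q gr order_trans[OF est(2)[OF z0H] C6] order_trans[OF est(4)[OF z0H] C6] by blast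
  qed
  have "smooth_on (positivity_set u \<inter> Q0 (1/2)) u" if "admissible K u c" for u :: "'n spacetime \<Rightarrow> real" and c
    by (rule smooth_on_Union) (use main[OF that] in blast)
  then show ?thesis using main C(1) by (intro exI[of _ "6 * C"]) auto
qed

section \<open>Weak derivatives by truncation near the zero set\<close>

text \<open>Rescaling \<open>flat 1\<close> by N shrinks the interval of vanishing to w \<le> 1/N
  and keeps the slope within [0, 1]. \<open>trunc1\<close> and \<open>trunc2\<close> are the first
  two derivatives.\<close>

definition trunc :: "real \<Rightarrow> real \<Rightarrow> real" where "trunc N w = 1 / N * flat 1 (N * w - 1)"
definition trunc1 :: "real \<Rightarrow> real \<Rightarrow> real" where "trunc1 N w = flat 0 (N * w - 1) + 1/4 * flat (-1) (N * w - 1)"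
definition trunc2 :: "real \<Rightarrow> real \<Rightarrow> real" where "trunc2 N w = N / 16 * flat (-3) (N * w - 1)"

lemma trunc_deriv: "N > 0 \<Longrightarrow> (trunc N has_real_derivative trunc1 N w) (at w)"
proof -
  assume N: "N > 0"
  have "((\<lambda>w. flat 1 (N * w - 1)) has_real_derivative (flat 0 (N * w - 1) + 1/4 * flat (-1) (N * w - 1)) * N) (at w)"
    by (rule DERIV_chain2[OF flat_1_has_deriv]) (auto intro!: derivative_eq_intros)
  from DERIV_cmult[OF this, of "1 / N"] show ?thesis using N by (simp add: trunc_def[abs_def] trunc1_def)
qed

lemma trunc1_deriv: "(trunc1 N has_real_derivative trunc2 N w) (at w)"
proof -
  have "((\<lambda>w. flat 0 (N * w - 1) + 1/4 * flat (-1) (N * w - 1)) has_real_derivative (1/16 * flat (-3) (N * w - 1)) * N) (at w)"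
    by (rule DERIV_chain2[OF flat_1_has_deriv2]) (auto intro!: derivative_eq_intros)
  then show ?thesis unfolding trunc1_def[abs_def] trunc2_def by (rule DERIV_cong) simp
qed

lemma smooth_trunc: "smooth_on UNIV (trunc N)"
proof -
  have "smooth_on UNIV (\<lambda>w. N * w - 1)"
    by (intro smooth_on_diff smooth_on_mult smooth_on_const open_UNIV smooth_on_linear bounded_linear_ident)
  then show ?thesis unfolding trunc_def[abs_def]
    by (intro smooth_on_mult smooth_on_const open_UNIV smooth_on_compose[OF open_UNIV open_UNIV _ _ smooth_on_flat]) auto
qed

lemma trunc_zero: "N > 0 \<Longrightarrow> w < 1 / N \<Longrightarrow> trunc N w = 0"
  unfolding trunc_def by (subst flat_0) (auto simp: field_simps)

lemma trunc_bounds: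
  assumes "N > 0" "w \<ge> 0"
  shows "0 \<le> trunc N w" "trunc N w \<le> w" "0 \<le> trunc1 N w" "trunc1 N w \<le> 1"
proof -
  show "0 \<le> trunc N w" using assms by (simp add: trunc_def flat_nonneg)
  have "flat 1 (N * w - 1) \<le> max (N * w - 1) 0" by (rule flat_1_le)
  also have "\<dots> \<le> N * w" using assms by simp
  finally show "trunc N w \<le> w" using assms by (simp add: trunc_def field_simps)
  show "0 \<le> trunc1 N w" by (simp add: trunc1_def flat_nonneg)
  show "trunc1 N w \<le> 1" unfolding trunc1_def by (rule flat_1_deriv_le)
qed

text \<open>With m + 1 in place of m in exp(y) \<ge> (y/m)^m and y = 1/(4x), the exponential absorbs
  the negative power of x.\<close>

lemma flat_neg_bound: "flat (- real (Suc m)) x \<le> (4 * real (Suc m)) ^ Suc m"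
proof (cases "x > 0")
  case True
  define y where "y = 1 / (4 * x)"
  have y: "y > 0" using True by (simp add: y_def)
  have "(y / real (Suc m)) ^ Suc m \<le> (1 + y / real (Suc m)) ^ Suc m" using y by (intro power_mono) auto
  also have "\<dots> \<le> exp y" using exp_ge_one_plus_x_over_n_power_n[where x=y and n="Suc m"] y by simp
  finally have "inverse (exp y) \<le> inverse ((y / real (Suc m)) ^ Suc m)"
    using y by (intro le_imp_inverse_le) auto
  then have e: "exp (- y) \<le> (real (Suc m) / y) ^ Suc m"
    by (simp only: exp_minus power_inverse[symmetric] inverse_divide)
  have "flat (- real (Suc m)) x = x powr (- real (Suc m)) * exp (- y)" using True by (simp add: flat_def y_def)
  also have "x powr (- real (Suc m)) = 1 / x ^ Suc m" using True by (simp only: powr_minus_divide powr_realpow)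
  also have "1 / x ^ Suc m * exp (- y) \<le> 1 / x ^ Suc m * (real (Suc m) / y) ^ Suc m"
    using e True by (intro mult_left_mono) auto
  also have "real (Suc m) / y = 4 * real (Suc m) * x" by (simp add: y_def)
  also have "1 / x ^ Suc m * (4 * real (Suc m) * x) ^ Suc m = (4 * real (Suc m)) ^ Suc m"
    using True by (simp only: power_mult_distrib) simp
  finally show ?thesis .
qed (simp add: flat_def)

text \<open>Writing N w as x + 1 with x = N w - 1 absorbs the growing factor N, so the product
  depends on N only through the argument.\<close>

lemma trunc2_eq: "N > 0 \<Longrightarrow> trunc2 N w * w = 1/16 * (flat (-2) (N * w - 1) + flat (-3) (N * w - 1))"
proof -
  assume N: "N > 0"
  have e: "(x + 1) * flat (-3) x = flat (-2) x + flat (-3) x" for x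
  proof (cases "x > 0")
    case True
    have "x * x powr (-3) = x powr (-2)" using powr_mult_base[of x "-3"] True by simp
    then have "x * flat (-3) x = flat (-2) x" using True by (simp add: flat_def flip: mult.assoc)
    then show ?thesis by (simp add: algebra_simps)
  qed (simp add: flat_def)
  show ?thesis using e[of "N * w - 1"] by (simp add: trunc2_def algebra_simps)
qed

text \<open>1792 = 8^2 + 12^3, the bounds for \<open>flat (-2)\<close> and \<open>flat (-3)\<close>;
  the factor 1/16 is dropped.\<close>

lemma trunc2_bound:
  assumes "N > 0" "w \<ge> 0"
  shows "0 \<le> trunc2 N w * w" "trunc2 N w * w \<le> 1792"
  using flat_neg_bound[of 1 "N * w - 1"] flat_neg_bound[of 2 "N * w - 1"] flat_nonneg[of "-2" "N * w - 1"] flat_nonneg[of "-3" "N * w - 1"]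
  unfolding trunc2_eq[OF assms(1)] by (simp_all add: numeral_eq_Suc)

lemma trunc_limits:
  assumes w: "w > 0"
  shows "(\<lambda>k. trunc (real (Suc k)) w) \<longlonglongrightarrow> w" "(\<lambda>k. trunc1 (real (Suc k)) w) \<longlonglongrightarrow> 1" "(\<lambda>k. trunc2 (real (Suc k)) w) \<longlonglongrightarrow> 0"
proof -
  have "filterlim (\<lambda>k. real (Suc k)) at_top sequentially"
    using filterlim_compose[OF filterlim_real_sequentially filterlim_Suc] by simp
  then have "filterlim (\<lambda>k. real (Suc k) * w) at_top sequentially"
    using w by (subst mult.commute) (rule filterlim_tendsto_pos_mult_at_top[OF tendsto_const])
  then have x: "filterlim (\<lambda>k. real (Suc k) * w - 1) at_top sequentially"
    using filterlim_tendsto_add_at_top[OF tendsto_const[of "-1"]] by (simp add: algebra_simps)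
  have f0: "(\<lambda>k. flat 0 (real (Suc k) * w - 1)) \<longlonglongrightarrow> 1" by (rule filterlim_compose[OF flat_at_top(1) x])
  have fm: "(\<lambda>k. flat (- m) (real (Suc k) * w - 1)) \<longlonglongrightarrow> 0" if "m > 0" for m by (rule filterlim_compose[OF flat_at_top(2)[OF that] x])
  have "(\<lambda>k. flat 0 (real (Suc k) * w - 1) + 1/4 * flat (-1) (real (Suc k) * w - 1)) \<longlonglongrightarrow> 1 + 1/4 * 0"
    using fm[of 1] by (intro tendsto_intros f0) auto
  then show "(\<lambda>k. trunc1 (real (Suc k)) w) \<longlonglongrightarrow> 1" by (simp add: trunc1_def)
  have "(\<lambda>k. (w - inverse (real (Suc k))) * flat 0 (real (Suc k) * w - 1)) \<longlonglongrightarrow> (w - 0) * 1"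
    by (intro tendsto_intros f0 LIMSEQ_inverse_real_of_nat)
  moreover have "trunc (real (Suc k)) w = (w - inverse (real (Suc k))) * flat 0 (real (Suc k) * w - 1)" for k
  proof -
    have "flat 1 x = x * flat 0 x" for x by (simp add: flat_def)
    moreover have "1 / real (Suc k) * (real (Suc k) * w - 1) = w - inverse (real (Suc k))"
      by (simp add: field_simps)
    ultimately show ?thesis by (simp only: trunc_def mult.assoc[symmetric])
  qed
  ultimately show "(\<lambda>k. trunc (real (Suc k)) w) \<longlonglongrightarrow> w" by simp
  have "(\<lambda>k. 1/16 * (flat (-2) (real (Suc k) * w - 1) + flat (-3) (real (Suc k) * w - 1)) * (1 / w)) \<longlonglongrightarrow> 1/16 * (0 + 0) * (1 / w)"
    using fm[of 2] fm[of 3] by (intro tendsto_intros) auto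
  moreover have "trunc2 (real (Suc k)) w = 1/16 * (flat (-2) (real (Suc k) * w - 1) + flat (-3) (real (Suc k) * w - 1)) * (1 / w)" for k
    using trunc2_eq[of "real (Suc k)" w] w by (simp add: field_simps)
  ultimately show "(\<lambda>k. trunc2 (real (Suc k)) w) \<longlonglongrightarrow> 0" by simp
qed

section \<open>Weak derivatives as limits of classical ones\<close>

lemma test_function_dir_deriv: "test_function \<Omega> \<phi> \<Longrightarrow> test_function \<Omega> (dir_deriv v \<phi>)"
proof -
  assume t: "test_function \<Omega> \<phi>"
  then obtain K where K: "smooth_on UNIV \<phi>" "compact K" "K \<subseteq> \<Omega>" "\<And>z. z \<notin> K \<Longrightarrow> \<phi> z = 0"
    using test_functionD[OF t] by auto
  show ?thesis
    by (rule test_functionI[OF smooth_on_dir_deriv[OF K(1)] K(2,3)]) (rule dir_deriv_vanish[OF compact_imp_closed[OF K(2)] K(4)])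
qed

text \<open>\<open>F\<close> is controlled only on \<Omega>, but its product with a test function is
  smooth on the whole space, so the vanishing of integrals of derivatives applies to the
  product.\<close>

lemma integration_by_parts:
  fixes F \<phi> :: "'a::euclidean_space \<Rightarrow> real"
  assumes \<Omega>: "open \<Omega>" and F: "smooth_on \<Omega> F" and t: "test_function \<Omega> \<phi>"
  shows "(\<integral>z. F z * dir_deriv v \<phi> z \<partial>lborel) = - (\<integral>z. dir_deriv v F z * \<phi> z \<partial>lborel)"
proof -
  obtain K where K: "smooth_on UNIV \<phi>" "compact K" "K \<subseteq> \<Omega>" "\<And>z. z \<notin> K \<Longrightarrow> \<phi> z = 0"
    using test_functionD[OF t] by auto
  have cl: "closed K" by (rule compact_imp_closed[OF K(2)])
  let ?G = "\<lambda>z. F z * \<phi> z"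
  have G: "smooth_on UNIV ?G"
  proof (rule smooth_on_Union)
    fix z
    show "\<exists>T. open T \<and> z \<in> T \<and> smooth_on T ?G"
    proof (cases "z \<in> \<Omega>")
      case True
      then show ?thesis using \<Omega> smooth_on_mult[OF \<Omega> F smooth_on_subset[OF K(1) subset_UNIV]] by blast
    next
      case False
      have "smooth_on (- K) ?G"
        by (rule smooth_on_cong_imp[OF open_Compl[OF cl] _ smooth_on_const[of _ 0]]) (simp add: K(4))
      then show ?thesis using False K(3) open_Compl[OF cl] by blast
    qed
  qed
  have dv: "dir_deriv v \<phi> z = 0" if "z \<notin> K" for z by (rule dir_deriv_vanish[OF cl K(4) that])
  have eq: "dir_deriv v ?G z = F z * dir_deriv v \<phi> z + dir_deriv v F z * \<phi> z" for z
  proof (cases "z \<in> \<Omega>")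
    case True
    then show ?thesis by (intro dir_deriv_mult smooth_on_differentiable[OF F] smooth_diff[OF K(1)])
  next
    case False
    then have "z \<notin> K" using K(3) by blast
    then show ?thesis using dv[of z] K(4)[of z] dir_deriv_vanish[OF cl, of ?G z v] K(4) by simp
  qed
  have c: "continuous_on K F" "continuous_on K (dir_deriv v F)" "continuous_on K \<phi>" "continuous_on K (dir_deriv v \<phi>)"
    using smooth_on_continuous[OF smooth_on_subset[OF F K(3)]] smooth_on_continuous[OF smooth_on_subset[OF smooth_on_dir_deriv[OF F] K(3)]]
      smooth_on_continuous[OF smooth_on_subset[OF K(1) subset_UNIV]] smooth_on_continuous[OF smooth_on_subset[OF smooth_on_dir_deriv[OF K(1)] subset_UNIV]] by auto
  have i1: "integrable lborel (\<lambda>z. F z * dir_deriv v \<phi> z)" by (rule integrable_times_compact[OF K(2) c(1,4) dv])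
  have i2: "integrable lborel (\<lambda>z. dir_deriv v F z * \<phi> z)" by (rule integrable_times_compact[OF K(2) c(2,3) K(4)])
  have "integral\<^sup>L lborel (dir_deriv v ?G) = 0" by (rule integral_dir_deriv_zero[OF G K(2)]) (simp add: K(4))
  then have "(\<integral>z. F z * dir_deriv v \<phi> z + dir_deriv v F z * \<phi> z \<partial>lborel) = 0" by (simp only: eq[symmetric])
  then show ?thesis using i1 i2 by simp
qed

text \<open>The outermost derivative of the test function is moved first and so becomes the
  innermost one on \<open>F\<close>; hence the reversed list.\<close>

lemma iterated_integration_by_parts:
  assumes "open \<Omega>" "smooth_on \<Omega> F" "test_function \<Omega> \<phi>"
  shows "(\<integral>z. F z * foldr dir_deriv ds \<phi> z \<partial>lborel) = (- 1) ^ length ds * (\<integral>z. foldr dir_deriv (rev ds) F z * \<phi> z \<partial>lborel)"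
  using assms(2)
proof (induction ds arbitrary: F)
  case (Cons v ds)
  have t: "test_function \<Omega> (foldr dir_deriv ds \<phi>)"
    by (induction ds) (auto intro: test_function_dir_deriv assms(3))
  have "(\<integral>z. F z * foldr dir_deriv (v # ds) \<phi> z \<partial>lborel) = - (\<integral>z. dir_deriv v F z * foldr dir_deriv ds \<phi> z \<partial>lborel)"
    using integration_by_parts[OF assms(1) Cons.prems t] by simp
  then show ?case using Cons.IH[OF smooth_on_dir_deriv[OF Cons.prems]] by simp
qed simp

lemma test_limit:
  fixes g :: "nat \<Rightarrow> 'a::euclidean_space \<Rightarrow> real"
  assumes K: "compact K" and h: "continuous_on K h" "\<And>z. z \<notin> K \<Longrightarrow> h z = 0"
    and g: "\<And>k. continuous_on K (g k)" "\<And>k z. z \<in> K \<Longrightarrow> \<bar>g k z\<bar> \<le> B" "\<And>z. z \<in> K \<Longrightarrow> (\<lambda>k. g k z) \<longlonglongrightarrow> G z"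
  shows "(\<lambda>k. \<integral>z. g k z * h z \<partial>lborel) \<longlonglongrightarrow> (\<integral>z. G z * h z \<partial>lborel)"
proof -
  have m: "(\<lambda>z. g k z * h z) \<in> borel_measurable lborel" for k
    using integrable_times_compact[OF K g(1) h] by blast
  have l: "(\<lambda>k. g k z * h z) \<longlonglongrightarrow> G z * h z" for z
    using g(3)[of z] h(2)[of z] by (cases "z \<in> K") (auto intro: tendsto_mult)
  have "integrable lborel (\<lambda>z. 1 * h z)" by (rule integrable_times_compact[OF K continuous_on_const h])
  then have i: "integrable lborel (\<lambda>z. \<bar>B\<bar> * \<bar>h z\<bar>)" by simp
  show ?thesis
  proof (rule integral_dominated_convergence[OF _ m i])
    show "(\<lambda>z. G z * h z) \<in> borel_measurable lborel" by (rule borel_measurable_LIMSEQ_real[OF l m])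
    show "AE x in lborel. (\<lambda>k. g k x * h x) \<longlonglongrightarrow> G x * h x" using l by simp
    show "AE x in lborel. norm (g k x * h x) \<le> \<bar>B\<bar> * \<bar>h x\<bar>" for k
    proof (intro always_eventually allI)
      fix x
      show "norm (g k x * h x) \<le> \<bar>B\<bar> * \<bar>h x\<bar>"
        using g(2)[of x k] h(2)[of x] by (cases "x \<in> K") (auto simp: abs_mult intro!: mult_right_mono)
    qed
  qed
qed

lemma set_integral_lebesgue_eq:
  fixes h :: "'a::euclidean_space \<Rightarrow> real"
  assumes "h \<in> borel_measurable borel" "\<And>z. z \<notin> \<Omega> \<Longrightarrow> h z = 0"
  shows "set_lebesgue_integral lebesgue \<Omega> h = integral\<^sup>L lborel h"
proof -
  have "(\<lambda>z. indicator \<Omega> z *\<^sub>R h z) = h" using assms(2) by (auto simp: indicator_def fun_eq_iff)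
  then show ?thesis unfolding set_lebesgue_integral_def using integral_completion[of h lborel] assms(1) by simp
qed

text \<open>Weak derivatives pass to limits under uniformly bounded pointwise convergence of the
  functions and of the derivatives in question; intermediate derivatives need no bound.
  Measurability and boundedness of \<open>g\<close> give its local integrability.\<close>

lemma weak_deriv_by_approximation:
  fixes u g :: "'a::euclidean_space \<Rightarrow> real"
  assumes \<Omega>: "open \<Omega>" and u: "continuous_on \<Omega> u" and F: "\<And>k. smooth_on \<Omega> (F k)"
    and Fb: "\<And>k z. z \<in> \<Omega> \<Longrightarrow> \<bar>F k z\<bar> \<le> B" "\<And>z. z \<in> \<Omega> \<Longrightarrow> (\<lambda>k. F k z) \<longlonglongrightarrow> u z"
    and Gb: "\<And>k z. z \<in> \<Omega> \<Longrightarrow> \<bar>foldr dir_deriv (rev ds) (F k) z\<bar> \<le> B" "\<And>z. z \<in> \<Omega> \<Longrightarrow> (\<lambda>k. foldr dir_deriv (rev ds) (F k) z) \<longlonglongrightarrow> g z"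
    and g: "g \<in> borel_measurable borel" "\<And>z. \<bar>g z\<bar> \<le> B"
  shows "has_weak_deriv \<Omega> ds u g"
  unfolding has_weak_deriv_def
proof (intro conjI allI impI)
  show "locally_integrable_on u \<Omega>" unfolding locally_integrable_on_def set_integrable_def
  proof (intro allI impI)
    fix S assume S: "compact S \<and> S \<subseteq> \<Omega>"
    then have "integrable lborel (\<lambda>x. indicator S x *\<^sub>R u x)"
      using borel_integrable_compact continuous_on_subset[OF u] by blast
    then show "integrable lebesgue (\<lambda>x. indicator S x *\<^sub>R u x)"
      using integrable_completion borel_measurable_integrable by blast
  qed
  show "locally_integrable_on g \<Omega>" unfolding locally_integrable_on_def set_integrable_def
  proof (intro allI impI)
    fix S :: "'a set" assume S: "compact S \<and> S \<subseteq> \<Omega>"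
    have Sm: "S \<in> sets borel" using S borel_closed[OF compact_imp_closed] by blast
    have "cpt_bdd S 1 (indicator S)" using S Sm by (auto simp: cpt_bdd_def)
    then have "integrable lborel (\<lambda>x. indicator S x * g x)"
      using integrable_cpt_bdd(1)[of S 1 "indicator S" g B] g by blast
    then have "integrable lborel (\<lambda>x. indicator S x *\<^sub>R g x)" by simp
    then show "integrable lebesgue (\<lambda>x. indicator S x *\<^sub>R g x)"
      using integrable_completion borel_measurable_integrable by blast
  qed
  fix \<phi> assume t: "test_function \<Omega> \<phi>"
  obtain K where K: "smooth_on UNIV \<phi>" "compact K" "K \<subseteq> \<Omega>" "\<And>z. z \<notin> K \<Longrightarrow> \<phi> z = 0"
    using test_functionD[OF t] by auto
  have t2: "test_function \<Omega> (foldr dir_deriv ds \<phi>)"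
    by (induction ds) (auto intro: test_function_dir_deriv t)
  obtain K2 where K2: "smooth_on UNIV (foldr dir_deriv ds \<phi>)" "compact K2" "K2 \<subseteq> \<Omega>" "\<And>z. z \<notin> K2 \<Longrightarrow> foldr dir_deriv ds \<phi> z = 0"
    using test_functionD[OF t2] by auto
  have cs: "continuous_on S f" if "smooth_on UNIV f" for S and f :: "'a \<Rightarrow> real"
    using smooth_on_continuous[OF smooth_on_subset[OF that subset_UNIV]] .
  have 1: "(\<lambda>k. \<integral>z. F k z * foldr dir_deriv ds \<phi> z \<partial>lborel) \<longlonglongrightarrow> (\<integral>z. u z * foldr dir_deriv ds \<phi> z \<partial>lborel)"
    by (rule test_limit[OF K2(2) cs[OF K2(1)] K2(4), where B=B])
      (use Fb K2(3) smooth_on_continuous[OF smooth_on_subset[OF F K2(3)]] in auto)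
  have 2: "(\<lambda>k. \<integral>z. foldr dir_deriv (rev ds) (F k) z * \<phi> z \<partial>lborel) \<longlonglongrightarrow> (\<integral>z. g z * \<phi> z \<partial>lborel)"
    by (rule test_limit[OF K(2) cs[OF K(1)] K(4), where B=B])
      (use Gb K(3) smooth_on_continuous[OF smooth_on_subset[OF smooth_foldr[OF F] K(3)]] in auto)
  have "(\<lambda>k. \<integral>z. F k z * foldr dir_deriv ds \<phi> z \<partial>lborel) \<longlonglongrightarrow> (- 1) ^ length ds * (\<integral>z. g z * \<phi> z \<partial>lborel)"
    unfolding iterated_integration_by_parts[OF \<Omega> F t] by (intro tendsto_mult tendsto_const 2)
  then have e: "(\<integral>z. u z * foldr dir_deriv ds \<phi> z \<partial>lborel) = (- 1) ^ length ds * (\<integral>z. g z * \<phi> z \<partial>lborel)"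
    using LIMSEQ_unique[OF 1] by blast
  have uK2: "continuous_on K2 u" by (rule continuous_on_subset[OF u K2(3)])
  have m1: "(\<lambda>z. u z * foldr dir_deriv ds \<phi> z) \<in> borel_measurable borel"
    using integrable_times_compact[OF K2(2) uK2 cs[OF K2(1)] K2(4)] borel_measurable_integrable by force
  have m2: "(\<lambda>z. g z * \<phi> z) \<in> borel_measurable borel"
    by (intro borel_measurable_times g borel_measurable_continuous_onI smooth_cont[OF K(1)])
  have s1: "set_lebesgue_integral lebesgue \<Omega> (\<lambda>z. u z * foldr dir_deriv ds \<phi> z) = (\<integral>z. u z * foldr dir_deriv ds \<phi> z \<partial>lborel)"
    by (rule set_integral_lebesgue_eq[OF m1]) (use K2(3,4) in auto)
  have s2: "set_lebesgue_integral lebesgue \<Omega> (\<lambda>z. g z * \<phi> z) = (\<integral>z. g z * \<phi> z \<partial>lborel)"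
    by (rule set_integral_lebesgue_eq[OF m2]) (use K(3,4) in auto)
  show "set_lebesgue_integral lebesgue \<Omega> (\<lambda>z. u z * foldr dir_deriv ds \<phi> z) = (- 1) ^ length ds * set_lebesgue_integral lebesgue \<Omega> (\<lambda>z. g z * \<phi> z)"
    unfolding s1 s2 by (rule e)
qed

text \<open>The truncation vanishes for \<open>u < 1/N\<close>, so it is smooth across the free boundary, where nothing is known about \<open>u\<close>.
  Its Hessian contains \<open>trunc2 N u\<close> times products of first derivatives, harmless because \<open>|\<nabla>u|\<^sup>2 \<le> C u\<close>.\<close>

lemma trunc_compose:
  fixes u :: "'a::euclidean_space \<Rightarrow> real"
  assumes \<Omega>: "open \<Omega>" and u: "continuous_on \<Omega> u" "\<And>z. z \<in> \<Omega> \<Longrightarrow> u z \<ge> 0" and P: "open P" "P \<subseteq> \<Omega>" "\<And>z. z \<in> \<Omega> \<Longrightarrow> z \<in> P \<longleftrightarrow> u z > 0"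
    and sm: "smooth_on P u" and N: "N > 0"
  shows "smooth_on \<Omega> (\<lambda>z. trunc N (u z))"
    and "z \<in> \<Omega> \<Longrightarrow> dir_deriv v (\<lambda>z. trunc N (u z)) z = trunc1 N (u z) * (indicator P z * dir_deriv v u z)"
    and "z \<in> \<Omega> \<Longrightarrow> dir_deriv w (dir_deriv v (\<lambda>z. trunc N (u z))) z =
      trunc1 N (u z) * (indicator P z * dir_deriv w (dir_deriv v u) z) + trunc2 N (u z) * (indicator P z * (dir_deriv w u z * dir_deriv v u z))"
proof -
  let ?F = "\<lambda>z. trunc N (u z)"
  let ?Z = "\<Omega> \<inter> u -` {..<1/N}"
  have Z: "open ?Z" by (rule continuous_open_preimage[OF u(1) \<Omega> open_lessThan])
  have FZ: "?F z = 0" if "z \<in> ?Z" for z using trunc_zero[OF N] that by auto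
  have zZ: "z \<in> ?Z" if "z \<in> \<Omega>" "z \<notin> P" for z
    using P(3)[OF that(1)] that u(2)[OF that(1)] N by auto
  have FP: "smooth_on P ?F" by (rule smooth_on_compose[OF P(1) open_UNIV _ sm smooth_trunc]) simp
  have sZ: "smooth_on ?Z ?F" by (rule smooth_on_cong_imp[OF Z FZ[symmetric] smooth_on_const])
  show "smooth_on \<Omega> ?F"
  proof (rule smooth_on_Union)
    fix z assume "z \<in> \<Omega>"
    then show "\<exists>T. open T \<and> z \<in> T \<and> smooth_on T ?F"
      using zZ[of z] P(1) Z FP sZ by (cases "z \<in> P") blast+
  qed
  have dP: "dir_deriv v ?F z = trunc1 N (u z) * dir_deriv v u z" if "z \<in> P" for v z
    by (rule dir_deriv_compose(2)[OF smooth_on_differentiable[OF sm that] trunc_deriv[OF N]])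
  have dZ: "dir_deriv v ?F z = 0" if "z \<in> ?Z" for v z
    using dir_deriv_cong_open(2)[OF Z that FZ smooth_on_differentiable[OF sZ that], of v] by (simp add: dir_deriv_const)
  show "dir_deriv v ?F z = trunc1 N (u z) * (indicator P z * dir_deriv v u z)" if "z \<in> \<Omega>"
    using dP[of z v] dZ[OF zZ[OF that], of v] by (cases "z \<in> P") auto
  show "dir_deriv w (dir_deriv v ?F) z =
      trunc1 N (u z) * (indicator P z * dir_deriv w (dir_deriv v u) z) + trunc2 N (u z) * (indicator P z * (dir_deriv w u z * dir_deriv v u z))" if z: "z \<in> \<Omega>"
  proof (cases "z \<in> P")
    case True
    have du: "u differentiable (at z)" "dir_deriv v u differentiable (at z)"
      using smooth_on_differentiable[OF sm True] smooth_on_differentiable[OF smooth_on_dir_deriv[OF sm] True] by auto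
    have "dir_deriv w (dir_deriv v ?F) z = dir_deriv w (\<lambda>z. trunc1 N (u z) * dir_deriv v u z) z"
      by (rule dir_deriv_cong_open(2)[OF P(1) True dP smooth_on_differentiable[OF smooth_on_dir_deriv[OF FP] True]])
    also have "\<dots> = trunc1 N (u z) * dir_deriv w (dir_deriv v u) z + trunc2 N (u z) * dir_deriv w u z * dir_deriv v u z"
      unfolding dir_deriv_mult[OF dir_deriv_compose(1)[OF du(1) trunc1_deriv] du(2)] dir_deriv_compose(2)[OF du(1) trunc1_deriv] ..
    finally show ?thesis using True by simp
  next
    case False
    have "dir_deriv w (dir_deriv v ?F) z = dir_deriv w (\<lambda>z. 0) z"
      by (rule dir_deriv_cong_open(2)[OF Z zZ[OF z False] dZ smooth_on_differentiable[OF smooth_on_dir_deriv[OF sZ] zZ[OF z False]]])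
    then show ?thesis using False by (simp add: dir_deriv_const)
  qed
qed

lemma measurable_indicator_open:
  fixes f :: "'a::euclidean_space \<Rightarrow> real"
  assumes "open P" "continuous_on P f"
  shows "(\<lambda>z. indicator P z * f z) \<in> borel_measurable borel"
  using borel_measurable_continuous_on_indicator[OF borel_open[OF assms(1)] assms(2)] by simp

text \<open>The truncations and their derivatives vanish off \<open>P\<close> and converge on
  \<open>P\<close> to the classical ones, with bounds free of N. The limit derivative is thus the
  extension by 0, and the free boundary carries no singular part.\<close>

lemma truncation_weak_derivs:
  fixes u :: "'n::finite spacetime \<Rightarrow> real"
  assumes \<Omega>: "open \<Omega>" and u: "continuous_on \<Omega> u" "\<And>z. z \<in> \<Omega> \<Longrightarrow> 0 \<le> u z" "\<And>z. z \<in> \<Omega> \<Longrightarrow> u z \<le> K" and P: "open P" "P \<subseteq> \<Omega>" "\<And>z. z \<in> \<Omega> \<Longrightarrow> z \<in> P \<longleftrightarrow> u z > 0"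
    and sm: "smooth_on P u" and C: "C \<ge> 0"
  shows "(\<And>z. z \<in> P \<Longrightarrow> \<bar>dir_deriv v u z\<bar> \<le> C) \<Longrightarrow> has_weak_deriv \<Omega> [v] u (\<lambda>z. indicator P z * dir_deriv v u z)"
    and "(\<And>z. z \<in> P \<Longrightarrow> \<bar>dir_deriv w (dir_deriv v u) z\<bar> \<le> C) \<Longrightarrow> (\<And>z. z \<in> P \<Longrightarrow> (dir_deriv v u z)\<^sup>2 \<le> C * u z) \<Longrightarrow>
        (\<And>z. z \<in> P \<Longrightarrow> (dir_deriv w u z)\<^sup>2 \<le> C * u z) \<Longrightarrow>
        has_weak_deriv \<Omega> [v, w] u (\<lambda>z. indicator P z * dir_deriv w (dir_deriv v u) z)"
proof -
  let ?F = "\<lambda>k z. trunc (real (Suc k)) (u z)"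
  have Np: "real (Suc k) > 0" for k by simp
  have tc1: "smooth_on \<Omega> (?F k)" for k by (rule trunc_compose(1)[OF \<Omega> u(1,2) P sm Np])
  have tc2: "dir_deriv v (?F k) z = trunc1 (real (Suc k)) (u z) * (indicator P z * dir_deriv v u z)" if "z \<in> \<Omega>" for k z v
    by (rule trunc_compose(2)[OF \<Omega> u(1,2) P sm Np that])
  have tc3: "dir_deriv w (dir_deriv v (?F k)) z = trunc1 (real (Suc k)) (u z) * (indicator P z * dir_deriv w (dir_deriv v u) z)
      + trunc2 (real (Suc k)) (u z) * (indicator P z * (dir_deriv w u z * dir_deriv v u z))" if "z \<in> \<Omega>" for k z v w
    by (rule trunc_compose(3)[OF \<Omega> u(1,2) P sm Np that])
  have Fb: "\<bar>?F k z\<bar> \<le> K" if "z \<in> \<Omega>" for k z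
    using trunc_bounds(1,2)[OF Np[of k] u(2)[OF that]] u(3)[OF that] by linarith
  have Fl: "(\<lambda>k. ?F k z) \<longlonglongrightarrow> u z" if "z \<in> \<Omega>" for z
  proof (cases "u z > 0")
    case True then show ?thesis by (rule trunc_limits(1))
  next
    case False
    then have "u z = 0" using u(2)[OF that] by simp
    then show ?thesis using trunc_zero[OF Np] by simp
  qed
  have t1: "(\<lambda>k. trunc1 (real (Suc k)) (u z) * (indicator P z * a)) \<longlonglongrightarrow> indicator P z * a" if "z \<in> \<Omega>" for z a
  proof (cases "z \<in> P")
    case True
    then have "u z > 0" using P(3)[OF that] by simp
    from tendsto_mult[OF trunc_limits(2)[OF this] tendsto_const[of a]] show ?thesis using True by simp
  qed simp
  have t1b: "\<bar>trunc1 (real (Suc k)) (u z) * (indicator P z * a)\<bar> \<le> C" if "z \<in> \<Omega>" "z \<in> P \<Longrightarrow> \<bar>a\<bar> \<le> C" for z a k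
  proof -
    have "\<bar>trunc1 (real (Suc k)) (u z)\<bar> * \<bar>indicator P z * a\<bar> \<le> 1 * C"
      using trunc_bounds(3,4)[OF Np[of k] u(2)[OF that(1)]] that(2) C by (intro mult_mono) (auto simp: indicator_def)
    then show ?thesis by (simp add: abs_mult)
  qed
  have cP: "continuous_on P f" if "smooth_on P f" for f :: "'n spacetime \<Rightarrow> real" by (rule smooth_on_continuous[OF that])
  have ib: "\<bar>indicator P z * a\<bar> \<le> C" if "z \<in> P \<Longrightarrow> \<bar>a\<bar> \<le> C" for z and a :: real
    using that C by (auto simp: indicator_def)
  show "has_weak_deriv \<Omega> [v] u (\<lambda>z. indicator P z * dir_deriv v u z)" if b: "\<And>z. z \<in> P \<Longrightarrow> \<bar>dir_deriv v u z\<bar> \<le> C"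
  proof (rule weak_deriv_by_approximation[OF \<Omega> u(1) tc1, where B="max K C"])
    fix z assume z: "z \<in> \<Omega>"
    show "\<bar>?F k z\<bar> \<le> max K C" for k using Fb[OF z, of k] by simp
    show "(\<lambda>k. ?F k z) \<longlonglongrightarrow> u z" by (rule Fl[OF z])
    show "\<bar>foldr dir_deriv (rev [v]) (?F k) z\<bar> \<le> max K C" for k
      using t1b[where z=z and k=k and a="dir_deriv v u z", OF z b] tc2[OF z] by simp
    show "(\<lambda>k. foldr dir_deriv (rev [v]) (?F k) z) \<longlonglongrightarrow> indicator P z * dir_deriv v u z"
      using t1[OF z, of "dir_deriv v u z"] tc2[OF z] by simp
  next
    show "(\<lambda>z. indicator P z * dir_deriv v u z) \<in> borel_measurable borel"
      by (rule measurable_indicator_open[OF P(1) cP[OF smooth_on_dir_deriv[OF sm]]])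
    show "\<bar>indicator P z * dir_deriv v u z\<bar> \<le> max K C" for z using ib[where z=z and a="dir_deriv v u z", OF b] by (simp add: le_max_iff_disj)
  qed
  show "has_weak_deriv \<Omega> [v, w] u (\<lambda>z. indicator P z * dir_deriv w (dir_deriv v u) z)"
    if b: "\<And>z. z \<in> P \<Longrightarrow> \<bar>dir_deriv w (dir_deriv v u) z\<bar> \<le> C" and bv: "\<And>z. z \<in> P \<Longrightarrow> (dir_deriv v u z)\<^sup>2 \<le> C * u z"
      and bw: "\<And>z. z \<in> P \<Longrightarrow> (dir_deriv w u z)\<^sup>2 \<le> C * u z"
  proof -
    \<comment> \<open>By the arithmetic-geometric mean inequality even a mixed product is at most C
      u, and the factor u is what tames \<open>trunc2\<close>.\<close>
    have prod: "\<bar>dir_deriv w u z * dir_deriv v u z\<bar> \<le> C * u z" if "z \<in> P" for z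
    proof -
      have "2 * (\<bar>dir_deriv w u z\<bar> * \<bar>dir_deriv v u z\<bar>) \<le> (dir_deriv w u z)\<^sup>2 + (dir_deriv v u z)\<^sup>2"
        using sum_squares_bound[of "\<bar>dir_deriv w u z\<bar>" "\<bar>dir_deriv v u z\<bar>"] by simp
      then show ?thesis using bv[OF that] bw[OF that] by (simp add: abs_mult)
    qed
    have t2b: "\<bar>trunc2 (real (Suc k)) (u z) * (indicator P z * (dir_deriv w u z * dir_deriv v u z))\<bar> \<le> 1792 * C" if "z \<in> \<Omega>" for k z
    proof (cases "z \<in> P")
      case True
      have t0: "trunc2 (real (Suc k)) (u z) \<ge> 0" by (simp add: trunc2_def flat_nonneg)
      have "\<bar>trunc2 (real (Suc k)) (u z) * (dir_deriv w u z * dir_deriv v u z)\<bar> \<le> trunc2 (real (Suc k)) (u z) * (C * u z)"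
        using mult_left_mono[OF prod[OF True] t0] t0 by (simp add: abs_mult)
      also have "\<dots> = C * (trunc2 (real (Suc k)) (u z) * u z)" by simp
      also have "\<dots> \<le> C * 1792" using trunc2_bound(2)[OF Np[of k] u(2)[OF that]] C by (intro mult_left_mono)
      finally show ?thesis using True by simp
    qed (use C in simp)
    have t2: "(\<lambda>k. trunc2 (real (Suc k)) (u z) * (indicator P z * a)) \<longlonglongrightarrow> 0" if "z \<in> \<Omega>" for z a
    proof (cases "z \<in> P")
      case True
      then have "u z > 0" using P(3)[OF that] by simp
      from tendsto_mult_left_zero[OF trunc_limits(3)[OF this]] show ?thesis using True by simp
    qed simp
    show ?thesis
    proof (rule weak_deriv_by_approximation[OF \<Omega> u(1) tc1, where B="max K (C + 1792 * C)"])
      fix z assume z: "z \<in> \<Omega>"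
      show "\<bar>?F k z\<bar> \<le> max K (C + 1792 * C)" for k using Fb[OF z, of k] by simp
      show "(\<lambda>k. ?F k z) \<longlonglongrightarrow> u z" by (rule Fl[OF z])
      have e: "foldr dir_deriv (rev [v, w]) (?F k) z = trunc1 (real (Suc k)) (u z) * (indicator P z * dir_deriv w (dir_deriv v u) z)
          + trunc2 (real (Suc k)) (u z) * (indicator P z * (dir_deriv w u z * dir_deriv v u z))" for k
        using tc3[OF z] by simp
      show "\<bar>foldr dir_deriv (rev [v, w]) (?F k) z\<bar> \<le> max K (C + 1792 * C)" for k
        unfolding e using t1b[where z=z and k=k and a="dir_deriv w (dir_deriv v u) z", OF z b] t2b[OF z, of k] abs_triangle_ineq
        by (smt (verit) max.cobounded2)
      show "(\<lambda>k. foldr dir_deriv (rev [v, w]) (?F k) z) \<longlonglongrightarrow> indicator P z * dir_deriv w (dir_deriv v u) z"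
        unfolding e using tendsto_add[OF t1[OF z, of "dir_deriv w (dir_deriv v u) z"] t2[OF z, of "dir_deriv w u z * dir_deriv v u z"]] by simp
    next
      show "(\<lambda>z. indicator P z * dir_deriv w (dir_deriv v u) z) \<in> borel_measurable borel"
        by (rule measurable_indicator_open[OF P(1) cP[OF smooth_on_dir_deriv[OF smooth_on_dir_deriv[OF sm]]]])
      show "\<bar>indicator P z * dir_deriv w (dir_deriv v u) z\<bar> \<le> max K (C + 1792 * C)" for z
        using ib[where z=z and a="dir_deriv w (dir_deriv v u) z", OF b] C by (simp add: le_max_iff_disj)
    qed
  qed
qed

section \<open>Consequences of the hypotheses\<close>

text \<open>Nonempty open sets are not negligible. This turns almost-everywhere information into a
  point: for the pointwise bound of the continuous \<open>u\<close>, and for the size of the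
  constant value of \<open>f\<close>.\<close>

lemma AE_open_witness:
  fixes S :: "'a::euclidean_space set"
  assumes "open S" "S \<noteq> {}" "AE z in lebesgue. z \<in> S \<longrightarrow> Q z"
  shows "\<exists>z\<in>S. Q z"
proof (rule ccontr)
  assume "\<not> (\<exists>z\<in>S. Q z)"
  with assms(3) have "AE z in lebesgue. z \<notin> S" by (auto elim!: eventually_mono)
  moreover have "S \<in> sets lebesgue" using assms(1) by (simp add: borel_open)
  ultimately have "S \<in> null_sets lebesgue" by (simp add: AE_iff_null_sets)
  then have "negligible S" by (simp add: negligible_iff_null_sets)
  then show False using open_not_negligible[OF assms(1,2)] by blast
qed

lemma Linf_norm_AE:
  assumes "\<Omega> \<in> sets lebesgue" "Linf_norm \<Omega> g \<le> ereal K"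
  shows "AE z in lebesgue. z \<in> \<Omega> \<longrightarrow> norm (g z) \<le> K"
proof -
  have "AE z in lebesgue_on \<Omega>. ereal (norm (g z)) \<le> ereal K"
    using esssup_AE[of "\<lambda>z. ereal (norm (g z))" "lebesgue_on \<Omega>"] assms(2) unfolding Linf_norm_def
    by (elim eventually_mono) (rule order_trans)
  then show ?thesis using assms(1) by (simp add: AE_restrict_space_iff)
qed

lemma Linf_norm_le:
  assumes "g \<in> borel_measurable (lebesgue_on \<Omega>)" "\<And>z. z \<in> \<Omega> \<Longrightarrow> norm (g z) \<le> K"
  shows "Linf_norm \<Omega> g \<le> ereal K"
  unfolding Linf_norm_def
proof (rule esssup_I)
  show "(\<lambda>z. ereal (norm (g z))) \<in> borel_measurable (lebesgue_on \<Omega>)" using assms(1) by measurable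
  show "AE z in lebesgue_on \<Omega>. ereal (norm (g z)) \<le> ereal K" using assms(2) by (intro AE_I2) auto
qed

lemma borel_imp_lebesgue_on: "g \<in> borel_measurable borel \<Longrightarrow> g \<in> borel_measurable (lebesgue_on \<Omega>)"
  by (intro measurable_restrict_space1 measurable_completion) simp

text \<open>Signs and bounds of \<open>f\<close> integrate to the two inequalities against
  nonnegative test functions, and on the positivity set \<open>f\<close> may be replaced by its
  constant under the integral. The constant in the conclusion may differ from the given one.\<close>

lemma hypotheses_admissible:
  fixes f u :: "'n::finite spacetime \<Rightarrow> real"
  assumes K: "K > 0" and f: "f \<in> borel_measurable (lebesgue_on (Q0 1))" "AE z in lebesgue_on (Q0 1). f z \<le> 0" "Linf_norm (Q0 1) f \<le> ereal K"
    and u: "continuous_on (Q0 1) u" "\<forall>z \<in> Q0 1. u z \<ge> 0" "weak_heat_solution (Q0 1) f u" "Linf_norm (Q0 1) u \<le> ereal K"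
    and c: "AE z in lebesgue_on (positivity_set u \<inter> Q0 1). f z = c"
  shows "\<exists>c. admissible K u c"
proof -
  let ?Q = "Q0 1 :: 'n spacetime set" and ?P = "positivity_set u"
  have Q: "open ?Q" by (rule parabolic_cylinder_open)
  have Ql: "?Q \<in> sets lebesgue" using Q by (simp add: borel_open)
  have P: "open ?P" by (rule open_positivity[OF u(1)])
  have Pl: "?P \<in> sets lebesgue" using P by (simp add: borel_open)
  have PQ: "?P \<inter> ?Q = ?P" using positivity_subset by blast
  have fle: "AE z in lebesgue. z \<in> ?Q \<longrightarrow> f z \<le> 0" using f(2) Ql by (simp add: AE_restrict_space_iff)
  have fb: "AE z in lebesgue. z \<in> ?Q \<longrightarrow> \<bar>f z\<bar> \<le> K" using Linf_norm_AE[OF Ql f(3)] by simp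
  have fc: "AE z in lebesgue. z \<in> ?P \<longrightarrow> f z = c" using c Pl unfolding PQ by (simp add: AE_restrict_space_iff)
  have ub: "AE z in lebesgue. z \<in> ?Q \<longrightarrow> \<bar>u z\<bar> \<le> K" using Linf_norm_AE[OF Ql u(4)] by simp
  have uK: "u z \<le> K" if "z \<in> ?Q" for z
  proof (rule ccontr)
    assume "\<not> u z \<le> K"
    \<comment> \<open>If \<open>u\<close> exceeded \<open>K\<close> somewhere it would do so on a
      nonempty open set, against the essential bound.\<close>
    let ?S = "?Q \<inter> u -` {K<..}"
    have "open ?S" by (rule continuous_open_preimage[OF u(1) Q open_greaterThan])
    moreover have "z \<in> ?S" using that \<open>\<not> u z \<le> K\<close> by auto
    moreover have "AE z in lebesgue. z \<in> ?S \<longrightarrow> \<bar>u z\<bar> \<le> K" using ub by eventually_elim blast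
    ultimately have "\<exists>w\<in>?S. \<bar>u w\<bar> \<le> K" by (intro AE_open_witness) blast+
    then obtain w where "w \<in> ?S" "\<bar>u w\<bar> \<le> K" by blast
    then show False by auto
  qed
  have weak: "(\<integral>z. u z * adj_heat \<phi> z \<partial>lborel) = (\<integral>z. indicator ?Q z * (f z * \<phi> z) \<partial>lebesgue)"
    if t: "test_function ?Q \<phi>" for \<phi>
  proof -
    obtain Kc where Kc: "smooth_on UNIV \<phi>" "compact Kc" "Kc \<subseteq> ?Q" "\<And>z. z \<notin> Kc \<Longrightarrow> \<phi> z = 0"
      using test_functionD[OF t] by auto
    have m: "(\<lambda>z. u z * adj_heat \<phi> z) \<in> borel_measurable borel"
      using borel_measurable_integrable[OF integrable_adj_heat[OF Kc(1,2,4) continuous_on_subset[OF u(1) Kc(3)]]] by simp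
    have "(\<integral>z. u z * adj_heat \<phi> z \<partial>lborel) = set_lebesgue_integral lebesgue ?Q (\<lambda>z. u z * adj_heat \<phi> z)"
    proof (rule set_integral_lebesgue_eq[OF m, symmetric])
      fix z assume "z \<notin> ?Q"
      then have "z \<notin> Kc" using Kc(3) by blast
      then show "u z * adj_heat \<phi> z = 0" using adj_heat_vanish[OF compact_imp_closed[OF Kc(2)] Kc(4)] by simp
    qed
    also have "\<dots> = set_lebesgue_integral lebesgue ?Q (\<lambda>z. f z * \<phi> z)"
      using u(3) t unfolding weak_heat_solution_def adj_heat_def by blast
    finally show ?thesis by (simp add: set_lebesgue_integral_def)
  qed
  have H: "heat_ineq ?Q u K" unfolding heat_ineq_def
  proof (intro allI impI, elim conjE)
    fix \<phi> :: "'n spacetime \<Rightarrow> real" assume t: "test_function ?Q \<phi>" and pos: "\<forall>z. 0 \<le> \<phi> z"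
    obtain Kc where Kc: "smooth_on UNIV \<phi>" "compact Kc" "Kc \<subseteq> ?Q" "\<And>z. z \<notin> Kc \<Longrightarrow> \<phi> z = 0"
      using test_functionD[OF t] by auto
    have i\<phi>: "integrable lborel \<phi>" by (rule integrable_smooth_compact[OF Kc(1,2,4)])
    then have i\<phi>': "integrable lebesgue \<phi>" and e\<phi>: "integral\<^sup>L lebesgue \<phi> = integral\<^sup>L lborel \<phi>"
      using integrable_completion[of \<phi> lborel] integral_completion[of \<phi> lborel] borel_measurable_integrable[OF i\<phi>] by auto
    let ?I = "\<lambda>z. indicator ?Q z * (f z * \<phi> z)"
    have "0 \<le> (\<integral>z. - ?I z \<partial>lebesgue)"
    proof (rule integral_nonneg_AE)
      show "AE z in lebesgue. 0 \<le> - ?I z" using fle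
        by (elim AE_mp) (use pos in \<open>auto simp: indicator_def mult_nonpos_nonneg\<close>)
    qed
    then have 1: "integral\<^sup>L lebesgue ?I \<le> 0" by simp
    have p0: "integral\<^sup>L lborel \<phi> \<ge> 0" by (rule Bochner_Integration.integral_nonneg) (use pos in blast)
    have 2: "- K * integral\<^sup>L lborel \<phi> \<le> integral\<^sup>L lebesgue ?I"
    proof (cases "integrable lebesgue ?I")
      case True
      have "0 \<le> (\<integral>z. ?I z + K * \<phi> z \<partial>lebesgue)"
      proof (rule integral_nonneg_AE)
        show "AE z in lebesgue. 0 \<le> ?I z + K * \<phi> z" using fb
        proof (elim AE_mp, intro AE_I2 impI)
          fix z assume a: "z \<in> ?Q \<longrightarrow> \<bar>f z\<bar> \<le> K"
          show "0 \<le> ?I z + K * \<phi> z"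
          proof (cases "z \<in> ?Q")
            case True
            then have "0 \<le> f z + K" using a by auto
            then have "0 \<le> (f z + K) * \<phi> z" using spec[OF pos, of z] by (rule mult_nonneg_nonneg)
            then show ?thesis using True by (simp add: algebra_simps)
          qed (use spec[OF pos, of z] K in simp)
        qed
      qed
      also have "\<dots> = integral\<^sup>L lebesgue ?I + K * integral\<^sup>L lborel \<phi>" using True i\<phi>' e\<phi> by simp
      finally show ?thesis by simp
    next
      case False
      \<comment> \<open>A non-integrable function has integral 0 by convention, and the left side is
        nonpositive.\<close>
      then show ?thesis using p0 K by (simp add: not_integrable_integral_eq)
    qed
    show "- K * integral\<^sup>L lborel \<phi> \<le> (\<integral>z. u z * adj_heat \<phi> z \<partial>lborel) \<and> (\<integral>z. u z * adj_heat \<phi> z \<partial>lborel) \<le> 0"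
      unfolding weak[OF t] using 1 2 by blast
  qed
  have cal: "(\<integral>z. u z * adj_heat \<phi> z \<partial>lborel) = c * integral\<^sup>L lborel \<phi>" if t: "test_function ?P \<phi>" for \<phi>
  proof -
    have tQ: "test_function ?Q \<phi>" by (rule test_function_mono[OF t positivity_subset])
    obtain Kc where Kc: "smooth_on UNIV \<phi>" "compact Kc" "Kc \<subseteq> ?P" "\<And>z. z \<notin> Kc \<Longrightarrow> \<phi> z = 0"
      using test_functionD[OF t] by auto
    have m\<phi>: "\<phi> \<in> borel_measurable borel" by (rule borel_measurable_continuous_onI[OF smooth_cont[OF Kc(1)]])
    then have m\<phi>': "\<phi> \<in> borel_measurable lebesgue" by (intro measurable_completion) simp
    have "(\<lambda>z. indicator ?Q z *\<^sub>R f z) \<in> borel_measurable lebesgue"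
      using f(1) Ql by (subst (asm) borel_measurable_restrict_space_iff) auto
    then have "(\<lambda>z. (indicator ?Q z *\<^sub>R f z) * \<phi> z) \<in> borel_measurable lebesgue" using m\<phi>' by (rule borel_measurable_times)
    then have mI: "(\<lambda>z. indicator ?Q z * (f z * \<phi> z)) \<in> borel_measurable lebesgue" by (simp add: mult.assoc)
    have "(\<integral>z. indicator ?Q z * (f z * \<phi> z) \<partial>lebesgue) = (\<integral>z. c * \<phi> z \<partial>lebesgue)"
    proof (rule integral_cong_AE[OF mI])
      show "(\<lambda>z. c * \<phi> z) \<in> borel_measurable lebesgue" using m\<phi>' by (intro borel_measurable_times borel_measurable_const)
      show "AE z in lebesgue. indicator ?Q z * (f z * \<phi> z) = c * \<phi> z" using fc
      proof (elim AE_mp, intro AE_I2 impI)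
        fix z assume a: "z \<in> ?P \<longrightarrow> f z = c"
        show "indicator ?Q z * (f z * \<phi> z) = c * \<phi> z"
        proof (cases "z \<in> Kc")
          case True
          then have "z \<in> ?P" "z \<in> ?Q" using Kc(3) positivity_subset[of u] by blast+
          then show ?thesis using a by simp
        qed (simp add: Kc(4))
      qed
    qed
    also have "\<dots> = c * integral\<^sup>L lborel \<phi>" using integral_completion[of \<phi> lborel] m\<phi> by simp
    finally show ?thesis unfolding weak[OF tQ] .
  qed
  show ?thesis
  \<comment> \<open>If \<open>u\<close> vanishes identically the given \<open>c\<close> is arbitrary
    and 0 takes its place. Otherwise some point satisfies both \<open>f z = c\<close> and
    \<open>\<bar>f z\<bar> \<le> K\<close>, which bounds \<open>c\<close>.\<close>
  proof (cases "?P = {}")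
    case True
    have "integral\<^sup>L lborel (\<lambda>z. u z * adj_heat \<phi> z) = 0 * integral\<^sup>L lborel \<phi>" if t: "test_function ?P \<phi>" for \<phi>
    proof -
      obtain Kc where Kc: "Kc \<subseteq> ?P" "\<And>z. z \<notin> Kc \<Longrightarrow> \<phi> z = 0" using test_functionD[OF t] by auto
      then have "\<phi> = (\<lambda>z. 0)" using True by auto
      then have "integral\<^sup>L lborel \<phi> = 0" by simp
      then show ?thesis using cal[OF t] by simp
    qed
    then show ?thesis using K u uK H unfolding admissible_def by (intro exI[of _ 0]) auto
  next
    case False
    have "AE z in lebesgue. z \<in> ?P \<longrightarrow> (f z = c \<and> \<bar>f z\<bar> \<le> K)"
      using fc fb by eventually_elim (use positivity_subset[of u] in blast)
    from AE_open_witness[OF P False this] obtain z where "f z = c" "\<bar>f z\<bar> \<le> K" by blast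
    then have "\<bar>c\<bar> \<le> K" by simp
    then show ?thesis using u uK H cal unfolding admissible_def by (intro exI[of _ c]) auto
  qed
qed

section \<open>Assembly of the final estimate\<close>

lemma norm_matrix_le:
  fixes A :: "real ^ 'n::finite ^ 'n"
  assumes "\<And>i j. \<bar>A $ i $ j\<bar> \<le> C"
  shows "norm A \<le> real CARD('n) * real CARD('n) * C"
proof -
  have "norm A \<le> (\<Sum>i\<in>UNIV. norm (A $ i))" unfolding norm_vec_def by (rule L2_set_le_sum) simp
  also have "\<dots> \<le> (\<Sum>i\<in>UNIV. \<Sum>j\<in>UNIV. \<bar>A $ i $ j\<bar>)" by (intro sum_mono norm_le_l1_cart)
  also have "\<dots> \<le> (\<Sum>i\<in>(UNIV::'n set). \<Sum>j\<in>(UNIV::'n set). C)" by (intro sum_mono assms)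
  finally show ?thesis by (simp add: mult.assoc)
qed

lemma gderiv_slice:
  fixes u :: "'n::finite spacetime \<Rightarrow> real"
  assumes "u differentiable (at (y, \<tau>))"
  shows "GDERIV (\<lambda>x. u (x, \<tau>)) y :> (\<chi> i. dir_deriv (space_dir i) u (y, \<tau>))"
proof -
  let ?z = "(y, \<tau>)"
  have p: "((\<lambda>x. (x, \<tau>)) has_derivative (\<lambda>h. (h, 0))) (at y)"
    by (intro has_derivative_Pair has_derivative_ident has_derivative_const)
  have d: "((\<lambda>x. u (x, \<tau>)) has_derivative (\<lambda>h. dir_deriv (h, 0) u ?z)) (at y)"
    using has_derivative_compose[OF p, of u "\<lambda>v. dir_deriv v u ?z"] dir_deriv_has_derivative[OF assms] by simp
  have l: "linear (\<lambda>v. dir_deriv v u ?z)" using has_derivative_linear[OF dir_deriv_has_derivative[OF assms]] .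
  have "dir_deriv (h, 0) u ?z = h \<bullet> (\<chi> i. dir_deriv (space_dir i) u ?z)" for h :: "real ^ 'n"
  proof -
    have "(h, 0::real) = (\<Sum>i\<in>UNIV. (h $ i) *\<^sub>R space_dir i)"
    proof (rule prod_eqI)
      have "fst (\<Sum>i\<in>UNIV. (h $ i) *\<^sub>R space_dir i) = (\<Sum>i\<in>UNIV. (h $ i) *\<^sub>R axis i (1::real))"
        by (simp add: fst_sum space_dir_def)
      also have "\<dots> = h" by (simp add: vec_eq_iff axis_def if_distrib cong: if_cong)
      finally show "fst (h, 0::real) = fst (\<Sum>i\<in>UNIV. (h $ i) *\<^sub>R space_dir i)" by simp
      show "snd (h, 0::real) = snd (\<Sum>i\<in>UNIV. (h $ i) *\<^sub>R space_dir i)" by (simp add: snd_sum space_dir_def)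
    qed
    then have "dir_deriv (h, 0) u ?z = (\<Sum>i\<in>UNIV. h $ i * dir_deriv (space_dir i) u ?z)"
      using linear_sum[OF l, of "\<lambda>i. (h $ i) *\<^sub>R space_dir i" UNIV] linear_cmul[OF l] by simp
    then show ?thesis by (simp add: inner_vec_def)
  qed
  then show ?thesis using d by (simp add: gderiv_def)
qed

theorem corollary3p5:
  fixes K :: real
  assumes "K > 0"
  shows "\<exists>C>0. \<forall>(f :: 'n::finite spacetime \<Rightarrow> real) (u :: 'n spacetime \<Rightarrow> real).
    f \<in> borel_measurable (lebesgue_on (Q0 1)) \<and>
    (AE z in lebesgue_on (Q0 1). f z \<le> 0) \<and>
    Linf_norm (Q0 1) f \<le> ereal K \<and>
    continuous_on (Q0 1) u \<and>
    (\<forall>z \<in> Q0 1. u z \<ge> 0) \<and>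
    weak_heat_solution (Q0 1) f u \<and>
    Linf_norm (Q0 1) u \<le> ereal K \<and>
    (\<exists>c. AE z in lebesgue_on (positivity_set u \<inter> Q0 1). f z = c)
    \<longrightarrow>
    (\<exists>ut H. has_weak_time_deriv (Q0 (1/2)) u ut \<and>
            has_weak_hessian (Q0 (1/2)) u H \<and>
            Linf_norm (Q0 (1/2)) ut + Linf_norm (Q0 (1/2)) H \<le> ereal C) \<and>
    (\<forall>y \<tau>. (y, \<tau>) \<in> positivity_set u \<inter> Q0 (1/2) \<longrightarrow>
       (\<exists>g. GDERIV (\<lambda>x. u (x, \<tau>)) y :> g \<and>
            norm g \<le> C * Sup {\<rho>. \<rho> > 0 \<and> parabolic_cylinder \<rho> (y, \<tau>) \<subseteq> positivity_set u}))"
proof -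
  obtain C where C: "C > 0" "\<And>(u :: 'n spacetime \<Rightarrow> real) c. admissible K u c \<Longrightarrow> smooth_on (positivity_set u \<inter> Q0 (1/2)) u \<and>
     (\<forall>z \<in> positivity_set u \<inter> Q0 (1/2). \<bar>dir_deriv time_dir u z\<bar> \<le> C \<and>
       (\<forall>i. \<bar>dir_deriv (space_dir i) u z\<bar> \<le> C * Sup (radii u z)) \<and>
       (\<forall>i j. \<bar>dir_deriv (space_dir i) (dir_deriv (space_dir j) u) z\<bar> \<le> C) \<and>
       (\<forall>i. (dir_deriv (space_dir i) u z)\<^sup>2 \<le> C * u z))"
    using pointwise_estimates[OF assms, where 'n='n] by blast
  let ?n = "real CARD('n)"
  \<comment> \<open>One C for the time derivative, n^2 C for the Frobenius norm of the Hessian, n C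
    for the gradient; both norms are estimated by sums of absolute values of the entries.\<close>
  define D where "D = C + ?n * ?n * C + ?n * C"
  have D: "D > 0" "C + ?n * ?n * C \<le> D" "?n * C \<le> D" using C(1) by (auto simp: D_def add_pos_nonneg)
  have main: "(\<exists>ut H. has_weak_time_deriv (Q0 (1/2)) u ut \<and>
            has_weak_hessian (Q0 (1/2)) u H \<and>
            Linf_norm (Q0 (1/2)) ut + Linf_norm (Q0 (1/2)) H \<le> ereal D) \<and>
    (\<forall>y \<tau>. (y, \<tau>) \<in> positivity_set u \<inter> Q0 (1/2) \<longrightarrow>
       (\<exists>g. GDERIV (\<lambda>x. u (x, \<tau>)) y :> g \<and>
            norm g \<le> D * Sup {\<rho>. \<rho> > 0 \<and> parabolic_cylinder \<rho> (y, \<tau>) \<subseteq> positivity_set u}))"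
    if ad: "admissible K u c" for u :: "'n spacetime \<Rightarrow> real" and c
  proof -
    let ?O = "Q0 (1/2) :: 'n spacetime set"
    define P where "P = positivity_set u \<inter> ?O"
    have u: "continuous_on (Q0 1) u" "\<forall>z\<in>Q0 1. 0 \<le> u z \<and> u z \<le> K" using ad by (auto simp: admissible_def)
    have O: "open ?O" by (rule parabolic_cylinder_open)
    have OQ: "?O \<subseteq> Q0 1" by (rule cylinder_mono) auto
    have P: "open P" "P \<subseteq> ?O" unfolding P_def using open_positivity[OF u(1)] O by auto
    have Pi: "z \<in> P \<longleftrightarrow> u z > 0" if "z \<in> ?O" for z using that OQ by (auto simp: P_def positivity_set_def)
    have uO: "continuous_on ?O u" "\<And>z. z \<in> ?O \<Longrightarrow> 0 \<le> u z" "\<And>z. z \<in> ?O \<Longrightarrow> u z \<le> K"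
      using continuous_on_subset[OF u(1) OQ] u(2) OQ by blast+
    have est: "smooth_on P u" "\<And>z. z \<in> P \<Longrightarrow> \<bar>dir_deriv time_dir u z\<bar> \<le> C"
       "\<And>z i. z \<in> P \<Longrightarrow> \<bar>dir_deriv (space_dir i) u z\<bar> \<le> C * Sup (radii u z)"
       "\<And>z i j. z \<in> P \<Longrightarrow> \<bar>dir_deriv (space_dir i) (dir_deriv (space_dir j) u) z\<bar> \<le> C"
       "\<And>z i. z \<in> P \<Longrightarrow> (dir_deriv (space_dir i) u z)\<^sup>2 \<le> C * u z"
      using C(2)[OF ad] unfolding P_def by blast+
    have C0: "C \<ge> 0" using C(1) by simp
    define ut where "ut = (\<lambda>z. indicator P z * dir_deriv time_dir u z)"
    \<comment> \<open>The indices are interchanged because integrating by parts reverses the order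
      of the derivatives; the symmetry of second derivatives is thereby never invoked.\<close>
    define H :: "'n spacetime \<Rightarrow> real ^ 'n ^ 'n" where
      "H = (\<lambda>z. \<chi> i j. indicator P z * dir_deriv (space_dir j) (dir_deriv (space_dir i) u) z)"
    have w1: "has_weak_time_deriv ?O u ut" unfolding has_weak_time_deriv_def ut_def
      by (rule truncation_weak_derivs(1)[OF O uO P Pi est(1) C0 est(2)])
    have w2: "has_weak_hessian ?O u H" unfolding has_weak_hessian_def H_def
    proof (intro allI)
      fix i j
      have "has_weak_deriv ?O [space_dir i, space_dir j] u (\<lambda>z. indicator P z * dir_deriv (space_dir j) (dir_deriv (space_dir i) u) z)"
        by (rule truncation_weak_derivs(2)[OF O uO P Pi est(1) C0 est(4,5,5)])
      then show "has_weak_deriv ?O [space_dir i, space_dir j] u (\<lambda>z. (\<chi> i j. indicator P z * dir_deriv (space_dir j) (dir_deriv (space_dir i) u) z) $ i $ j)"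
        by simp
    qed
    have m: "(\<lambda>z. indicator P z * f z) \<in> borel_measurable borel" if "smooth_on P f" for f :: "'n spacetime \<Rightarrow> real"
      by (rule measurable_indicator_open[OF P(1) smooth_on_continuous[OF that]])
    have L1: "Linf_norm ?O ut \<le> ereal C"
    proof (rule Linf_norm_le)
      show "ut \<in> borel_measurable (lebesgue_on ?O)" unfolding ut_def
        by (intro borel_imp_lebesgue_on m smooth_on_dir_deriv est(1))
      show "norm (ut z) \<le> C" for z using est(2)[of z] C0 by (auto simp: ut_def indicator_def)
    qed
    have Hb: "norm (H z) \<le> ?n * ?n * C" for z
      by (rule norm_matrix_le) (use est(4)[of z] C0 in \<open>auto simp: H_def indicator_def\<close>)
    have Hm: "(\<lambda>z. norm (H z)) \<in> borel_measurable borel"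
    proof -
      have "norm (H z) = sqrt (\<Sum>i\<in>UNIV. \<Sum>j\<in>UNIV. (indicator P z * dir_deriv (space_dir j) (dir_deriv (space_dir i) u) z)\<^sup>2)" for z
        by (simp add: norm_vec_def L2_set_def H_def sum_nonneg)
      moreover have "(\<lambda>z. sqrt (\<Sum>i\<in>UNIV. \<Sum>j\<in>UNIV. (indicator P z * dir_deriv (space_dir j) (dir_deriv (space_dir i) u) z)\<^sup>2)) \<in> borel_measurable borel"
        by (intro borel_measurable_sqrt[THEN measurable_compose[rotated]] borel_measurable_sum borel_measurable_power m smooth_on_dir_deriv est(1))
      ultimately show ?thesis by simp
    qed
    have L2: "Linf_norm ?O H \<le> ereal (?n * ?n * C)"
    proof -
      \<comment> \<open>The essential supremum sees only the pointwise norm, so measurability of a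
        scalar function suffices.\<close>
      have "Linf_norm ?O H = Linf_norm ?O (\<lambda>z. norm (H z))" by (simp add: Linf_norm_def)
      also have "\<dots> \<le> ereal (?n * ?n * C)" by (rule Linf_norm_le[OF borel_imp_lebesgue_on[OF Hm]]) (use Hb in simp)
      finally show ?thesis .
    qed
    have "Linf_norm ?O ut + Linf_norm ?O H \<le> ereal C + ereal (?n * ?n * C)" by (rule add_mono[OF L1 L2])
    also have "\<dots> \<le> ereal D" using D(2) by simp
    finally have L: "Linf_norm ?O ut + Linf_norm ?O H \<le> ereal D" .
    have G: "\<exists>g. GDERIV (\<lambda>x. u (x, \<tau>)) y :> g \<and> norm g \<le> D * Sup {\<rho>. \<rho> > 0 \<and> parabolic_cylinder \<rho> (y, \<tau>) \<subseteq> positivity_set u}"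
      if z: "(y, \<tau>) \<in> positivity_set u \<inter> ?O" for y \<tau>
    proof (intro exI conjI)
      have zP: "(y, \<tau>) \<in> P" using z by (simp add: P_def)
      show "GDERIV (\<lambda>x. u (x, \<tau>)) y :> (\<chi> i. dir_deriv (space_dir i) u (y, \<tau>))"
        by (rule gderiv_slice[OF smooth_on_differentiable[OF est(1) zP]])
      let ?S = "Sup (radii u (y, \<tau>))"
      have S: "?S > 0" using radii_props(3)[OF u(1)] z by blast
      have "norm (\<chi> i. dir_deriv (space_dir i) u (y, \<tau>)) \<le> (\<Sum>i\<in>(UNIV::'n set). \<bar>dir_deriv (space_dir i) u (y, \<tau>)\<bar>)"
        using norm_le_l1_cart[of "\<chi> i. dir_deriv (space_dir i) u (y, \<tau>)"] by simp
      also have "\<dots> \<le> (\<Sum>i\<in>(UNIV::'n set). C * ?S)" by (intro sum_mono est(3)[OF zP])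
      also have "\<dots> = (?n * C) * ?S" by simp
      also have "\<dots> \<le> D * ?S" using D(3) S by (intro mult_right_mono) auto
      finally show "norm (\<chi> i. dir_deriv (space_dir i) u (y, \<tau>)) \<le> D * Sup {\<rho>. \<rho> > 0 \<and> parabolic_cylinder \<rho> (y, \<tau>) \<subseteq> positivity_set u}"
        by (simp add: radii_def)
    qed
    show ?thesis using w1 w2 L G by blast
  qed
  show ?thesis
  proof (intro exI[of _ D] conjI allI impI D(1))
    fix f u :: "'n spacetime \<Rightarrow> real"
    assume h: "f \<in> borel_measurable (lebesgue_on (Q0 1)) \<and>
      (AE z in lebesgue_on (Q0 1). f z \<le> 0) \<and>
      Linf_norm (Q0 1) f \<le> ereal K \<and>
      continuous_on (Q0 1) u \<and>
      (\<forall>z \<in> Q0 1. u z \<ge> 0) \<and>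
      weak_heat_solution (Q0 1) f u \<and>
      Linf_norm (Q0 1) u \<le> ereal K \<and>
      (\<exists>c. AE z in lebesgue_on (positivity_set u \<inter> Q0 1). f z = c)"
    then obtain c where "AE z in lebesgue_on (positivity_set u \<inter> Q0 1). f z = c" by blast
    then obtain c' where ad: "admissible K u c'" using hypotheses_admissible[OF assms, of f u c] h by blast
    show "\<exists>ut H. has_weak_time_deriv (Q0 (1/2)) u ut \<and>
            has_weak_hessian (Q0 (1/2)) u H \<and>
            Linf_norm (Q0 (1/2)) ut + Linf_norm (Q0 (1/2)) H \<le> ereal D"
      using main[OF ad] by blast
    show "\<exists>g. GDERIV (\<lambda>x. u (x, \<tau>)) y :> g \<and>
            norm g \<le> D * Sup {\<rho>. \<rho> > 0 \<and> parabolic_cylinder \<rho> (y, \<tau>) \<subseteq> positivity_set u}"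
      if "(y, \<tau>) \<in> positivity_set u \<inter> Q0 (1/2)" for y \<tau>
      using main[OF ad] that by blast
  qed
qed

end
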